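(* Suppose that $f$ is a subnormal meromorphic function in $\mathbb{C}$ such that $\Delta f\not\equiv0$. Let $q\ge2$ and let $a_1,\dots,a_q\in\mathbb{C}$ be distinct constants. Then $$(q-1)T(r,f)\le \overline{N}_\Delta(r,f)+\sum_{k=1}^q\overline{N}_\Delta\Big(r,\frac{1}{f-a_k}\Big)+S(r,f),$$ where the exceptional set $E$ associated with $S(r,f)$ is of zero upper density.
   Context: $\Delta f(z)=f(z+1)-f(z)$. $T(r,f)$ is the Nevanlinna characteristic. $f$ is subnormal if $\limsup_{r\to\infty}\frac{\log T(r,f)}{r}=0$. $S(r,f)$ denotes a quantity that is $o(T(r,f))$ as $r\to\infty$ outside an exceptional set $E\subset[1,\infty)$; the upper density of $E$ is $\limsup_{r\to\infty}\frac1r\int_{E\cap[1,r]}dt$. Counting functions. For meromorphic $f\not\equiv a$ ($a\in\mathbb{C}$) let $\mathrm{ord}_w(f-a)$ be the multiplicity of $w$ as a zero of $f-a$ ($0$ if it is not a zero), and let $\mathrm{ord}^-_w(f)$ be the multiplicity of $w$ as a pole of $f$ ($0$ if it is not a pole). Set $$\overline{n}_\Delta\Big(r,\frac1{f-a}\Big)=\sum_{|w|\le r}\Big(\mathrm{ord}_w(f-a)-\min\{\mathrm{ord}_w(f-a),\mathrm{Ord}_{w-1}(f-a)\}\Big),$$ $$\overline{n}_\Delta(r,f)=\sum_{|w|\le r}\Big(\mathrm{ord}^-_w(f)-\min\{\mathrm{ord}^-_w(f),\mathrm{Ord}^-_{w+1}(f)\}\Big),$$ where $\mathrm{Ord}_{w-1}(f-a)$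 equals $\mathrm{ord}_{w-1}(f-a)$ if $|w-1|\le r$ and $0$ otherwise, and $\mathrm{Ord}^-_{w+1}(f)$ equals $\mathrm{ord}^-_{w+1}(f)$ if $|w+1|\le r$ and $0$ otherwise. For $\ast=f$ or $\ast=\frac1{f-a}$, $$\overline{N}_\Delta(r,\ast)=\int_0^r\frac{\overline{n}_\Delta(t,\ast)-\overline{n}_\Delta(0,\ast)}{t}\,dt+\overline{n}_\Delta(0,\ast)\log r.$$ *)

theory Defs
  imports "HOL-Complex_Analysis.Complex_Analysis" "HOL-Library.Landau_Symbols"
begin

text \<open>
  A meromorphic function is represented, as in the library, by a total function
  that is \<^const>\<open>meromorphic_on\<close> \<^term>\<open>UNIV\<close>; its values at a sparse set of points
  (the poles in particular) carry no information. None of the notions below depends on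
  these values: orders are defined through punctured neighbourhoods, circles meet a sparse set
  in finitely many points, and identities between meromorphic functions are
  required up to a sparse set (filter \<^term>\<open>cosparse UNIV\<close>).
\<close>

definition fwd_diff :: "(complex \<Rightarrow> complex) \<Rightarrow> complex \<Rightarrow> complex" where
  "fwd_diff f z = f (z + 1) - f z"

definition zero_order :: "(complex \<Rightarrow> complex) \<Rightarrow> complex \<Rightarrow> nat" where
  "zero_order g w = (if isolated_zero g w then nat (zorder g w) else 0)"

definition pole_order :: "(complex \<Rightarrow> complex) \<Rightarrow> complex \<Rightarrow> nat" where
  "pole_order g w = (if is_pole g w then nat (- zorder g w) else 0)"

definition integrated_count :: "(real \<Rightarrow> real) \<Rightarrow> real \<Rightarrow> real" where
  "integrated_count n r = integral {0..r} (\<lambda>t. (n t - n 0) / t) + n 0 * ln r"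


subsection \<open>Nevanlinna characteristic\<close>

definition log_plus :: "real \<Rightarrow> real" where
  "log_plus x = (if x \<le> 1 then 0 else ln x)"

definition proximity :: "real \<Rightarrow> (complex \<Rightarrow> complex) \<Rightarrow> real" where
  "proximity r f =
     integral {0..2 * pi} (\<lambda>\<theta>. log_plus (norm (f (of_real r * cis \<theta>)))) / (2 * pi)"

definition pole_count :: "(complex \<Rightarrow> complex) \<Rightarrow> real \<Rightarrow> real" where
  "pole_count f r = (\<Sum>w | norm w \<le> r \<and> is_pole f w. real (pole_order f w))"

definition characteristic :: "real \<Rightarrow> (complex \<Rightarrow> complex) \<Rightarrow> real" where
  "characteristic r f = proximity r f + integrated_count (pole_count f) r"

definition subnormal :: "(complex \<Rightarrow> complex) \<Rightarrow> bool" where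
  "subnormal f \<longleftrightarrow> Limsup at_top (\<lambda>r. ereal (ln (characteristic r f) / r)) = 0"


subsection \<open>Difference counting functions\<close>

text \<open>
  The sums range over the zeros (poles) only, so that the index set is finite for
  nonconstant \<^term>\<open>f\<close>; all other points of the disc would contribute 0.
\<close>

definition n_Delta_zero :: "(complex \<Rightarrow> complex) \<Rightarrow> complex \<Rightarrow> real \<Rightarrow> real" where
  "n_Delta_zero f a r =
     (let ord = zero_order (\<lambda>z. f z - a);
          Ord = (\<lambda>w. if norm w \<le> r then ord w else 0)
      in \<Sum>w | norm w \<le> r \<and> isolated_zero (\<lambda>z. f z - a) w.
           real (ord w) - real (min (ord w) (Ord (w - 1))))"

definition n_Delta_pole :: "(complex \<Rightarrow> complex) \<Rightarrow> real \<Rightarrow> real" where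
  "n_Delta_pole f r =
     (let ord = pole_order f;
          Ord = (\<lambda>w. if norm w \<le> r then ord w else 0)
      in \<Sum>w | norm w \<le> r \<and> is_pole f w.
           real (ord w) - real (min (ord w) (Ord (w + 1))))"

definition N_Delta_zero :: "real \<Rightarrow> (complex \<Rightarrow> complex) \<Rightarrow> complex \<Rightarrow> real" where
  "N_Delta_zero r f a = integrated_count (n_Delta_zero f a) r"

definition N_Delta_pole :: "real \<Rightarrow> (complex \<Rightarrow> complex) \<Rightarrow> real" where
  "N_Delta_pole r f = integrated_count (n_Delta_pole f) r"


subsection \<open>Error terms\<close>

definition upper_density :: "real set \<Rightarrow> ereal" where
  "upper_density E = Limsup at_top (\<lambda>r. ereal (measure lebesgue (E \<inter> {1..r}) / r))"

text \<open>
  \<^term>\<open>S\<close> is a quantity \<open>S(r,f)\<close> with exceptional set \<^term>\<open>E\<close>; on \<^term>\<open>E\<close> it is unrestricted.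
\<close>

definition small_error :: "(complex \<Rightarrow> complex) \<Rightarrow> real set \<Rightarrow> (real \<Rightarrow> real) \<Rightarrow> bool" where
  "small_error f E S \<longleftrightarrow> E \<subseteq> {1..} \<and> E \<in> sets lebesgue \<and>
     S \<in> o[inf at_top (principal (- E))](\<lambda>r. characteristic r f)"

end

theory Submission
  imports Defs
begin

text \<open>
  The proof is the classical derivation of Nevanlinna's second main theorem with the derivative
  replaced by the difference \<open>\<Delta>f\<close>. If \<open>f(z)\<close> is close to one of the targets \<open>a\<^sub>k\<close>, then
  \<open>\<Delta>f(z) = (f(z) - a\<^sub>k) \<cdot> (\<Delta>f(z) / (f(z) - a\<^sub>k))\<close> is small, unless the quotient is large; so the
  proximity of \<open>f\<close> to all targets together is at most the proximity of \<open>\<Delta>f\<close> to \<open>0\<close> plus the means of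
  \<open>log\<^sup>+ |\<Delta>f / (f - a\<^sub>k)|\<close>. Jensen's formula turns the proximity of \<open>\<Delta>f\<close> to \<open>0\<close> into a count of its
  divisor. A zero of \<open>f - a\<^sub>k\<close> shared by \<open>w\<close> and \<open>w + 1\<close> is a zero of \<open>\<Delta>f\<close>, and the poles of \<open>\<Delta>f\<close> are
  no worse than those of \<open>f\<close> at the two points (\<open>zorder_fwd_diff_lower\<close>). Exactly these shared points
  are what the counting functions \<open>N\<^sub>\<Delta>\<close> leave out, and the inequality follows, up to an error
  consisting of the means of the logarithmic differences and of a shift of the pole count by \<open>1\<close>
  (\<open>second_main_inequality\<close>).

  The analytic core is the bound for the mean of \<open>|log |g(z+1)| - log |g(z)||\<close> on \<open>|z| = r\<close>, with
  \<open>g = f - a\<^sub>k\<close>. The Poisson-Jensen formula is applied in the disc of a fixed radius \<open>\<alpha>\<close> around \<open>z\<close>,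
  not in a disc around the origin. The Poisson kernels at the centre and at distance \<open>1\<close> from it
  differ by \<open>O(1/\<alpha>)\<close>, and the mean over \<open>z\<close> of the mean of \<open>|log |g||\<close> over the small circle around \<open>z\<close>
  is at most \<open>2 T(r+\<alpha>) + O(1)\<close>, because rotating the small circle along with \<open>z\<close> turns the iterated
  mean into a mean of circle means about the origin. Each zero or pole contributes at most a
  constant times \<open>\<surd>\<alpha> / r\<close> to the mean, and the disc of radius \<open>r + \<alpha>\<close> contains \<open>O(r/\<alpha>) \<cdot> T(r+2\<alpha>)\<close> of
  them. Altogether the mean is at most \<open>O(1/\<surd>\<alpha>) \<cdot> T(r+3\<alpha>) + O(1)\<close> (\<open>difference_estimate\<close>).

  Subnormality enters only through the growth of \<open>T\<close>: since \<open>log T(r) = o(r)\<close>, one has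
  \<open>T(r+3\<alpha>) \<le> 2 T(r)\<close> outside a set of zero upper density
  (\<open>slow_growth_outside_zero_density\<close>). Hence for each \<open>\<delta> > 0\<close> a suitable \<open>\<alpha>\<close> makes the error at most
  \<open>\<delta> T(r)\<close> outside such a set, and a diagonal choice over \<open>\<delta> \<rightarrow> 0\<close> yields a single exceptional set
  (\<open>diagonal_zero_density\<close>). Radii of circles that meet a zero or a pole of one of the functions
  involved form a countable set and are put into the exceptional set as well; on all other circles
  the integrands are continuous.
\<close>

section \<open>The positive part of the logarithm and circle means\<close>

lemma log_plus_eq: "log_plus x = ln (max 1 x)"
  by (auto simp: log_plus_def max_def)

lemma log_plus_nonneg: "0 \<le> log_plus x"
  by (simp add: log_plus_def)

lemma ln_le_log_plus: "0 < x \<Longrightarrow> ln x \<le> log_plus x"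
  by (simp add: log_plus_def)

lemma log_plus_le: "0 < x \<Longrightarrow> ln x \<le> y \<Longrightarrow> 0 \<le> y \<Longrightarrow> log_plus x \<le> y"
  by (simp add: log_plus_def)

lemma log_plus_diff_inverse: "0 < x \<Longrightarrow> log_plus x - log_plus (inverse x) = ln x"
  by (auto simp: log_plus_def ln_inverse inverse_le_1_iff one_le_inverse_iff)

lemma abs_ln_eq_log_plus: "0 < x \<Longrightarrow> \<bar>ln x\<bar> = log_plus x + log_plus (inverse x)"
  by (auto simp: log_plus_def ln_inverse inverse_le_1_iff one_le_inverse_iff)

lemma continuous_on_log_plus [continuous_intros]:
  "continuous_on A f \<Longrightarrow> continuous_on A (\<lambda>x. log_plus (f x))"
  unfolding log_plus_eq by (intro continuous_intros) auto

lemma log_plus_mono: "x \<le> y \<Longrightarrow> log_plus x \<le> log_plus y"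
  by (auto simp: log_plus_eq)

lemma log_plus_mult: "0 \<le> x \<Longrightarrow> 0 \<le> y \<Longrightarrow> log_plus (x * y) \<le> log_plus x + log_plus y"
proof -
  assume xy: "0 \<le> x" "0 \<le> y"
  have "max 1 (x * y) \<le> max 1 x * max 1 y"
    using xy mult_mono[of x "max 1 x" y "max 1 y"] mult_mono[of 1 "max 1 x" 1 "max 1 y"] by auto
  then have "ln (max 1 (x * y)) \<le> ln (max 1 x * max 1 y)" by (subst ln_le_cancel_iff) (auto intro!: mult_pos_pos)
  also have "\<dots> = ln (max 1 x) + ln (max 1 y)" by (rule ln_mult_pos) auto
  finally show ?thesis by (simp add: log_plus_eq)
qed

lemma log_plus_add: "0 \<le> x \<Longrightarrow> 0 \<le> y \<Longrightarrow> log_plus (x + y) \<le> log_plus x + log_plus y + ln 2"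
proof -
  assume xy: "0 \<le> x" "0 \<le> y"
  have "log_plus (x + y) \<le> log_plus (2 * max x y)" by (rule log_plus_mono) auto
  also have "\<dots> \<le> log_plus 2 + log_plus (max x y)" using xy by (intro log_plus_mult) auto
  also have "log_plus (max x y) \<le> log_plus x + log_plus y"
    using log_plus_nonneg[of x] log_plus_nonneg[of y] by (auto simp: max_def)
  finally show ?thesis by (simp add: log_plus_def)
qed

lemma log_plus_norm_minus:
  "log_plus (norm (x - a)) \<le> log_plus (norm x) + (log_plus (norm a) + ln 2)"
  using log_plus_mono[OF norm_triangle_ineq4[of x a]] log_plus_add[of "norm x" "norm a"] by simp

lemma log_plus_ratio:
  assumes "x \<noteq> a" "y \<noteq> a"
  shows "log_plus (norm (y - x) / norm (x - a)) \<le> \<bar>ln (norm (y - a)) - ln (norm (x - a))\<bar> + ln 2"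
proof -
  define L where "L = \<bar>ln (norm (y - a)) - ln (norm (x - a))\<bar>"
  have p: "0 < norm (x - a)" "0 < norm (y - a)" using assms by auto
  have "norm (y - x) \<le> norm (y - a) + norm (x - a)"
    using norm_triangle_ineq4[of "y - a" "x - a"] by simp
  then have "norm (y - x) / norm (x - a) \<le> norm (y - a) / norm (x - a) + 1"
    using p by (simp add: field_simps)
  also have "norm (y - a) / norm (x - a) = exp (ln (norm (y - a)) - ln (norm (x - a)))"
    using p by (simp add: exp_diff)
  also have "\<dots> \<le> exp L" by (simp add: L_def)
  also have "exp L + 1 \<le> 2 * exp L" by (simp add: L_def)
  finally have "log_plus (norm (y - x) / norm (x - a)) \<le> log_plus (2 * exp L)"
    by (intro log_plus_mono) simp
  also have "\<dots> \<le> log_plus 2 + log_plus (exp L)" by (rule log_plus_mult) auto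
  also have "\<dots> = L + ln 2" by (simp add: log_plus_def L_def)
  finally show ?thesis by (simp add: L_def)
qed

definition circle_mean :: "(complex \<Rightarrow> real) \<Rightarrow> real \<Rightarrow> real" where
  "circle_mean u r = integral {0..2*pi} (\<lambda>\<theta>. u (of_real r * cis \<theta>)) / (2*pi)"

lemma circle_mean_mono:
  assumes "(\<lambda>t. u (of_real r * cis t)) integrable_on {0..2*pi}" "(\<lambda>t. v (of_real r * cis t)) integrable_on {0..2*pi}"
    and "\<And>t. u (of_real r * cis t) \<le> v (of_real r * cis t)"
  shows "circle_mean u r \<le> circle_mean v r"
  unfolding circle_mean_def using assms by (intro divide_right_mono integral_le) auto

lemma circle_mean_add:
  assumes "(\<lambda>t. u (of_real r * cis t)) integrable_on {0..2*pi}" "(\<lambda>t. v (of_real r * cis t)) integrable_on {0..2*pi}"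
  shows "circle_mean (\<lambda>z. u z + v z) r = circle_mean u r + circle_mean v r"
  using integral_add[OF assms] by (simp add: circle_mean_def add_divide_distrib)

lemma circle_mean_sum:
  assumes "finite K" "\<And>k. k \<in> K \<Longrightarrow> (\<lambda>t. u k (of_real r * cis t)) integrable_on {0..2*pi}"
  shows "circle_mean (\<lambda>z. \<Sum>k\<in>K. u k z) r = (\<Sum>k\<in>K. circle_mean (u k) r)"
  using integral_sum[OF assms] by (simp add: circle_mean_def sum_divide_distrib)

lemma circle_mean_cmult: "circle_mean (\<lambda>z. c * u z) r = c * circle_mean u r"
  by (simp add: circle_mean_def)

lemma circle_mean_const: "circle_mean (\<lambda>z. c) r = c"
  by (simp add: circle_mean_def)

section \<open>The Poisson formula\<close>

definition poisson_kernel :: "complex \<Rightarrow> complex \<Rightarrow> real" where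
  "poisson_kernel \<xi> w = ((norm w)\<^sup>2 - (norm \<xi>)\<^sup>2) / (norm (w - \<xi>))\<^sup>2"

lemma poisson_kernel_complex:
  assumes "w \<noteq> \<xi>"
  shows "complex_of_real (poisson_kernel \<xi> w) = w / (w - \<xi>) + cnj \<xi> / (cnj w - cnj \<xi>)"
proof -
  have nz: "w - \<xi> \<noteq> 0" "cnj w - cnj \<xi> \<noteq> 0"
    using assms complex_cnj_cancel_iff by auto
  have "complex_of_real (poisson_kernel \<xi> w) = (w * cnj w - \<xi> * cnj \<xi>) / ((w - \<xi>) * (cnj w - cnj \<xi>))"
    by (simp add: poisson_kernel_def complex_norm_square del: of_real_power flip: of_real_power)
  also have "\<dots> = w / (w - \<xi>) + cnj \<xi> / (cnj w - cnj \<xi>)"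
    using nz by (simp add: divide_simps) (simp add: algebra_simps)
  finally show ?thesis .
qed

text \<open>
  On the circle of radius \<open>R\<close> the Poisson kernel is the sum of \<open>w / (w - \<xi>)\<close>, the Cauchy kernel with
  respect to the angle, and of the function \<open>w \<mapsto> w \<cdot> cnj \<xi> / (R\<^sup>2 - cnj \<xi> \<cdot> w)\<close>, which is holomorphic beyond the circle. The former
  reproduces \<open>h \<xi>\<close> by Cauchy's integral formula, the latter contributes nothing by Cauchy's theorem.
\<close>

lemma poisson_holomorphic:
  assumes h: "h holomorphic_on ball 0 \<rho>" and R: "0 < R" "R < \<rho>" and xi: "norm \<xi> < R"
  shows "((\<lambda>\<theta>. Re (h (of_real R * cis \<theta>)) * poisson_kernel \<xi> (of_real R * cis \<theta>))
           has_integral 2 * pi * Re (h \<xi>)) {0..2*pi}"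
proof -
  define k where "k w = cnj \<xi> / (of_real (R\<^sup>2) - cnj \<xi> * w)" for w
  \<comment> \<open>A radius slightly larger than \<open>R\<close> at which \<open>k\<close> has no pole yet.\<close>
  obtain \<sigma> where \<sigma>: "R < \<sigma>" "\<sigma> \<le> \<rho>" "norm \<xi> * \<sigma> < R\<^sup>2"
  proof (cases "\<xi> = 0")
    case True
    then show ?thesis using R that[of \<rho>] by auto
  next
    case False
    have "R < R\<^sup>2 / norm \<xi>"
      using xi R False by (simp add: power2_eq_square field_simps)
    then obtain s where "R < s" "s < R\<^sup>2 / norm \<xi>" using dense by blast
    show ?thesis
    proof -
      have "s * norm \<xi> < R\<^sup>2"
        using \<open>s < R\<^sup>2 / norm \<xi>\<close> False by (simp add: pos_less_divide_eq)
      moreover have "min s \<rho> * norm \<xi> \<le> s * norm \<xi>"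
        by (intro mult_right_mono) auto
      ultimately show ?thesis
        using R that[of "min s \<rho>"] \<open>R < s\<close> by (auto simp: mult.commute)
    qed
  qed
  have nz: "of_real (R\<^sup>2) - cnj \<xi> * w \<noteq> 0" if "w \<in> ball 0 \<sigma>" for w
  proof
    assume "of_real (R\<^sup>2) - cnj \<xi> * w = 0"
    then have "norm (of_real (R\<^sup>2) :: complex) = norm (cnj \<xi> * w)" by simp
    then have "R\<^sup>2 = norm \<xi> * norm w" by (simp add: norm_mult norm_power)
    moreover have "norm \<xi> * norm w \<le> norm \<xi> * \<sigma>"
      using that by (intro mult_left_mono) auto
    ultimately show False using \<sigma> by simp
  qed
  have c1: "((\<lambda>w. h w / (w - \<xi>)) has_contour_integral (2 * of_real pi * \<i> * h \<xi>)) (circlepath 0 R)"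
    by (rule Cauchy_integral_circlepath)
       (use h R xi in \<open>auto intro!: holomorphic_on_imp_continuous_on elim!: holomorphic_on_subset\<close>)
  have c2: "((\<lambda>w. h w * k w) has_contour_integral 0) (circlepath 0 R)"
  proof (rule Cauchy_theorem_disc_simple[where a=0 and e=\<sigma>])
    show "(\<lambda>w. h w * k w) holomorphic_on ball 0 \<sigma>"
      unfolding k_def using \<sigma> nz
      by (intro holomorphic_intros holomorphic_on_subset[OF h]) auto
  qed (use R \<sigma> in \<open>auto simp: path_image_circlepath\<close>)
  have c3: "((\<lambda>w. h w / (w - \<xi>) + h w * k w) has_contour_integral (2 * of_real pi * \<i> * h \<xi>))
              (part_circlepath 0 R 0 (2*pi))"
    using has_contour_integral_add[OF c1 c2] unfolding circlepath_def by simp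
  then have "((\<lambda>t. (h (R * cis t) / (R * cis t - \<xi>) + h (R * cis t) * k (R * cis t)) * R * \<i> * cis t)
        has_integral (2 * of_real pi * \<i> * h \<xi>)) {0..2*pi}"
    using has_contour_integral_part_circlepath_iff[of 0 "2*pi"] R by simp
  then have "((\<lambda>t. h (R * cis t) * of_real (poisson_kernel \<xi> (R * cis t)) * \<i>)
        has_integral (2 * of_real pi * \<i> * h \<xi>)) {0..2*pi}"
  proof (rule has_integral_eq[rotated])
    fix t :: real
    define w where "w = R * cis t"
    have nw: "norm w = R" using R by (simp add: w_def norm_mult)
    then have ne: "w \<noteq> \<xi>" "w \<noteq> 0" using xi R by auto
    have ww: "w * cnj w = of_real (R\<^sup>2)"
      using nw by (metis complex_norm_square)
    have "k w * w = cnj \<xi> / (cnj w - cnj \<xi>)"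
    proof -
      have "k w = cnj \<xi> / (w * (cnj w - cnj \<xi>))"
        unfolding k_def ww[symmetric] by (simp add: algebra_simps)
      then show ?thesis using ne by simp
    qed
    moreover have "(h w / (w - \<xi>) + h w * k w) * w = h w * (w / (w - \<xi>) + k w * w)"
      by (simp add: algebra_simps)
    ultimately have "(h w / (w - \<xi>) + h w * k w) * w = h w * poisson_kernel \<xi> w"
      unfolding poisson_kernel_complex[OF ne(1)] by simp
    then show "(h (R * cis t) / (R * cis t - \<xi>) + h (R * cis t) * k (R * cis t)) * R * \<i> * cis t
        = h (R * cis t) * of_real (poisson_kernel \<xi> (R * cis t)) * \<i>"
      unfolding w_def[symmetric] by (metis mult.assoc mult.commute w_def)
  qed
  from has_integral_mult_left[OF this, of "-\<i>"]
  have "((\<lambda>t. h (R * cis t) * of_real (poisson_kernel \<xi> (R * cis t)))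
        has_integral (2 * of_real pi * h \<xi>)) {0..2*pi}"
    by (simp add: algebra_simps)
  from has_integral_linear[OF this bounded_linear_Re]
  show ?thesis by (simp add: o_def)
qed

lemma poisson_log_outside:
  assumes "0 < R" "R < norm b" "norm \<xi> < R"
  shows "((\<lambda>\<theta>. ln (norm (of_real R * cis \<theta> - b)) * poisson_kernel \<xi> (of_real R * cis \<theta>))
           has_integral 2 * pi * ln (norm (\<xi> - b))) {0..2*pi}"
proof -
  have b: "b \<noteq> 0" using assms by auto
  define h where "h w = Ln (1 - w / b) + of_real (ln (norm b))" for w
  have pos: "Re (1 - w / b) > 0" if "norm w < norm b" for w
  proof -
    have "norm (w / b) < 1" using that b by (simp add: norm_divide)
    then show ?thesis using abs_Re_le_cmod[of "w/b"] by simp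
  qed
  have hol: "h holomorphic_on ball 0 (norm b)"
    unfolding h_def using pos b
    by (intro holomorphic_intros) (auto simp: complex_nonpos_Reals_iff dest: pos)
  have Reh: "Re (h w) = ln (norm (w - b))" if "norm w < norm b" for w
  proof -
    have "1 - w / b \<noteq> 0" using pos[OF that] by auto
    then have "Re (h w) = ln (norm (1 - w / b)) + ln (norm b)" by (simp add: h_def)
    also have "\<dots> = ln (norm (1 - w / b) * norm b)"
      using b \<open>1 - w / b \<noteq> 0\<close> by (simp add: ln_mult)
    also have "norm (1 - w / b) * norm b = norm (w - b)"
    proof -
      have "norm (1 - w / b) * norm b = norm ((1 - w / b) * b)" by (simp add: norm_mult)
      also have "(1 - w / b) * b = b - w" using b by (simp add: algebra_simps)
      finally show ?thesis by (simp add: norm_minus_commute)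
    qed
    finally show ?thesis .
  qed
  have "((\<lambda>\<theta>. Re (h (of_real R * cis \<theta>)) * poisson_kernel \<xi> (of_real R * cis \<theta>))
           has_integral 2 * pi * Re (h \<xi>)) {0..2*pi}"
    by (rule poisson_holomorphic[OF hol]) (use assms in auto)
  then show ?thesis using assms by (simp add: Reh norm_mult)
qed

text \<open>
  On the circle, \<open>|w - b|\<close> agrees up to the factor \<open>|b| / R\<close> with the distance of \<open>w\<close> to the mirror image
  of \<open>b\<close>, which lies outside.
\<close>

lemma poisson_log_inside:
  assumes "0 < R" "norm b < R" "norm \<xi> < R"
  shows "((\<lambda>\<theta>. ln (norm (of_real R * cis \<theta> - b)) * poisson_kernel \<xi> (of_real R * cis \<theta>))
           has_integral 2 * pi * ln (norm (of_real R - cnj b * \<xi> / of_real R))) {0..2*pi}"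
proof (cases "b = 0")
  case True
  have "((\<lambda>\<theta>. Re (of_real (ln R)) * poisson_kernel \<xi> (of_real R * cis \<theta>))
           has_integral 2 * pi * Re (of_real (ln R))) {0..2*pi}"
    by (rule poisson_holomorphic[where \<rho>="R+1" and h="\<lambda>_. of_real (ln R)"]) (use assms in auto)
  then show ?thesis using assms True by (simp add: norm_mult)
next
  case False
  \<comment> \<open>The mirror image of \<open>b\<close> in the circle.\<close>
  define b' where "b' = of_real (R\<^sup>2) / cnj b"
  have b': "R < norm b'" using False assms
    by (simp add: b'_def norm_divide norm_mult norm_power power2_eq_square pos_less_divide_eq)
  have eq: "ln (norm (of_real R * cis t - b)) = ln (norm (of_real R * cis t - b')) + ln (norm b / R)" for t
  proof -
    define w where "w = of_real R * cis t"
    have nw: "norm w = R" using assms by (simp add: w_def norm_mult)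
    have ww: "cnj w * w = of_real (R\<^sup>2)"
      using nw by (metis complex_norm_square mult.commute)
    have "w - b' = - w * cnj (w - b) / cnj b"
      using False unfolding b'_def ww[symmetric] by (simp add: field_simps)
    then have "norm (w - b') = R * norm (w - b) / norm b"
      by (simp add: norm_mult norm_divide nw del: complex_cnj_diff)
    moreover have "norm (w - b) > 0" using nw assms by auto
    ultimately show ?thesis
      using assms False b' unfolding w_def[symmetric] by (simp add: ln_mult ln_div)
  qed
  have 1: "((\<lambda>\<theta>. Re (of_real (ln (norm b / R))) * poisson_kernel \<xi> (of_real R * cis \<theta>))
           has_integral 2 * pi * Re (of_real (ln (norm b / R)))) {0..2*pi}"
    by (rule poisson_holomorphic[where \<rho>="R+1" and h="\<lambda>_. of_real (ln (norm b / R))"]) (use assms in auto)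
  have val: "ln (norm (\<xi> - b')) + ln (norm b / R) = ln (norm (of_real R - cnj b * \<xi> / of_real R))"
  proof -
    have "norm (\<xi> - b') * (norm b / R) = norm ((\<xi> - b') * cnj b / of_real R)"
      using assms by (simp add: norm_mult norm_divide)
    also have "(\<xi> - b') * cnj b / of_real R = - (of_real R - cnj b * \<xi> / of_real R)"
      using False assms unfolding b'_def by (simp add: field_simps power2_eq_square)
    finally have "norm (\<xi> - b') * (norm b / R) = norm (of_real R - cnj b * \<xi> / of_real R)"
      by (simp only: norm_minus_cancel)
    moreover have "norm (\<xi> - b') > 0" using b' assms by auto
    ultimately show ?thesis
      using False assms ln_mult[of "norm (\<xi> - b')" "norm b / R"] by simp
  qed
  show ?thesis
    using has_integral_add[OF poisson_log_outside[OF assms(1) b' assms(3)] 1]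
    by (simp add: eq distrib_right distrib_left flip: val)
qed

section \<open>Zeros and poles of meromorphic functions\<close>

text \<open>
  This set contains the zeros and poles of \<open>g\<close>, and also the removable singularities at which the
  total function \<open>g\<close> has an arbitrary value. Outside of it \<open>g\<close> is analytic and nonzero.
\<close>

definition singular_set :: "(complex \<Rightarrow> complex) \<Rightarrow> complex set" where
  "singular_set g = {z. \<not> (g analytic_on {z} \<and> g z \<noteq> 0)}"

definition nonzero_meromorphic :: "(complex \<Rightarrow> complex) \<Rightarrow> bool" where
  "nonzero_meromorphic g \<longleftrightarrow> g meromorphic_on UNIV \<and> eventually (\<lambda>z. g z \<noteq> 0) (cosparse UNIV)"

lemma nonzero_meromorphicD:
  assumes "nonzero_meromorphic g"
  shows "g meromorphic_on {z}" "eventually (\<lambda>z. g z \<noteq> 0) (at z)" "frequently (\<lambda>z. g z \<noteq> 0) (at z)"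
    "isolated_singularity_at g z" "not_essential g z"
proof -
  show 1: "g meromorphic_on {z}"
    using assms meromorphic_on_subset unfolding nonzero_meromorphic_def by blast
  show 2: "eventually (\<lambda>z. g z \<noteq> 0) (at z)"
    using assms eventually_cosparse_imp_eventually_at[of "\<lambda>z. g z \<noteq> 0" UNIV z UNIV]
    unfolding nonzero_meromorphic_def by auto
  then show "frequently (\<lambda>z. g z \<noteq> 0) (at z)"
    by (simp add: eventually_frequently)
  show "isolated_singularity_at g z" "not_essential g z"
    using 1 by (auto simp: meromorphic_at_iff)
qed

lemma sparse_singular_set: "nonzero_meromorphic g \<Longrightarrow> singular_set g sparse_in UNIV"
proof -
  assume g: "nonzero_meromorphic g"
  have "eventually (\<lambda>z. g analytic_on {z} \<and> g z \<noteq> 0) (cosparse UNIV)"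
    using g meromorphic_on_imp_analytic_cosparse[of g UNIV]
    by (auto simp: nonzero_meromorphic_def intro: eventually_conj)
  then show ?thesis by (simp add: eventually_cosparse singular_set_def)
qed

lemma finite_singular_set:
  assumes "nonzero_meromorphic g"
  shows "finite {b \<in> singular_set g. norm b \<le> R}"
proof -
  have "finite (singular_set g \<inter> cball 0 R)"
    using sparse_in_compact_finite[of "singular_set g" "cball 0 R"]
      sparse_in_subset[OF sparse_singular_set[OF assms], of "cball 0 R"]
    by (auto simp: Int_commute)
  then show ?thesis by (rule rev_finite_subset) auto
qed

lemma countable_singular_set: "nonzero_meromorphic g \<Longrightarrow> countable (singular_set g)"
  using sparse_imp_countable[of UNIV "singular_set g"] sparse_singular_set[of g] by auto

lemma zorder_outside_singular_set: "w \<notin> singular_set g \<Longrightarrow> zorder g w = 0"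
  by (auto simp: singular_set_def intro: zorder_eq_0I)

lemma continuous_on_outside_singular_set:
  assumes "A \<inter> singular_set g = {}"
  shows "continuous_on A g"
  using assms
  by (intro continuous_at_imp_continuous_on ballI analytic_at_imp_isCont) (auto simp: singular_set_def)

lemma borel_measurable_nonzero_meromorphic:
  assumes "nonzero_meromorphic g"
  shows "g \<in> borel_measurable borel"
  by (rule borel_measurable_continuous_countable_exceptions[OF countable_singular_set[OF assms]])
     (rule continuous_on_outside_singular_set, auto)

lemma zorder_eq_zero_order_minus_pole_order:
  assumes "nonzero_meromorphic g"
  shows "zorder g w = int (zero_order g w) - int (pole_order g w)"
proof -
  note g = nonzero_meromorphicD[OF assms, of w]
  consider "isolated_zero g w" | "is_pole g w" | "\<not> is_pole g w" "\<not> isolated_zero g w" by blast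
  then show ?thesis
  proof cases
    case 1
    then have "\<not> is_pole g w" using pole_is_not_zero by blast
    then show ?thesis
      using 1 zorder_isolated_zero_pos'[OF 1 g(4)] by (simp add: zero_order_def pole_order_def)
  next
    case 2
    then have "\<not> isolated_zero g w" using pole_is_not_zero by blast
    then show ?thesis
      using 2 isolated_pole_imp_neg_zorder[OF g(4) 2] by (simp add: zero_order_def pole_order_def)
  next
    case 3
    then show ?thesis
      using not_pole_not_isolated_zero_imp_zorder_eq_0[OF g(1) 3 g(3)]
      by (simp add: zero_order_def pole_order_def)
  qed
qed

lemma zero_order_or_pole_order_zero: "zero_order g w = 0 \<or> pole_order g w = 0"
  using pole_is_not_zero by (auto simp: zero_order_def pole_order_def)

lemma orders_outside_singular_set:
  assumes "nonzero_meromorphic g" "w \<notin> singular_set g"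
  shows "zero_order g w = 0" "pole_order g w = 0"
  using zorder_eq_zero_order_minus_pole_order[OF assms(1), of w]
    zorder_outside_singular_set[OF assms(2)] zero_order_or_pole_order_zero[of g w] by auto

lemma zero_pole_in_singular_set:
  assumes "nonzero_meromorphic g"
  shows "isolated_zero g w \<Longrightarrow> w \<in> singular_set g" "is_pole g w \<Longrightarrow> w \<in> singular_set g"
proof -
  show "isolated_zero g w \<Longrightarrow> w \<in> singular_set g"
    by (auto simp: singular_set_def dest: zero_isolated_zero_analytic)
  show "is_pole g w \<Longrightarrow> w \<in> singular_set g"
    by (auto simp: singular_set_def dest: analytic_at_imp_no_pole)
qed

lemma remove_sings_of_zorder_zero:
  assumes "f meromorphic_on {z}" "eventually (\<lambda>z. f z \<noteq> 0) (at z)" "zorder f z = 0"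
  shows "remove_sings f analytic_on {z}" "remove_sings f z \<noteq> 0"
proof -
  have iso: "isolated_singularity_at f z" "not_essential f z"
    using assms(1) by (auto simp: meromorphic_at_iff)
  have np: "\<not> is_pole f z"
    using isolated_pole_imp_neg_zorder[OF iso(1)] assms(3) by force
  have nz: "\<not> isolated_zero f z"
    using zorder_isolated_zero_pos'[OF _ iso(1)] assms(3) by force
  show an: "remove_sings f analytic_on {z}"
    using iso np not_essential_def remove_sings_analytic_at by blast
  show "remove_sings f z \<noteq> 0"
    using nz assms(2) iso np isolated_zero_def remove_sings_eq_0_iff by blast
qed

lemma ln_power_int_real: "0 < x \<Longrightarrow> ln (x powi n) = of_int n * ln (x::real)"
  by (simp add: ln_powr flip: powr_real_of_int')

text \<open>
  Dividing out the finitely many zeros and poles in a disc leaves a zero-free holomorphic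
  function, which has a logarithm there.
\<close>

lemma log_norm_factorization:
  assumes g: "nonzero_meromorphic g"
  obtains h where "h holomorphic_on ball 0 \<rho>"
    "\<And>w. norm w < \<rho> \<Longrightarrow> w \<notin> singular_set g \<Longrightarrow>
       ln (norm (g w)) = Re (h w) + (\<Sum>b | b \<in> singular_set g \<and> norm b \<le> \<rho>. of_int (zorder g b) * ln (norm (w - b)))"
proof -
  define B where "B = {b \<in> singular_set g. norm b \<le> \<rho>}"
  have fin: "finite B" unfolding B_def by (rule finite_singular_set[OF g])
  define P where "P z = (\<Prod>b\<in>B. (z - b) powi (- zorder g b))" for z
  define G where "G z = g z * P z" for z
  have mP: "P meromorphic_on {z}" for z
    unfolding P_def by (intro meromorphic_intros)
  have nzP: "eventually (\<lambda>z. P z \<noteq> 0) (at z)" for z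
  proof -
    have "eventually (\<lambda>w. w \<notin> B) (at z)"
      using finite_imp_sparse[OF fin, of UNIV] sparse_in_UNIV_imp_closed
      by (metis (no_types) UNIV_I eventually_cosparse_imp_eventually_at eventually_not_in_cosparse)
    then show ?thesis
      by eventually_elim (use fin in \<open>auto simp: P_def\<close>)
  qed
  have zP: "zorder P z = (if z \<in> B then - zorder g z else 0)" for z
  proof -
    have "zorder P z = (\<Sum>b\<in>B. zorder (\<lambda>z. (z - b) powi (- zorder g b)) z)"
      unfolding P_def using nzP[of z]
      by (intro zorder_prod meromorphic_intros) (simp_all add: P_def)
    also have "\<dots> = (\<Sum>b\<in>B. if b = z then - zorder g z else 0)"
    proof (rule sum.cong[OF refl])
      fix b
      show "zorder (\<lambda>z. (z - b) powi (- zorder g b)) z = (if b = z then - zorder g z else 0)"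
      proof (cases "b = z")
        case True
        have "zorder (\<lambda>w. (w - z) powi (- zorder g z)) z = - zorder g z"
          by (rule zorder_eqI[where S=UNIV and g="\<lambda>_. 1"]) auto
        then show ?thesis using True by simp
      next
        case False
        then show ?thesis
          by (intro trans[OF zorder_eq_0I]) (auto intro!: analytic_intros)
      qed
    qed
    also have "\<dots> = (if z \<in> B then - zorder g z else 0)"
      using fin by simp
    finally show ?thesis .
  qed
  \<comment> \<open>Outside \<open>B\<close> both orders vanish, and on \<open>B\<close> they cancel.\<close>
  have zG: "zorder G z = 0" if "norm z < \<rho>" for z
  proof -
    have "zorder G z = zorder g z + zorder P z"
      unfolding G_def
      by (intro zorder_mult nonzero_meromorphicD[OF g] mP)
         (use nzP in \<open>simp add: eventually_frequently\<close>)
    also have "\<dots> = 0"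
      using that zorder_outside_singular_set[of z g] unfolding zP B_def by auto
    finally show ?thesis .
  qed
  have mG: "G meromorphic_on {z}" for z
    unfolding G_def by (intro meromorphic_intros nonzero_meromorphicD[OF g] mP)
  have nzG: "eventually (\<lambda>z. G z \<noteq> 0) (at z)" for z
    using nonzero_meromorphicD(2)[OF g, of z] nzP[of z]
    by eventually_elim (auto simp: G_def)
  note F = remove_sings_of_zorder_zero[OF mG nzG zG]
  have "remove_sings G holomorphic_on ball 0 \<rho>"
    using F(1) by (metis analytic_on_analytic_at analytic_imp_holomorphic dist_0_norm mem_ball)
  moreover have "simply_connected (ball (0::complex) \<rho>)"
    by (simp add: convex_imp_simply_connected)
  ultimately obtain h where h: "h holomorphic_on ball 0 \<rho>"
    "\<And>z. z \<in> ball 0 \<rho> \<Longrightarrow> remove_sings G z = exp (h z)"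
    using F(2) holomorphic_logarithm_exists[of "ball 0 \<rho>" "remove_sings G"]
    by (metis convex_ball dist_0_norm mem_ball open_ball)
  show ?thesis
  proof
    show "h holomorphic_on ball 0 \<rho>" by fact
    fix w assume w: "norm w < \<rho>" "w \<notin> singular_set g"
    then have gw: "g analytic_on {w}" "g w \<noteq> 0" by (auto simp: singular_set_def)
    have wB: "w \<notin> B" using w by (auto simp: B_def)
    have "P analytic_on {w}" unfolding P_def
      by (intro analytic_intros) (use wB in auto)
    then have "G analytic_on {w}" unfolding G_def
      by (intro analytic_intros gw)
    then have "G w = exp (h w)" using h(2)[of w] w by simp
    then have "norm (g w) * norm (P w) = exp (Re (h w))"
      by (simp add: G_def flip: norm_mult)
    moreover have Pw: "P w \<noteq> 0" using wB fin by (auto simp: P_def)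
    ultimately have "ln (norm (g w)) + ln (norm (P w)) = Re (h w)"
      using gw by (metis ln_exp ln_mult_pos zero_less_norm_iff)
    moreover have "ln (norm (P w)) = (\<Sum>b\<in>B. - of_int (zorder g b) * ln (norm (w - b)))"
    proof -
      have "norm (P w) = (\<Prod>b\<in>B. norm (w - b) powi (- zorder g b))"
        by (simp add: P_def norm_power_int flip: prod_norm)
      also have "ln \<dots> = (\<Sum>b\<in>B. ln (norm (w - b) powi (- zorder g b)))"
        by (rule ln_prod) (use fin wB in auto)
      also have "\<dots> = (\<Sum>b\<in>B. - of_int (zorder g b) * ln (norm (w - b)))"
        proof (intro sum.cong refl)
        fix b assume "b \<in> B"
        then have "0 < norm (w - b)" using wB by auto
        then show "ln (norm (w - b) powi (- zorder g b)) = - of_int (zorder g b) * ln (norm (w - b))"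
          by (subst ln_power_int_real) auto
      qed
      finally show ?thesis .
    qed
    ultimately show "ln (norm (g w)) = Re (h w) + (\<Sum>b | b \<in> singular_set g \<and> norm b \<le> \<rho>. of_int (zorder g b) * ln (norm (w - b)))"
      by (simp add: B_def sum_negf)
  qed
qed

section \<open>Integrated counting functions\<close>

text \<open>
  The element \<open>b\<close> enters the count at radius \<open>\<rho> b\<close>. For ordinary counting functions \<open>\<rho>\<close> is the norm; a
  pair of points is counted from the larger of the two norms on.
\<close>

definition step_count :: "('b \<Rightarrow> real) \<Rightarrow> ('b \<Rightarrow> real) \<Rightarrow> 'b set \<Rightarrow> real \<Rightarrow> real" where
  "step_count \<rho> c S t = (\<Sum>b | b \<in> S \<and> \<rho> b \<le> t. c b)"

text \<open>
  The contribution of a unit jump at radius \<open>x\<close> to an integrated counting function at radius \<open>r\<close>. A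
  jump at \<open>0\<close> is weighted by \<open>ln r\<close>, according to the second term of \<^const>\<open>integrated_count\<close>.
\<close>

definition log_excess :: "real \<Rightarrow> real \<Rightarrow> real" where
  "log_excess x r = (if x = 0 then ln r else ln (max r x) - ln x)"

lemma log_excess_diff:
  "0 \<le> x \<Longrightarrow> 0 < r \<Longrightarrow> 0 < s \<Longrightarrow> log_excess x r - log_excess x s = ln (max r x) - ln (max s x)"
  by (auto simp: log_excess_def)

lemma log_excess_nonneg: "0 \<le> x \<Longrightarrow> 1 \<le> r \<Longrightarrow> 0 \<le> log_excess x r"
  by (auto simp: log_excess_def max_def)

lemma has_integral_jump_over_t:
  fixes r s x :: real
  assumes "0 < s" "s \<le> r"
  shows "((\<lambda>t. (if x \<le> t then 1 else 0) / t) has_integral (ln (max r x) - ln (max s x))) {s..r}"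
proof -
  have inv: "((\<lambda>t. 1 / t) has_integral (ln r - ln y)) {y..r}" if y: "0 < y" "y \<le> r" for y
  proof -
    have "(ln has_vector_derivative 1 / t) (at t within {y..r})" if "t \<in> {y..r}" for t
      using that y
      by (auto intro!: derivative_eq_intros simp: has_real_derivative_iff_has_vector_derivative[symmetric])
    from fundamental_theorem_of_calculus[OF y(2) this] show ?thesis by simp
  qed
  consider "x \<le> s" | "s < x" "x \<le> r" | "r < x" by linarith
  then show ?thesis
  proof cases
    case 1
    then have "max r x = r" "max s x = s" using assms by auto
    then have "((\<lambda>t. 1 / t) has_integral (ln (max r x) - ln (max s x))) {s..r}"
      using inv[of s] assms by simp
    then show ?thesis by (rule has_integral_eq[rotated]) (use 1 in auto)
  next
    case 2
    have "((\<lambda>t. (if x \<le> t then 1 else 0) / t) has_integral 0) {s..x}"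
      by (rule has_integral_spike_finite[of "{x}" _ _ "\<lambda>_. 0"]) auto
    moreover have "((\<lambda>t. (if x \<le> t then 1 else 0) / t) has_integral (ln r - ln x)) {x..r}"
      by (rule has_integral_eq[OF _ inv]) (use 2 assms in auto)
    ultimately have "((\<lambda>t. (if x \<le> t then 1 else 0) / t) has_integral (0 + (ln r - ln x))) {s..r}"
      by (intro has_integral_combine[where c=x]) (use 2 in auto)
    then show ?thesis using 2 by simp
  next
    case 3
    have "((\<lambda>t. (if x \<le> t then 1 else 0) / t) has_integral 0) {s..r}"
      by (rule has_integral_eq[of _ "\<lambda>_. 0"]) (use 3 in auto)
    then show ?thesis using 3 assms by simp
  qed
qed

lemma has_integral_jump_over_t_0:
  fixes r x :: real
  assumes "0 < x" "0 < r"
  shows "((\<lambda>t. (if x \<le> t then 1 else 0) / t) has_integral (ln (max r x) - ln x)) {0..r}"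
proof (cases "x \<le> r")
  case True
  have "((\<lambda>t. (if x \<le> t then 1 else 0) / t) has_integral 0) {0..x}"
    by (rule has_integral_spike_finite[of "{x}" _ _ "\<lambda>_. 0"]) (auto split: if_splits)
  from has_integral_combine[OF _ _ this has_integral_jump_over_t[of x r x]] True assms
  show ?thesis by (simp add: max_def)
next
  case False
  have "((\<lambda>t. (if x \<le> t then 1 else 0) / t) has_integral 0) {0..r}"
    by (rule has_integral_eq[of _ "\<lambda>_. 0"]) (use False in auto)
  then show ?thesis using False assms by (simp add: max_def)
qed

lemma step_count_eq:
  assumes "finite {b \<in> S. \<rho> b \<le> R}" "t \<le> R"
  shows "step_count \<rho> c S t = (\<Sum>b | b \<in> S \<and> \<rho> b \<le> R. c b * (if \<rho> b \<le> t then 1 else 0))"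
proof -
  have "(\<Sum>b | b \<in> S \<and> \<rho> b \<le> R. c b * (if \<rho> b \<le> t then 1 else 0))
      = (\<Sum>b | b \<in> S \<and> \<rho> b \<le> R. if \<rho> b \<le> t then c b else 0)"
    by (intro sum.cong) auto
  also have "\<dots> = sum c {b \<in> {b \<in> S. \<rho> b \<le> R}. \<rho> b \<le> t}"
    by (rule sum.inter_filter[symmetric]) fact
  also have "{b \<in> {b \<in> S. \<rho> b \<le> R}. \<rho> b \<le> t} = {b \<in> S. \<rho> b \<le> t}" using assms(2) by auto
  finally show ?thesis by (simp add: step_count_def)
qed

lemma has_integral_step_count:
  assumes fin: "finite {b \<in> S. \<rho> b \<le> R}" and "r \<le> R" "0 < s" "s \<le> r"
  shows "((\<lambda>t. step_count \<rho> c S t / t) has_integral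
          (\<Sum>b | b \<in> S \<and> \<rho> b \<le> R. c b * (ln (max r (\<rho> b)) - ln (max s (\<rho> b))))) {s..r}"
proof -
  have "((\<lambda>t. \<Sum>b | b \<in> S \<and> \<rho> b \<le> R. c b * ((if \<rho> b \<le> t then 1 else 0) / t)) has_integral
          (\<Sum>b | b \<in> S \<and> \<rho> b \<le> R. c b * (ln (max r (\<rho> b)) - ln (max s (\<rho> b))))) {s..r}"
    by (intro has_integral_sum fin has_integral_mult_right has_integral_jump_over_t assms)
  then show ?thesis
    by (rule has_integral_eq[rotated])
       (use assms in \<open>auto simp: step_count_eq[OF fin] sum_divide_distrib\<close>)
qed

lemma integrated_count_step_count:
  assumes fin: "finite {b \<in> S. \<rho> b \<le> R}" and r: "0 < r" "r \<le> R" and nn: "\<And>b. b \<in> S \<Longrightarrow> 0 \<le> \<rho> b"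
  shows "integrated_count (step_count \<rho> c S) r = (\<Sum>b | b \<in> S \<and> \<rho> b \<le> R. c b * log_excess (\<rho> b) r)"
    and "(\<lambda>t. (step_count \<rho> c S t - step_count \<rho> c S 0) / t) integrable_on {0..r}"
proof -
  define B where "B = {b \<in> S. \<rho> b \<le> R}"
  note f = fin[folded B_def]
  have e: "step_count \<rho> c S t = (\<Sum>b\<in>B. c b * (if \<rho> b \<le> t then 1 else 0))" if "t \<le> R" for t
    using step_count_eq[OF fin that] by (simp add: B_def)
  have "((\<lambda>t. \<Sum>b\<in>B. c b * (if \<rho> b = 0 then 0 else (if \<rho> b \<le> t then 1 else 0) / t)) has_integral
          (\<Sum>b\<in>B. c b * (if \<rho> b = 0 then 0 else ln (max r (\<rho> b)) - ln (\<rho> b)))) {0..r}"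
  proof (intro has_integral_sum f has_integral_mult_right)
    fix b assume "b \<in> B"
    then have "0 \<le> \<rho> b" using nn by (auto simp: B_def)
    then show "((\<lambda>t. if \<rho> b = 0 then 0 else (if \<rho> b \<le> t then 1 else 0) / t) has_integral
           (if \<rho> b = 0 then 0 else ln (max r (\<rho> b)) - ln (\<rho> b))) {0..r}"
      using has_integral_jump_over_t_0[of "\<rho> b" r] r by auto
  qed
  moreover have "(\<Sum>b\<in>B. c b * (if \<rho> b = 0 then 0 else (if \<rho> b \<le> t then 1 else 0) / t))
      = (step_count \<rho> c S t - step_count \<rho> c S 0) / t" if "t \<in> {0..r}" for t
  proof -
    have "step_count \<rho> c S t - step_count \<rho> c S 0
        = (\<Sum>b\<in>B. c b * (if \<rho> b \<le> t then 1 else 0) - c b * (if \<rho> b \<le> 0 then 1 else 0))"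
      using that r by (simp add: e sum_subtractf)
    moreover have "(\<Sum>b\<in>B. (c b * (if \<rho> b \<le> t then 1 else 0) - c b * (if \<rho> b \<le> 0 then 1 else 0)) / t)
       = (\<Sum>b\<in>B. c b * (if \<rho> b = 0 then 0 else (if \<rho> b \<le> t then 1 else 0) / t))"
    proof (intro sum.cong refl)
      fix b assume "b \<in> B"
      then have "0 \<le> \<rho> b" using nn by (auto simp: B_def)
      then show "(c b * (if \<rho> b \<le> t then 1 else 0) - c b * (if \<rho> b \<le> 0 then 1 else 0)) / t
          = c b * (if \<rho> b = 0 then 0 else (if \<rho> b \<le> t then 1 else 0) / t)"
        using that by auto
    qed
    ultimately show ?thesis by (simp only: sum_divide_distrib)
  qed
  ultimately have hi: "((\<lambda>t. (step_count \<rho> c S t - step_count \<rho> c S 0) / t) has_integral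
        (\<Sum>b\<in>B. c b * (if \<rho> b = 0 then 0 else ln (max r (\<rho> b)) - ln (\<rho> b)))) {0..r}"
    by (rule has_integral_eq[rotated]) auto
  then show "(\<lambda>t. (step_count \<rho> c S t - step_count \<rho> c S 0) / t) integrable_on {0..r}" by blast
  from hi have "integral {0..r} (\<lambda>t. (step_count \<rho> c S t - step_count \<rho> c S 0) / t)
      = (\<Sum>b\<in>B. c b * (if \<rho> b = 0 then 0 else ln (max r (\<rho> b)) - ln (\<rho> b)))"
    by (rule integral_unique)
  moreover have "step_count \<rho> c S 0 * ln r = (\<Sum>b\<in>B. c b * (if \<rho> b = 0 then ln r else 0))"
    unfolding e[OF order_trans[OF less_imp_le[OF r(1)] r(2)]] sum_distrib_right
  proof (intro sum.cong refl)
    fix b assume "b \<in> B"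
    then have "0 \<le> \<rho> b" using nn by (auto simp: B_def)
    then show "c b * (if \<rho> b \<le> 0 then 1 else 0) * ln r = c b * (if \<rho> b = 0 then ln r else 0)" by auto
  qed
  ultimately have "integrated_count (step_count \<rho> c S) r
     = (\<Sum>b\<in>B. c b * (if \<rho> b = 0 then 0 else ln (max r (\<rho> b)) - ln (\<rho> b)) + c b * (if \<rho> b = 0 then ln r else 0))"
    by (simp add: integrated_count_def sum.distrib)
  also have "\<dots> = (\<Sum>b\<in>B. c b * log_excess (\<rho> b) r)"
    by (intro sum.cong refl) (auto simp: log_excess_def)
  finally show "integrated_count (step_count \<rho> c S) r = (\<Sum>b | b \<in> S \<and> \<rho> b \<le> R. c b * log_excess (\<rho> b) r)"
    by (simp add: B_def)
qed

lemma integrated_count_diff: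
  assumes fin: "finite {b \<in> S. \<rho> b \<le> r}" and r: "0 < s" "s \<le> r" and nn: "\<And>b. b \<in> S \<Longrightarrow> 0 \<le> \<rho> b"
  shows "((\<lambda>t. step_count \<rho> c S t / t) has_integral
     (integrated_count (step_count \<rho> c S) r - integrated_count (step_count \<rho> c S) s)) {s..r}"
proof -
  have "integrated_count (step_count \<rho> c S) r - integrated_count (step_count \<rho> c S) s
    = (\<Sum>b | b \<in> S \<and> \<rho> b \<le> r. c b * (ln (max r (\<rho> b)) - ln (max s (\<rho> b))))"
  proof -
    have "(\<Sum>b | b \<in> S \<and> \<rho> b \<le> r. c b * log_excess (\<rho> b) r) - (\<Sum>b | b \<in> S \<and> \<rho> b \<le> r. c b * log_excess (\<rho> b) s)
      = (\<Sum>b | b \<in> S \<and> \<rho> b \<le> r. c b * (log_excess (\<rho> b) r - log_excess (\<rho> b) s))"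
      by (simp add: right_diff_distrib sum_subtractf)
    also have "\<dots> = (\<Sum>b | b \<in> S \<and> \<rho> b \<le> r. c b * (ln (max r (\<rho> b)) - ln (max s (\<rho> b))))"
      by (intro sum.cong refl arg_cong2[where f="(*)"] log_excess_diff) (use r nn in auto)
    finally show ?thesis
      using r nn by (simp add: integrated_count_step_count[OF fin])
  qed
  then show ?thesis using has_integral_step_count[OF fin _ r, where c=c] by simp
qed

lemma integrated_count_nonneg:
  assumes fin: "finite {b \<in> S. \<rho> b \<le> r}" and r: "1 \<le> r" and nn: "\<And>b. b \<in> S \<Longrightarrow> 0 \<le> \<rho> b"
    and c: "\<And>b. b \<in> S \<Longrightarrow> 0 \<le> c b"
  shows "0 \<le> integrated_count (step_count \<rho> c S) r"
  using r by (subst integrated_count_step_count[OF fin _ _ nn])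
    (auto intro!: sum_nonneg mult_nonneg_nonneg log_excess_nonneg nn c)

lemma integrated_count_minus:
  assumes fin: "finite {b \<in> S. \<rho> b \<le> r}" "finite {b \<in> S'. \<rho>' b \<le> r}" and r: "0 < r"
    and nn: "\<And>b. b \<in> S \<Longrightarrow> 0 \<le> \<rho> b" "\<And>b. b \<in> S' \<Longrightarrow> 0 \<le> \<rho>' b"
  shows "integrated_count (\<lambda>t. step_count \<rho> c S t - step_count \<rho>' c' S' t) r
    = integrated_count (step_count \<rho> c S) r - integrated_count (step_count \<rho>' c' S') r"
proof -
  note i1 = integrated_count_step_count(2)[OF fin(1) r order_refl nn(1), of c]
  note i2 = integrated_count_step_count(2)[OF fin(2) r order_refl nn(2), of c']
  show ?thesis
    using integral_diff[OF i1 i2]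
    by (simp add: integrated_count_def algebra_simps diff_divide_distrib add_divide_distrib)
qed

section \<open>The formulas of Jensen and Poisson-Jensen\<close>

text \<open>
  Circles of such a radius avoid the zeros and poles of \<open>g\<close>, so that all integrands are continuous
  on them. If \<open>g\<close> is meromorphic and not identically zero, all but countably many positive radii are
  generic.
\<close>

definition generic_radius :: "(complex \<Rightarrow> complex) \<Rightarrow> real \<Rightarrow> bool" where
  "generic_radius g r \<longleftrightarrow> 0 < r \<and> (\<forall>b\<in>singular_set g. norm b \<noteq> r)"

lemma circle_generic:
  assumes "generic_radius g (norm z)"
  shows "g z \<noteq> 0" "isCont g z" "z \<notin> singular_set g"
  using assms by (auto simp: generic_radius_def singular_set_def intro: analytic_at_imp_isCont)

lemma norm_circle [simp]: "0 \<le> r \<Longrightarrow> norm (of_real r * cis t) = r"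
  by (simp add: norm_mult)

lemma continuous_on_circle:
  assumes "generic_radius g r"
  shows "continuous_on A (\<lambda>t. g (of_real r * cis t))" "g (of_real r * cis t) \<noteq> 0"
proof -
  have "continuous_on {z. norm z = r} g"
    using assms by (intro continuous_on_outside_singular_set) (auto simp: generic_radius_def)
  moreover have "0 \<le> r" using assms by (simp add: generic_radius_def)
  ultimately show "continuous_on A (\<lambda>t. g (of_real r * cis t))"
    by (intro continuous_on_compose2[of "{z. norm z = r}" g A]) (auto intro!: continuous_intros)
  show "g (of_real r * cis t) \<noteq> 0"
    using assms \<open>0 \<le> r\<close> by (intro circle_generic) simp
qed

text \<open>
  The Poisson-Jensen formula in the disc of radius \<open>\<alpha>\<close> around \<open>z0\<close>, for a function whose logarithmic
  modulus is given as \<open>Re h\<close> plus a sum of logarithms. The parameter \<open>l\<close> rotates the disc; letting it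
  vary with \<open>z0\<close> makes the boundary points \<open>z0 + l \<cdot> \<alpha> \<cdot> cis t\<close> move on circles about the origin.
\<close>

lemma poisson_jensen:
  fixes h :: "complex \<Rightarrow> complex" and m :: "complex \<Rightarrow> real"
  assumes hol: "h holomorphic_on ball 0 \<rho>" and fin: "finite B" and l: "norm l = 1"
    and \<alpha>: "0 < \<alpha>" "norm z0 + \<alpha> < \<rho>" and xi: "norm \<xi> < \<alpha>" and B: "\<And>b. b \<in> B \<Longrightarrow> norm (b - z0) \<noteq> \<alpha>"
  shows "((\<lambda>t. (Re (h (z0 + l * (of_real \<alpha> * cis t))) +
                (\<Sum>b\<in>B. m b * ln (norm (z0 + l * (of_real \<alpha> * cis t) - b)))) * poisson_kernel \<xi> (of_real \<alpha> * cis t))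
      has_integral 2 * pi * (Re (h (z0 + l * \<xi>)) +
        (\<Sum>b\<in>B. m b * (if norm (b - z0) < \<alpha> then ln (norm (of_real \<alpha> - cnj ((b - z0) / l) * \<xi> / of_real \<alpha>))
                       else ln (norm (z0 + l * \<xi> - b)))))) {0..2*pi}"
proof -
  have l0: "l \<noteq> 0" using l by auto
  have shift: "norm (z0 + l * z - b) = norm (z - (b - z0) / l)" for z :: complex and b
  proof -
    have "z0 + l * z - b = l * (z - (b - z0) / l)" using l0 by (simp add: field_simps)
    then show ?thesis by (simp add: norm_mult l)
  qed
  have "(h \<circ> (\<lambda>z. z0 + l * z)) holomorphic_on ball 0 (\<rho> - norm z0)"
  proof (rule holomorphic_on_compose_gen[OF _ hol])
    show "(\<lambda>z. z0 + l * z) ` ball 0 (\<rho> - cmod z0) \<subseteq> ball 0 \<rho>"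
    proof safe
      fix z :: complex assume "z \<in> ball 0 (\<rho> - cmod z0)"
      then show "z0 + l * z \<in> ball 0 \<rho>"
        using norm_triangle_ineq[of z0 "l * z"] l by (simp add: norm_mult)
    qed
  qed (intro holomorphic_intros)
  from poisson_holomorphic[OF this \<alpha>(1) _ xi]
  have 1: "((\<lambda>t. Re (h (z0 + l * (of_real \<alpha> * cis t))) * poisson_kernel \<xi> (of_real \<alpha> * cis t)) has_integral
       2 * pi * Re (h (z0 + l * \<xi>))) {0..2*pi}"
    using \<alpha> by simp
  have 2: "((\<lambda>t. m b * (ln (norm (z0 + l * (of_real \<alpha> * cis t) - b)) * poisson_kernel \<xi> (of_real \<alpha> * cis t)))
     has_integral m b * (2 * pi * (if norm (b - z0) < \<alpha> then ln (norm (of_real \<alpha> - cnj ((b - z0) / l) * \<xi> / of_real \<alpha>))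
                       else ln (norm (z0 + l * \<xi> - b))))) {0..2*pi}" if "b \<in> B" for b
  proof (rule has_integral_mult_right)
    have nb: "norm ((b - z0) / l) = norm (b - z0)" by (simp add: norm_divide l)
    show "((\<lambda>t. ln (norm (z0 + l * (of_real \<alpha> * cis t) - b)) * poisson_kernel \<xi> (of_real \<alpha> * cis t))
     has_integral 2 * pi * (if norm (b - z0) < \<alpha> then ln (norm (of_real \<alpha> - cnj ((b - z0) / l) * \<xi> / of_real \<alpha>))
                       else ln (norm (z0 + l * \<xi> - b)))) {0..2*pi}"
      using poisson_log_inside[OF \<alpha>(1) _ xi, of "(b - z0) / l"]
        poisson_log_outside[OF \<alpha>(1) _ xi, of "(b - z0) / l"] B[OF that]
      unfolding shift nb by (cases "norm (b - z0) < \<alpha>") auto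
  qed
  have 3: "((\<lambda>t. \<Sum>b\<in>B. m b * (ln (norm (z0 + l * (of_real \<alpha> * cis t) - b)) * poisson_kernel \<xi> (of_real \<alpha> * cis t)))
     has_integral (\<Sum>b\<in>B. m b * (2 * pi * (if norm (b - z0) < \<alpha> then ln (norm (of_real \<alpha> - cnj ((b - z0) / l) * \<xi> / of_real \<alpha>))
                       else ln (norm (z0 + l * \<xi> - b)))))) {0..2*pi}"
    by (rule has_integral_sum[OF fin 2])
  show ?thesis
    using has_integral_add[OF 1 3]
    by (simp only: distrib_right distrib_left sum_distrib_left sum_distrib_right mult.assoc
        mult.commute mult.left_commute)
qed

lemma poisson_kernel_0: "w \<noteq> 0 \<Longrightarrow> poisson_kernel 0 w = 1"
  by (simp add: poisson_kernel_def)

lemma poisson_kernel_nonneg: "norm \<xi> \<le> norm w \<Longrightarrow> 0 \<le> poisson_kernel \<xi> w"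
  by (simp add: poisson_kernel_def power_mono)

lemma poisson_kernel_Re:
  assumes "w \<noteq> \<xi>" shows "poisson_kernel \<xi> w = Re ((w + \<xi>) / (w - \<xi>))"
proof -
  have "Re ((w + \<xi>) / (w - \<xi>)) = Re ((w + \<xi>) * cnj (w - \<xi>)) / (norm (w - \<xi>))\<^sup>2"
    by (subst complex_div_cnj) (simp only: Re_divide_of_real flip: of_real_power)
  also have "Re ((w + \<xi>) * cnj (w - \<xi>)) = (norm w)\<^sup>2 - (norm \<xi>)\<^sup>2"
    unfolding cmod_power2 by (simp add: algebra_simps power2_eq_square)
  finally show ?thesis by (simp add: poisson_kernel_def)
qed

lemma circle_mean_log_norm:
  assumes "0 < r" "norm b \<noteq> r"
  shows "((\<lambda>t. ln (norm (of_real r * cis t - b))) has_integral 2 * pi * ln (max r (norm b))) {0..2*pi}"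
proof -
  have "((\<lambda>t. ln (norm (of_real r * cis t - b)) * poisson_kernel 0 (of_real r * cis t)) has_integral
     2 * pi * ln (max r (norm b))) {0..2*pi}"
    using poisson_log_inside[of r b 0] poisson_log_outside[of r b 0] assms
    by (cases "norm b < r") (auto simp: max_def)
  then show ?thesis using assms by (simp add: poisson_kernel_0)
qed

lemma circle_mean_factorized:
  assumes hol: "h holomorphic_on ball 0 \<rho>" and fin: "finite B" and r: "0 < r" "r < \<rho>"
    and B: "\<And>b. b \<in> B \<Longrightarrow> norm b \<noteq> r"
    and u: "\<And>z. norm z = r \<Longrightarrow> u z = Re (h z) + (\<Sum>b\<in>B. m b * ln (norm (z - b)))"
  shows "circle_mean u r = Re (h 0) + (\<Sum>b\<in>B. m b * ln (max r (norm b)))"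
proof -
  have 1: "((\<lambda>t. Re (h (of_real r * cis t)) * poisson_kernel 0 (of_real r * cis t)) has_integral
     2 * pi * Re (h 0)) {0..2*pi}"
    by (rule poisson_holomorphic[OF hol]) (use r in auto)
  have 2: "((\<lambda>t. m b * ln (norm (of_real r * cis t - b))) has_integral m b * (2 * pi * ln (max r (norm b)))) {0..2*pi}"
    if "b \<in> B" for b
    by (intro has_integral_mult_right circle_mean_log_norm r B that)
  have "((\<lambda>t. u (of_real r * cis t)) has_integral
     2 * pi * Re (h 0) + (\<Sum>b\<in>B. m b * (2 * pi * ln (max r (norm b))))) {0..2*pi}"
    using has_integral_add[OF 1 has_integral_sum[OF fin 2]] r by (simp add: poisson_kernel_0 u)
  then have "integral {0..2*pi} (\<lambda>t. u (of_real r * cis t)) =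
     2 * pi * (Re (h 0) + (\<Sum>b\<in>B. m b * ln (max r (norm b))))"
    by (simp add: integral_unique distrib_left sum_distrib_left mult.left_commute)
  then show ?thesis by (simp add: circle_mean_def)
qed

definition zero_count :: "(complex \<Rightarrow> complex) \<Rightarrow> real \<Rightarrow> real" where
  "zero_count g = step_count norm (\<lambda>w. real (zero_order g w)) (singular_set g)"

lemma pole_count_step_count:
  assumes "nonzero_meromorphic g"
  shows "pole_count g = step_count norm (\<lambda>w. real (pole_order g w)) (singular_set g)"
proof
  fix t
  show "pole_count g t = step_count norm (\<lambda>w. real (pole_order g w)) (singular_set g) t"
    unfolding pole_count_def step_count_def
  proof (rule sum.mono_neutral_left)
    show "finite {b \<in> singular_set g. norm b \<le> t}" by (rule finite_singular_set[OF assms])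
    show "{w. norm w \<le> t \<and> is_pole g w} \<subseteq> {b \<in> singular_set g. norm b \<le> t}"
    proof safe
      fix w assume "is_pole g w"
      then show "w \<in> singular_set g" by (rule zero_pole_in_singular_set(2)[OF assms])
    qed
    show "\<forall>w\<in>{b \<in> singular_set g. norm b \<le> t} - {w. norm w \<le> t \<and> is_pole g w}. real (pole_order g w) = 0"
      by (simp add: pole_order_def)
  qed
qed

text \<open>
  The mean over a circle of the real part of a holomorphic function does not depend on the radius, and
  the mean of \<open>ln |z - b|\<close> is \<open>ln (max r |b|)\<close>, which is also how \<open>b\<close> enters the integrated count.
\<close>

lemma jensen:
  assumes g: "nonzero_meromorphic g" and r: "generic_radius g r" and s: "generic_radius g s"
  shows "circle_mean (\<lambda>z. ln (norm (g z))) r - circle_mean (\<lambda>z. ln (norm (g z))) s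
    = integrated_count (step_count norm (\<lambda>b. of_int (zorder g b)) (singular_set g)) r
    - integrated_count (step_count norm (\<lambda>b. of_int (zorder g b)) (singular_set g)) s"
proof -
  define \<rho> where "\<rho> = max r s + 1"
  obtain h where h: "h holomorphic_on ball 0 \<rho>"
    "\<And>w. norm w < \<rho> \<Longrightarrow> w \<notin> singular_set g \<Longrightarrow>
       ln (norm (g w)) = Re (h w) + (\<Sum>b | b \<in> singular_set g \<and> norm b \<le> \<rho>. of_int (zorder g b) * ln (norm (w - b)))"
    by (rule log_norm_factorization[OF g, of \<rho>]) blast
  have fin: "finite {b \<in> singular_set g. norm b \<le> \<rho>}" by (rule finite_singular_set[OF g])
  have m: "circle_mean (\<lambda>z. ln (norm (g z))) x = Re (h 0) +
      (\<Sum>b | b \<in> singular_set g \<and> norm b \<le> \<rho>. of_int (zorder g b) * ln (max x (norm b)))"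
    if "generic_radius g x" "x < \<rho>" for x
    by (rule circle_mean_factorized[OF h(1) fin])
       (use that in \<open>auto simp: generic_radius_def intro!: h(2)\<close>)
  have pos: "0 < r" "0 < s" using r s by (auto simp: generic_radius_def)
  have "integrated_count (step_count norm (\<lambda>b. of_int (zorder g b)) (singular_set g)) r
    - integrated_count (step_count norm (\<lambda>b. of_int (zorder g b)) (singular_set g)) s
    = (\<Sum>b | b \<in> singular_set g \<and> norm b \<le> \<rho>. of_int (zorder g b) * log_excess (norm b) r)
    - (\<Sum>b | b \<in> singular_set g \<and> norm b \<le> \<rho>. of_int (zorder g b) * log_excess (norm b) s)"
    using pos by (subst (1 2) integrated_count_step_count[OF fin]) (auto simp: \<rho>_def)
  also have "\<dots> = (\<Sum>b | b \<in> singular_set g \<and> norm b \<le> \<rho>. of_int (zorder g b) * (log_excess (norm b) r - log_excess (norm b) s))"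
    by (simp add: right_diff_distrib sum_subtractf)
  also have "\<dots> = (\<Sum>b | b \<in> singular_set g \<and> norm b \<le> \<rho>. of_int (zorder g b) * (ln (max r (norm b)) - ln (max s (norm b))))"
    using pos by (simp add: log_excess_diff)
  also have "\<dots> = circle_mean (\<lambda>z. ln (norm (g z))) r - circle_mean (\<lambda>z. ln (norm (g z))) s"
    using m[OF r] m[OF s] by (simp add: \<rho>_def right_diff_distrib sum_subtractf)
  finally show ?thesis by simp
qed

lemma jensen_divisor:
  assumes g: "nonzero_meromorphic g"
  obtains C where "\<And>r. generic_radius g r \<Longrightarrow> circle_mean (\<lambda>z. ln (norm (g z))) r
      = integrated_count (step_count norm (\<lambda>b. of_int (zorder g b)) (singular_set g)) r + C"
proof (cases "\<exists>s. generic_radius g s")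
  case True
  then obtain s where s: "generic_radius g s" by blast
  show ?thesis
    by (rule that[of "circle_mean (\<lambda>z. ln (norm (g z))) s - integrated_count (step_count norm (\<lambda>b. of_int (zorder g b)) (singular_set g)) s"])
       (use jensen[OF g _ s] in force)
qed (use that in auto)

lemma jensen_counts:
  assumes g: "nonzero_meromorphic g"
  obtains C where "\<And>r. generic_radius g r \<Longrightarrow> circle_mean (\<lambda>z. ln (norm (g z))) r
      = integrated_count (zero_count g) r - integrated_count (pole_count g) r + C"
proof -
  have D: "integrated_count (step_count norm (\<lambda>b. of_int (zorder g b)) (singular_set g)) r
      = integrated_count (zero_count g) r - integrated_count (pole_count g) r" if "0 < r" for r
  proof -
    have "step_count norm (\<lambda>b. of_int (zorder g b)) (singular_set g)
      = (\<lambda>t. step_count norm (\<lambda>w. real (zero_order g w)) (singular_set g) t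
           - step_count norm (\<lambda>w. real (pole_order g w)) (singular_set g) t)"
      by (simp add: fun_eq_iff step_count_def zorder_eq_zero_order_minus_pole_order[OF g] sum_subtractf)
    then show ?thesis
      using that finite_singular_set[OF g]
      by (simp add: integrated_count_minus zero_count_def pole_count_step_count[OF g])
  qed
  obtain C where C: "\<And>r. generic_radius g r \<Longrightarrow> circle_mean (\<lambda>z. ln (norm (g z))) r
      = integrated_count (step_count norm (\<lambda>b. of_int (zorder g b)) (singular_set g)) r + C"
    by (rule jensen_divisor[OF g]) blast
  show ?thesis
  proof (rule that)
    fix r assume r: "generic_radius g r"
    then show "circle_mean (\<lambda>z. ln (norm (g z))) r
      = integrated_count (zero_count g) r - integrated_count (pole_count g) r + C"
      using C[OF r] D[of r] by (simp add: generic_radius_def)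
  qed
qed

lemma integrable_on_circle:
  assumes "generic_radius g r" "continuous_on (- {0}) F"
  shows "(\<lambda>t. F (g (of_real r * cis t)) :: real) integrable_on {a..b}"
proof (rule integrable_continuous_real)
  show "continuous_on {a..b} (\<lambda>t. F (g (of_real r * cis t)))"
    by (rule continuous_on_compose2[OF assms(2) continuous_on_circle(1)[OF assms(1)]])
       (use continuous_on_circle(2)[OF assms(1)] in auto)
qed

lemma proximity_circle_mean: "proximity r g = circle_mean (\<lambda>z. log_plus (norm (g z))) r"
  by (simp add: proximity_def circle_mean_def)

lemma proximity_minus_proximity_inverse:
  assumes "generic_radius g r"
  shows "proximity r g - proximity r (\<lambda>z. inverse (g z)) = circle_mean (\<lambda>z. ln (norm (g z))) r"
proof -
  have "(\<lambda>t. log_plus (norm (g (of_real r * cis t)))) integrable_on {0..2*pi}"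
    "(\<lambda>t. log_plus (norm (inverse (g (of_real r * cis t))))) integrable_on {0..2*pi}"
    by (intro integrable_on_circle[OF assms] continuous_intros; auto)+
  then have "integral {0..2*pi} (\<lambda>t. log_plus (norm (g (of_real r * cis t))))
     - integral {0..2*pi} (\<lambda>t. log_plus (norm (inverse (g (of_real r * cis t)))))
     = integral {0..2*pi} (\<lambda>t. log_plus (norm (g (of_real r * cis t))) - log_plus (norm (inverse (g (of_real r * cis t)))))"
    by (rule integral_diff[symmetric])
  also have "\<dots> = integral {0..2*pi} (\<lambda>t. ln (norm (g (of_real r * cis t))))"
    by (intro integral_cong)
       (use continuous_on_circle(2)[OF assms] in \<open>simp add: norm_inverse log_plus_diff_inverse\<close>)
  finally show ?thesis
    by (simp add: proximity_def circle_mean_def flip: diff_divide_distrib)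
qed

section \<open>Monotonicity of the characteristic\<close>

text \<open>
  As a function of its first argument the kernel is the real part of \<open>(w + z) / (w - z)\<close>, so this is
  the mean value property at \<open>0\<close>.
\<close>

lemma mean_poisson_kernel:
  assumes "0 < r" "r < norm w"
  shows "((\<lambda>t. poisson_kernel (of_real r * cis t) w) has_integral 2 * pi) {0..2*pi}"
proof -
  define h where "h z = (w + z) / (w - z)" for z
  have w: "w \<noteq> 0" using assms by auto
  have "h holomorphic_on ball 0 (norm w)"
    unfolding h_def by (intro holomorphic_intros) auto
  from poisson_holomorphic[OF this assms(1) assms(2), of 0]
  have "((\<lambda>t. Re (h (of_real r * cis t)) * poisson_kernel 0 (of_real r * cis t)) has_integral 2 * pi) {0..2*pi}"
    using assms w by (simp add: h_def)
  moreover have "Re (h (of_real r * cis t)) = poisson_kernel (of_real r * cis t) w" for t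
    using assms norm_circle[of r t] unfolding h_def by (subst poisson_kernel_Re) auto
  ultimately show ?thesis using assms by (simp add: poisson_kernel_0)
qed

text \<open>
  The Green function of the disc of radius \<open>R\<close> with pole \<open>b\<close>. The first term is the logarithmic
  potential of the mirror image of \<open>b\<close>, normalised so that the difference vanishes on the boundary.
\<close>

definition green :: "real \<Rightarrow> complex \<Rightarrow> complex \<Rightarrow> real" where
  "green R b z = ln (norm (of_real R - cnj b * z / of_real R)) - ln (norm (z - b))"

lemma green_nonneg:
  assumes "norm b < R" "norm z < R" "z \<noteq> b"
  shows "0 \<le> green R b z"
proof -
  have R: "0 < R" using assms(1) norm_ge_zero[of b] by linarith
  have "(norm (z - b))\<^sup>2 \<le> (norm (of_real R - cnj b * z / of_real R))\<^sup>2"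
  proof -
    have e: "R\<^sup>2 * ((norm (of_real R - cnj b * z / of_real R))\<^sup>2) = (norm (of_real (R\<^sup>2) - cnj b * z))\<^sup>2"
    proof -
      have "R * norm (of_real R - cnj b * z / of_real R) = norm (of_real R * (of_real R - cnj b * z / of_real R))"
        using R by (simp add: norm_mult)
      also have "of_real R * (of_real R - cnj b * z / of_real R) = of_real (R\<^sup>2) - cnj b * z"
        using R by (simp add: field_simps power2_eq_square)
      finally show ?thesis by (metis power_mult_distrib)
    qed
    have "(norm (of_real (R\<^sup>2) - cnj b * z))\<^sup>2 - R\<^sup>2 * (norm (z - b))\<^sup>2
        = (R\<^sup>2 - (norm z)\<^sup>2) * (R\<^sup>2 - (norm b)\<^sup>2)"
      unfolding cmod_power2 by (simp add: algebra_simps power2_eq_square)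
    also have "\<dots> \<ge> 0"
      using assms R by (intro mult_nonneg_nonneg) (auto intro!: power_mono)
    finally have "R\<^sup>2 * (norm (z - b))\<^sup>2 \<le> R\<^sup>2 * (norm (of_real R - cnj b * z / of_real R))\<^sup>2"
      by (simp add: e)
    then show ?thesis using R by simp
  qed
  then have "norm (z - b) \<le> norm (of_real R - cnj b * z / of_real R)"
    by (rule power2_le_imp_le) simp
  moreover have "0 < norm (z - b)" using assms by simp
  ultimately show ?thesis unfolding green_def
    using ln_le_cancel_iff[of "norm (z - b)" "norm (of_real R - cnj b * z / of_real R)"] by linarith
qed

lemma mean_green:
  assumes r: "0 < r" "r < R" and b: "norm b < R" "norm b \<noteq> r"
  shows "((\<lambda>t. green R b (of_real r * cis t)) has_integral 2 * pi * (ln R - ln (max r (norm b)))) {0..2*pi}"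
proof -
  have 1: "((\<lambda>t. ln (norm (of_real R - cnj b * (of_real r * cis t) / of_real R))) has_integral 2 * pi * ln R) {0..2*pi}"
  proof (cases "b = 0")
    case True
    then show ?thesis using has_integral_const_real[of "ln R" 0 "2*pi"] r by simp
  next
    case False
    define c where "c = of_real (R\<^sup>2) / cnj b"
    have nc: "R < norm c" using False b r
      by (simp add: c_def norm_divide norm_mult norm_power power2_eq_square pos_less_divide_eq)
    then have "max r (norm c) = norm c" using r by simp
    have "((\<lambda>t. ln (norm (of_real r * cis t - c)) + ln (norm b / R)) has_integral
        2 * pi * ln (max r (norm c)) + 2 * pi * ln (norm b / R)) {0..2*pi}"
      using has_integral_add[OF circle_mean_log_norm[of r c] has_integral_const_real[of "ln (norm b / R)" 0 "2*pi"]]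
        r nc by simp
    moreover have "2 * pi * ln (max r (norm c)) + 2 * pi * ln (norm b / R) = 2 * pi * ln R"
    proof -
      have "norm c * (norm b / R) = R"
        using False r by (simp add: c_def norm_divide norm_mult norm_power power2_eq_square)
      then have "ln (norm c) + ln (norm b / R) = ln R"
        using False r nc by (metis divide_pos_pos ln_mult_pos order_less_trans zero_less_norm_iff)
      then show ?thesis using \<open>max r (norm c) = norm c\<close> by (simp add: distrib_left[symmetric])
    qed
    moreover have "ln (norm (of_real r * cis t - c)) + ln (norm b / R)
       = ln (norm (of_real R - cnj b * (of_real r * cis t) / of_real R))" for t
    proof -
      define z where "z = of_real r * cis t"
      have nz: "norm (z - c) > 0" using r nc norm_circle[of r t] by (auto simp: z_def)
      have "norm (z - c) * (norm b / R) = norm ((z - c) * cnj b / of_real R)"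
        using r by (simp add: norm_mult norm_divide)
      also have "(z - c) * cnj b / of_real R = - (of_real R - cnj b * z / of_real R)"
        using False r unfolding c_def by (simp add: field_simps power2_eq_square)
      finally have e: "norm (z - c) * (norm b / R) = norm (of_real R - cnj b * z / of_real R)"
        by (simp only: norm_minus_cancel)
      have "ln (norm (z - c)) + ln (norm b / R) = ln (norm (z - c) * (norm b / R))"
        using nz False r by (intro ln_mult_pos[symmetric]) auto
      then show ?thesis unfolding e by (simp only: z_def)
    qed
    ultimately show ?thesis by simp
  qed
  show ?thesis
    unfolding green_def
    using has_integral_diff[OF 1 circle_mean_log_norm[OF r(1) b(2)]]
    by (simp add: right_diff_distrib)
qed

lemma continuous_on_poisson_kernel [continuous_intros]:
  assumes "continuous_on A f" "continuous_on A g" "\<And>x. x \<in> A \<Longrightarrow> f x \<noteq> g x"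
  shows "continuous_on A (\<lambda>x. poisson_kernel (f x) (g x))"
  unfolding poisson_kernel_def
  by (intro continuous_intros assms(1,2)) (simp add: not_sym[OF assms(3)])

text \<open>
  In the Poisson-Jensen formula the zeros enter with the sign that can be dropped in an upper bound. The
  remaining right-hand side is nonnegative, so it bounds \<open>log\<^sup>+\<close> as well.
\<close>

lemma log_plus_poisson_jensen:
  assumes g: "nonzero_meromorphic g" and R: "generic_radius g R" and z: "norm z < R" "z \<notin> singular_set g"
  shows "log_plus (norm (g z)) \<le>
     integral {0..2*pi} (\<lambda>t. log_plus (norm (g (of_real R * cis t))) * poisson_kernel z (of_real R * cis t)) / (2*pi)
     + (\<Sum>b | b \<in> singular_set g \<and> norm b \<le> R. real (pole_order g b) * green R b z)"
proof -
  define \<rho> where "\<rho> = R + 1"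
  have R0: "0 < R" using R by (simp add: generic_radius_def)
  obtain h where h: "h holomorphic_on ball 0 \<rho>"
    "\<And>w. norm w < \<rho> \<Longrightarrow> w \<notin> singular_set g \<Longrightarrow>
       ln (norm (g w)) = Re (h w) + (\<Sum>b | b \<in> singular_set g \<and> norm b \<le> \<rho>. of_int (zorder g b) * ln (norm (w - b)))"
    by (rule log_norm_factorization[OF g, of \<rho>]) blast
  define B where "B = {b \<in> singular_set g. norm b \<le> \<rho>}"
  define B' where "B' = {b \<in> singular_set g. norm b \<le> R}"
  have fin: "finite B" "finite B'" unfolding B_def B'_def by (rule finite_singular_set[OF g])+
  have BR: "norm b < R" if "b \<in> B'" for b
    using that R by (force simp: B'_def generic_radius_def)
  note zR = z(1)
  have zB: "z \<notin> B" using z by (auto simp: B_def)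
  define I where "I = integral {0..2*pi} (\<lambda>t. ln (norm (g (of_real R * cis t))) * poisson_kernel z (of_real R * cis t))"
  define J where "J = integral {0..2*pi} (\<lambda>t. log_plus (norm (g (of_real R * cis t))) * poisson_kernel z (of_real R * cis t))"
  have "((\<lambda>t. (Re (h (0 + 1 * (of_real R * cis t))) +
                (\<Sum>b\<in>B. of_int (zorder g b) * ln (norm (0 + 1 * (of_real R * cis t) - b)))) * poisson_kernel z (of_real R * cis t))
      has_integral 2 * pi * (Re (h (0 + 1 * z)) +
        (\<Sum>b\<in>B. of_int (zorder g b) * (if norm (b - 0) < R then ln (norm (of_real R - cnj ((b - 0) / 1) * z / of_real R))
                       else ln (norm (0 + 1 * z - b)))))) {0..2*pi}"
    by (rule poisson_jensen[OF h(1) fin(1)])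
       (use R R0 z in \<open>auto simp: \<rho>_def B_def generic_radius_def\<close>)
  then have "((\<lambda>t. (Re (h (of_real R * cis t)) +
                (\<Sum>b\<in>B. of_int (zorder g b) * ln (norm (of_real R * cis t - b)))) * poisson_kernel z (of_real R * cis t))
      has_integral 2 * pi * (Re (h z) +
        (\<Sum>b\<in>B. of_int (zorder g b) * (if norm b < R then ln (norm (of_real R - cnj b * z / of_real R))
                       else ln (norm (z - b)))))) {0..2*pi}" by (simp cong: if_cong)
  moreover have "Re (h (of_real R * cis t)) + (\<Sum>b\<in>B. of_int (zorder g b) * ln (norm (of_real R * cis t - b)))
      = ln (norm (g (of_real R * cis t)))" for t
    using h(2)[of "of_real R * cis t"] circle_generic(3)[of g "of_real R * cis t"] R R0
    by (simp add: \<rho>_def B_def)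
  ultimately have hi: "((\<lambda>t. ln (norm (g (of_real R * cis t))) * poisson_kernel z (of_real R * cis t))
      has_integral 2 * pi * (Re (h z) +
        (\<Sum>b\<in>B. of_int (zorder g b) * (if norm b < R then ln (norm (of_real R - cnj b * z / of_real R))
                       else ln (norm (z - b)))))) {0..2*pi}" by simp
  have "I = 2 * pi * (Re (h z) + (\<Sum>b\<in>B. of_int (zorder g b) * (if norm b < R then ln (norm (of_real R - cnj b * z / of_real R))
                       else ln (norm (z - b)))))"
    unfolding I_def by (rule integral_unique[OF hi])
  also have "(\<Sum>b\<in>B. of_int (zorder g b) * (if norm b < R then ln (norm (of_real R - cnj b * z / of_real R))
                       else ln (norm (z - b))))
     = (\<Sum>b\<in>B. of_int (zorder g b) * ln (norm (z - b))) + (\<Sum>b\<in>B. if norm b < R then of_int (zorder g b) * green R b z else 0)"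
    unfolding sum.distrib[symmetric] by (intro sum.cong refl) (auto simp: green_def algebra_simps)
  also have "(\<Sum>b\<in>B. if norm b < R then of_int (zorder g b) * green R b z else 0) = (\<Sum>b\<in>B'. of_int (zorder g b) * green R b z)"
  proof -
    have "B' = {b \<in> B. norm b < R}" using BR by (auto simp: B_def B'_def \<rho>_def)
    then show ?thesis using fin(1) by (simp add: sum.inter_filter)
  qed
  finally have "I = 2 * pi * (ln (norm (g z)) + (\<Sum>b\<in>B'. of_int (zorder g b) * green R b z))"
    using h(2)[of z] z by (simp add: \<rho>_def B_def add.assoc)
  then have "ln (norm (g z)) = I / (2*pi) - (\<Sum>b\<in>B'. of_int (zorder g b) * green R b z)"
    by simp
  also have "\<dots> \<le> J / (2*pi) + (\<Sum>b\<in>B'. real (pole_order g b) * green R b z)"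
  proof -
    have "(\<Sum>b\<in>B'. - of_int (zorder g b) * green R b z) \<le> (\<Sum>b\<in>B'. real (pole_order g b) * green R b z)"
      by (intro sum_mono mult_right_mono)
         (use BR z zorder_eq_zero_order_minus_pole_order[OF g] in \<open>auto simp: B'_def intro!: green_nonneg\<close>)
    moreover have "I \<le> J"
      unfolding I_def J_def
    proof (rule integral_le)
      show "(\<lambda>t. ln (norm (g (of_real R * cis t))) * poisson_kernel z (of_real R * cis t)) integrable_on {0..2*pi}"
        using hi by blast
      show "(\<lambda>t. log_plus (norm (g (of_real R * cis t))) * poisson_kernel z (of_real R * cis t)) integrable_on {0..2*pi}"
        by (intro integrable_continuous_real continuous_intros continuous_on_circle[OF R])
           (use z norm_circle[of R] R0 in \<open>metis less_eq_real_def less_irrefl\<close>)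
    qed (use z R0 continuous_on_circle(2)[OF R] in \<open>auto intro!: mult_right_mono ln_le_log_plus poisson_kernel_nonneg\<close>)
    moreover have "I / (2*pi) \<le> J / (2*pi)"
      using \<open>I \<le> J\<close> by (intro divide_right_mono) auto
    ultimately show ?thesis by (simp add: sum_negf)
  qed
  finally have le: "ln (norm (g z)) \<le> J / (2*pi) + (\<Sum>b\<in>B'. real (pole_order g b) * green R b z)" .
  have "0 \<le> J" unfolding J_def
  proof (rule integral_nonneg)
    show "(\<lambda>t. log_plus (norm (g (of_real R * cis t))) * poisson_kernel z (of_real R * cis t)) integrable_on {0..2*pi}"
      by (intro integrable_continuous_real continuous_intros continuous_on_circle[OF R])
         (use z norm_circle[of R] R0 in \<open>metis less_eq_real_def less_irrefl\<close>)
  qed (use z R0 in \<open>auto intro!: mult_nonneg_nonneg log_plus_nonneg poisson_kernel_nonneg\<close>)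
  moreover have "0 \<le> (\<Sum>b\<in>B'. real (pole_order g b) * green R b z)"
    by (intro sum_nonneg mult_nonneg_nonneg green_nonneg) (use BR z in \<open>auto simp: B'_def\<close>)
  ultimately have "0 \<le> J / (2*pi) + (\<Sum>b\<in>B'. real (pole_order g b) * green R b z)" by simp
  with le have "log_plus (norm (g z)) \<le> J / (2*pi) + (\<Sum>b\<in>B'. real (pole_order g b) * green R b z)"
    using z by (intro log_plus_le) (auto simp: singular_set_def)
  then show ?thesis by (simp add: J_def B'_def)
qed

text \<open>
  The previous inequality is averaged over the smaller circle. The mean of the Poisson kernel is \<open>1\<close>,
  and the mean of a Green function is precisely the increment of the integrated pole count.
\<close>

lemma proximity_almost_mono:
  assumes g: "nonzero_meromorphic g" and r: "generic_radius g r" and R: "generic_radius g R" and rR: "r < R"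
  shows "proximity r g + integrated_count (pole_count g) r \<le> proximity R g + integrated_count (pole_count g) R"
proof -
  define B where "B = {b \<in> singular_set g. norm b \<le> R}"
  have fin: "finite B" unfolding B_def by (rule finite_singular_set[OF g])
  have r0: "0 < r" "0 < R" using r R by (auto simp: generic_radius_def)
  have B: "norm b < R" "norm b \<noteq> r" if "b \<in> B" for b
    using that R r by (force simp: B_def generic_radius_def)+
  define F where "F s t = log_plus (norm (g (of_real R * cis t))) * poisson_kernel (of_real r * cis s) (of_real R * cis t)" for s t
  have ne: "of_real r * cis s \<noteq> of_real R * cis t" for s t
    using norm_circle[of r s] norm_circle[of R t] r0 rR by (metis less_eq_real_def less_irrefl)
  have "continuous_on (cbox (0,0) (2*pi,2*pi)) (\<lambda>(s,t). F s t)"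
  proof -
    have c: "continuous_on A (\<lambda>p. g (of_real R * cis (snd p)))" for A :: "(real \<times> real) set"
      by (rule continuous_on_compose2[OF continuous_on_circle(1)[OF R, of UNIV]]) (auto intro!: continuous_intros)
    show ?thesis
      unfolding F_def case_prod_beta by (intro continuous_intros c) (use ne in auto)
  qed
  from integral_swap_continuous[OF this]
  have swap: "integral {0..2*pi} (\<lambda>s. integral {0..2*pi} (F s)) = integral {0..2*pi} (\<lambda>t. integral {0..2*pi} (\<lambda>s. F s t))"
    by (simp add: cbox_interval)
  have inner: "integral {0..2*pi} (\<lambda>s. F s t) = log_plus (norm (g (of_real R * cis t))) * (2 * pi)" for t
    unfolding F_def using has_integral_mult_right[OF mean_poisson_kernel[of r "of_real R * cis t"]] r0 rR
    by (intro integral_unique) simp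
  have contF: "(\<lambda>s. integral {0..2*pi} (F s)) integrable_on {0..2*pi}"
  proof -
    have c: "continuous_on A (\<lambda>p. g (of_real R * cis (snd p)))" for A :: "(real \<times> real) set"
      by (rule continuous_on_compose2[OF continuous_on_circle(1)[OF R, of UNIV]]) (auto intro!: continuous_intros)
    have "continuous_on (cbox 0 (2*pi) \<times> cbox 0 (2*pi)) (\<lambda>(s,t). F s t)"
      unfolding F_def case_prod_beta by (intro continuous_intros c) (use ne in auto)
    from integral_continuous_on_param[OF this] show ?thesis
      by (intro integrable_continuous_real) (simp add: cbox_interval)
  qed
  define G where "G s = (\<Sum>b\<in>B. real (pole_order g b) * green R b (of_real r * cis s))" for s
  have G: "(G has_integral (\<Sum>b\<in>B. real (pole_order g b) * (2 * pi * (ln R - ln (max r (norm b)))))) {0..2*pi}"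
    unfolding G_def
    by (intro has_integral_sum fin has_integral_mult_right mean_green r0 rR B)
  have "integral {0..2*pi} (\<lambda>s. log_plus (norm (g (of_real r * cis s))))
     \<le> integral {0..2*pi} (\<lambda>s. integral {0..2*pi} (F s) / (2*pi) + G s)"
  proof (rule integral_le)
    show "(\<lambda>s. log_plus (norm (g (of_real r * cis s)))) integrable_on {0..2*pi}"
      by (intro integrable_on_circle[OF r] continuous_intros)
    show "(\<lambda>s. integral {0..2*pi} (F s) / (2*pi) + G s) integrable_on {0..2*pi}"
      using G by (intro integrable_add integrable_on_divide contF) blast
    fix s
    show "log_plus (norm (g (of_real r * cis s))) \<le> integral {0..2*pi} (F s) / (2*pi) + G s"
      using log_plus_poisson_jensen[OF g R, of "of_real r * cis s"] r0 rR r circle_generic(3)[of g "of_real r * cis s"]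
      by (simp add: F_def[abs_def] G_def B_def)
  qed
  also have "\<dots> = integral {0..2*pi} (\<lambda>s. integral {0..2*pi} (F s)) / (2*pi) + integral {0..2*pi} G"
    using G contF by (subst integral_add) (auto intro: integrable_on_divide)
  also have "integral {0..2*pi} (\<lambda>s. integral {0..2*pi} (F s)) / (2*pi) = 2 * pi * proximity R g"
    unfolding swap inner by (simp add: proximity_def)
  finally have "2 * pi * proximity r g \<le> 2 * pi * proximity R g + integral {0..2*pi} G"
    by (simp add: proximity_def)
  also have "integral {0..2*pi} G = 2 * pi * (\<Sum>b\<in>B. real (pole_order g b) * (ln R - ln (max r (norm b))))"
    using integral_unique[OF G] by (simp add: sum_distrib_left mult.left_commute)
  finally have "proximity r g \<le> proximity R g + (\<Sum>b\<in>B. real (pole_order g b) * (ln R - ln (max r (norm b))))"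
    by (simp add: distrib_left[symmetric])
  also have "(\<Sum>b\<in>B. real (pole_order g b) * (ln R - ln (max r (norm b))))
     = (\<Sum>b\<in>B. real (pole_order g b) * (log_excess (norm b) R - log_excess (norm b) r))"
    by (intro sum.cong refl) (use B(1) r0 in \<open>force simp: log_excess_diff max_def\<close>)
  also have "\<dots> = integrated_count (pole_count g) R - integrated_count (pole_count g) r"
    using r0 rR fin unfolding pole_count_step_count[OF g] B_def
    by (subst (1 2) integrated_count_step_count[where R=R])
       (auto simp: right_diff_distrib sum_subtractf)
  finally show ?thesis by simp
qed

text \<open>
  A point counted at radius \<open>x\<close> contributes at least \<open>ln (R / x)\<close>, hence at least \<open>(R - x) / R\<close>, to the
  integrated count at \<open>R\<close>.
\<close>

lemma step_count_le_integrated_count: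
  assumes fin: "finite {b \<in> S. \<rho> b \<le> R}" and x: "1 \<le> x" "x < R" and nn: "\<And>b. b \<in> S \<Longrightarrow> 0 \<le> \<rho> b"
    and c: "\<And>b. b \<in> S \<Longrightarrow> 0 \<le> c b"
  shows "step_count \<rho> c S x \<le> R / (R - x) * integrated_count (step_count \<rho> c S) R"
proof -
  have R: "0 < R" using x by auto
  have s0: "0 \<le> step_count \<rho> c S x" unfolding step_count_def using c by (intro sum_nonneg) auto
  have "step_count \<rho> c S x * (ln R - ln x) = (\<Sum>b | b \<in> S \<and> \<rho> b \<le> R. c b * (if \<rho> b \<le> x then 1 else 0) * (ln R - ln x))"
    using x by (simp add: step_count_eq[OF fin] sum_distrib_right)
  also have "\<dots> \<le> (\<Sum>b | b \<in> S \<and> \<rho> b \<le> R. c b * log_excess (\<rho> b) R)"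
  proof (rule sum_mono)
    fix b assume b: "b \<in> {b. b \<in> S \<and> \<rho> b \<le> R}"
    have "(if \<rho> b \<le> x then 1 else 0) * (ln R - ln x) \<le> log_excess (\<rho> b) R"
      using x nn[of b] b log_excess_nonneg[of "\<rho> b" R] by (auto simp: log_excess_def)
    then show "c b * (if \<rho> b \<le> x then 1 else 0) * (ln R - ln x) \<le> c b * log_excess (\<rho> b) R"
      using mult_left_mono[OF _ c[of b]] b by (simp add: mult.assoc)
  qed
  also have "\<dots> = integrated_count (step_count \<rho> c S) R"
    using R by (subst integrated_count_step_count(1)[OF fin _ order_refl nn]) auto
  finally have 1: "step_count \<rho> c S x * (ln R - ln x) \<le> integrated_count (step_count \<rho> c S) R" .
  have "ln (x / R) \<le> x / R - 1" using x R by (intro ln_le_minus_one) auto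
  then have "(R - x) / R \<le> ln R - ln x" using x R by (simp add: ln_div diff_divide_distrib)
  then have "step_count \<rho> c S x * ((R - x) / R) \<le> integrated_count (step_count \<rho> c S) R"
    using mult_left_mono[OF _ s0] 1 by (meson order_trans)
  then show ?thesis using x R by (simp add: field_simps)
qed

lemma integrated_counts_nonneg:
  assumes g: "nonzero_meromorphic g" and r: "1 \<le> r"
  shows "0 \<le> integrated_count (zero_count g) r" "0 \<le> integrated_count (pole_count g) r"
  unfolding zero_count_def pole_count_step_count[OF g]
  by (intro integrated_count_nonneg finite_singular_set g r; simp)+

lemma proximity_nonneg: "generic_radius g r \<Longrightarrow> 0 \<le> proximity r g"
  unfolding proximity_def
  by (intro divide_nonneg_nonneg integral_nonneg integrable_on_circle[of g r "\<lambda>w. log_plus (norm w)"] continuous_intros log_plus_nonneg) auto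

lemma proximity_inverse_nonneg: "generic_radius g r \<Longrightarrow> 0 \<le> proximity r (\<lambda>z. inverse (g z))"
  unfolding proximity_def
  by (intro divide_nonneg_nonneg integral_nonneg continuous_intros log_plus_nonneg
      integrable_on_circle[of g r "\<lambda>w. log_plus (norm (inverse w))"]) auto

lemma characteristic_nonneg:
  assumes "nonzero_meromorphic g" "generic_radius g r" "1 \<le> r"
  shows "0 \<le> characteristic r g"
  using assms by (simp add: characteristic_def proximity_nonneg integrated_counts_nonneg)

text \<open>
  Nevanlinna's first main theorem, for the value \<open>0\<close>.
\<close>

lemma proximity_inverse:
  assumes g: "nonzero_meromorphic g"
  obtains C where "\<And>r. generic_radius g r \<Longrightarrow>
    proximity r (\<lambda>z. inverse (g z)) = characteristic r g - integrated_count (zero_count g) r + C"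
proof -
  obtain C where C: "\<And>r. generic_radius g r \<Longrightarrow> circle_mean (\<lambda>z. ln (norm (g z))) r
      = integrated_count (zero_count g) r - integrated_count (pole_count g) r + C"
    by (rule jensen_counts[OF g]) blast
  have "proximity r (\<lambda>z. inverse (g z)) = characteristic r g - integrated_count (zero_count g) r + (- C)"
    if "generic_radius g r" for r
    using C[OF that] proximity_minus_proximity_inverse[OF that] by (simp add: characteristic_def)
  then show ?thesis by (rule that)
qed

lemma characteristic_almost_mono:
  assumes "nonzero_meromorphic g" "generic_radius g r" "generic_radius g R" "r \<le> R"
  shows "characteristic r g \<le> characteristic R g"
  using proximity_almost_mono[OF assms(1-3)] assms(4)
  by (cases "r = R") (auto simp: characteristic_def)

section \<open>The mean over a circle of a square-root singularity\<close>

text \<open>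
  A truncated inverse square root. It dominates a logarithmic singularity near \<open>0\<close>, and the square root
  is weak enough for its integral over \<open>[-\<beta>, \<beta>]\<close> to grow only like \<open>\<surd>\<beta>\<close>.
\<close>

definition sqrt_kernel :: "real \<Rightarrow> real \<Rightarrow> real" where
  "sqrt_kernel \<beta> d = (if d < \<beta> then 1 / sqrt d else 0)"

lemma sqrt_kernel_nonneg: "0 \<le> d \<Longrightarrow> 0 \<le> sqrt_kernel \<beta> d"
  by (simp add: sqrt_kernel_def)

lemma sqrt_kernel_antimono: "0 < d \<Longrightarrow> d \<le> d' \<Longrightarrow> sqrt_kernel \<beta> d' \<le> sqrt_kernel \<beta> d"
  by (auto simp: sqrt_kernel_def intro!: divide_left_mono)

lemma borel_measurable_sqrt_kernel [measurable]: "sqrt_kernel \<beta> \<in> borel_measurable borel"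
  unfolding sqrt_kernel_def[abs_def] by measurable

lemma nn_integral_sqrt_kernel:
  assumes "0 < \<beta>"
  shows "(\<integral>\<^sup>+y. ennreal (sqrt_kernel \<beta> \<bar>y\<bar>) \<partial>lborel) \<le> ennreal (4 * sqrt \<beta>)"
proof -
  have "((\<lambda>y. 1 / sqrt \<bar>y\<bar>) has_integral (2 * sqrt \<beta> - 2 * sqrt (- \<beta>))) {-\<beta>..\<beta>}"
  proof (rule fundamental_theorem_of_calculus_interior_strong[of "{0}"])
    fix x assume x: "x \<in> {-\<beta><..<\<beta>} - {0}"
    show "((\<lambda>y. 2 * sqrt y) has_vector_derivative 1 / sqrt \<bar>x\<bar>) (at x)"
    proof (cases "x > 0")
      case True
      then show ?thesis
        by (auto intro!: derivative_eq_intros simp: divide_simps simp flip: has_real_derivative_iff_has_vector_derivative)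
    next
      case False
      then have "x < 0" using x by auto
      have "((\<lambda>y. - 2 * sqrt (- y)) has_real_derivative 1 / sqrt \<bar>x\<bar>) (at x)"
        using \<open>x < 0\<close> by (auto intro!: derivative_eq_intros simp: divide_simps)
      moreover have "(\<lambda>y::real. - 2 * sqrt (- y)) = (\<lambda>y. 2 * sqrt y)" by (simp add: real_sqrt_minus)
      ultimately show ?thesis by (simp add: has_real_derivative_iff_has_vector_derivative)
    qed
  qed (use assms in \<open>auto intro!: continuous_intros\<close>)
  then have "((\<lambda>y. 1 / sqrt \<bar>y\<bar>) has_integral (4 * sqrt \<beta>)) {-\<beta>..\<beta>}"
    by (simp add: real_sqrt_minus)
  from nn_integral_has_integral_lebesgue'[OF _ this]
  have "(\<integral>\<^sup>+y. ennreal (1 / sqrt \<bar>y\<bar>) * indicator {-\<beta>..\<beta>} y \<partial>lborel) = ennreal (4 * sqrt \<beta>)" by simp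
  moreover have "(\<integral>\<^sup>+y. ennreal (sqrt_kernel \<beta> \<bar>y\<bar>) \<partial>lborel) \<le> (\<integral>\<^sup>+y. ennreal (1 / sqrt \<bar>y\<bar>) * indicator {-\<beta>..\<beta>} y \<partial>lborel)"
    by (rule nn_integral_mono) (auto simp: sqrt_kernel_def indicator_def)
  ultimately show ?thesis by simp
qed

lemma sin_ge_third:
  assumes "0 \<le> y" "y \<le> pi / 2"
  shows "y / 3 \<le> sin y"
proof -
  have rt: "4/3 \<le> sqrt (2::real)"
    by (rule real_le_rsqrt) (simp add: power2_eq_square)
  show ?thesis
  proof (cases "y \<le> pi / 4")
    case True
    have "sin 0 - 0 / 3 \<le> sin y - y / 3"
    proof (rule DERIV_nonneg_imp_nondecreasing[OF assms(1), of "\<lambda>y. sin y - y / 3"])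
      fix x assume x: "0 \<le> x" "x \<le> y"
      have "cos (pi / 4) \<le> cos x"
        using x True pi_gt_zero by (subst cos_mono_le_eq) auto
      then have "0 \<le> cos x - 1 / 3" using rt by (simp add: cos_45)
      moreover have "((\<lambda>y. sin y - y / 3) has_real_derivative (cos x - 1 / 3)) (at x)"
        by (auto intro!: derivative_eq_intros)
      ultimately show "\<exists>D. ((\<lambda>y. sin y - y / 3) has_real_derivative D) (at x) \<and> 0 \<le> D" by blast
    qed
    then show ?thesis by simp
  next
    case False
    have "sin (pi / 4) \<le> sin y"
      using False assms by (subst sin_mono_le_eq) auto
    then show ?thesis using rt pi_less_4 assms by (simp add: sin_45)
  qed
qed

text \<open>
  The interval is where \<open>t - Arg c\<close> ranges for an angle \<open>t \<in> [0, 2\<pi>]\<close>; the nearest multiple of \<open>\<pi>\<close> is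
  then one of five.
\<close>

lemma abs_sin_ge:
  assumes "-pi \<le> x" "x \<le> 3 * pi"
  shows "\<exists>m\<in>{-1..3::int}. \<bar>x - of_int m * pi\<bar> / 3 \<le> \<bar>sin x\<bar>"
proof -
  define m where "m = round (x / pi)"
  have "\<bar>of_int m - x / pi\<bar> \<le> 1 / 2"
    unfolding m_def by (rule of_int_round_abs_le)
  then have "\<bar>of_int m - x / pi\<bar> * pi \<le> 1 / 2 * pi"
    by (intro mult_right_mono) auto
  moreover have "\<bar>of_int m - x / pi\<bar> * pi = \<bar>x - of_int m * pi\<bar>"
  proof -
    have "\<bar>of_int m - x / pi\<bar> * pi = \<bar>(of_int m - x / pi) * pi\<bar>" by (simp add: abs_mult)
    also have "(of_int m - x / pi) * pi = of_int m * pi - x" by (simp add: left_diff_distrib)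
    finally show ?thesis by (simp add: abs_minus_commute)
  qed
  ultimately have d: "\<bar>x - of_int m * pi\<bar> \<le> pi / 2" by simp
  have "-1 \<le> x / pi" "x / pi \<le> 3" using assms by (simp_all add: pos_le_divide_eq pos_divide_le_eq)
  then have "round (-1 :: real) \<le> m" "m \<le> round (3 :: real)"
    unfolding m_def by (blast intro: round_mono)+
  then have m: "m \<in> {-1..3}" using round_of_int[of "-1", where ?'a=real] round_of_int[of 3, where ?'a=real] by simp
  define y where "y = x - of_int m * pi"
  have "\<bar>sin x\<bar> = \<bar>sin y\<bar>"
  proof -
    have "sin x = sin (y + of_int m * pi)" by (simp add: y_def)
    also have "\<dots> = sin y * cos (of_int m * pi)" by (simp add: sin_add sin_integer_2pi mult.commute)
    finally show ?thesis by (simp add: abs_mult mult.commute[of _ pi])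
  qed
  also have "\<dots> = sin \<bar>y\<bar>"
  proof (cases "0 \<le> y")
    case True
    then show ?thesis using sin_ge_third[of y] d by (simp add: y_def)
  next
    case False
    then show ?thesis using sin_ge_third[of "- y"] d unfolding y_def[symmetric] by simp
  qed
  finally have "\<bar>y\<bar> / 3 \<le> \<bar>sin x\<bar>" using sin_ge_third[of "\<bar>y\<bar>"] d by (simp add: y_def)
  then show ?thesis using m by (auto simp: y_def)
qed

text \<open>
  The distance of the point \<open>r \<cdot> cis t\<close> to \<open>c\<close> is at least its distance to the line through \<open>0\<close> and \<open>c\<close>,
  which is \<open>r |sin (t - Arg c)|\<close>. The circle may thus be replaced by five copies of the real line,
  uniformly in the position of \<open>c\<close>. The constant \<open>60\<close>
  is \<open>5 \<cdot> 3 \<cdot> 4\<close>: five lines, the factor \<open>3\<close> of \<open>abs_sin_ge\<close> and \<open>4 \<surd>\<beta>\<close> for the integral over each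
  line.
\<close>

lemma mean_sqrt_kernel_circle:
  assumes r: "0 < r" and b: "0 < \<beta>"
  shows "(\<integral>\<^sup>+t. ennreal (sqrt_kernel \<beta> (norm (c - of_real r * cis t))) * indicator {0..2*pi} t \<partial>lborel)
           \<le> ennreal (60 * sqrt \<beta> / r)"
proof -
  define \<tau> where "\<tau> = Arg c"
  have c: "c = of_real (norm c) * cis \<tau>"
    unfolding \<tau>_def using rcis_cmod_Arg[of c] by (simp add: rcis_def)
  have \<tau>: "-pi < \<tau>" "\<tau> \<le> pi" unfolding \<tau>_def using Arg_bounded[of c] by auto
  define k where "k m t = sqrt_kernel \<beta> (r / 3 * \<bar>t - \<tau> - of_int m * pi\<bar>)" for m :: int and t
  have pw: "ennreal (sqrt_kernel \<beta> (norm (c - of_real r * cis t))) * indicator {0..2*pi} t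
      \<le> (\<Sum>m\<in>{-1..3}. ennreal (k m t))" if t: "t \<notin> (\<lambda>m::int. \<tau> + of_int m * pi) ` {-1..3}" for t
  proof (cases "t \<in> {0..2*pi}")
    case True
    then obtain m :: int where m: "m \<in> {-1..3}" "\<bar>t - \<tau> - of_int m * pi\<bar> / 3 \<le> \<bar>sin (t - \<tau>)\<bar>"
      using abs_sin_ge[of "t - \<tau>"] \<tau> by auto
    have "c - of_real r * cis t = cis \<tau> * (of_real (norm c) - of_real r * cis (t - \<tau>))"
      using c by (simp add: right_diff_distrib cis_mult mult.left_commute mult.commute)
    then have "norm (c - of_real r * cis t) = norm (of_real (norm c) - of_real r * cis (t - \<tau>))"
      by (simp add: norm_mult)
    also have "\<dots> \<ge> \<bar>Im (of_real (norm c) - of_real r * cis (t - \<tau>))\<bar>"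
      by (rule abs_Im_le_cmod)
    finally have 1: "r * \<bar>sin (t - \<tau>)\<bar> \<le> norm (c - of_real r * cis t)"
      using r by (simp add: abs_mult)
    have "r * (\<bar>t - \<tau> - of_int m * pi\<bar> / 3) \<le> r * \<bar>sin (t - \<tau>)\<bar>"
      using m(2) r by (intro mult_left_mono) auto
    with 1 have "r / 3 * \<bar>t - \<tau> - of_int m * pi\<bar> \<le> norm (c - of_real r * cis t)" by simp
    moreover have "0 < r / 3 * \<bar>t - \<tau> - of_int m * pi\<bar>"
    proof -
      have "t \<noteq> \<tau> + of_int m * pi" using t m(1) by blast
      then show ?thesis using r by simp
    qed
    ultimately have "sqrt_kernel \<beta> (norm (c - of_real r * cis t)) \<le> k m t"
      unfolding k_def by (rule sqrt_kernel_antimono[rotated])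
    then have "ennreal (sqrt_kernel \<beta> (norm (c - of_real r * cis t))) \<le> ennreal (k m t)"
      by (rule ennreal_leI)
    also have "\<dots> \<le> (\<Sum>m\<in>{-1..3}. ennreal (k m t))"
      using m(1) by (intro member_le_sum) auto
    finally show ?thesis using True by simp
  qed simp
  have "finite ((\<lambda>m::int. \<tau> + of_int m * pi) ` {-1..3})" by simp
  then have "AE t in lborel. t \<notin> (\<lambda>m::int. \<tau> + of_int m * pi) ` {-1..3}"
    by (intro AE_not_in countable_imp_null_set_lborel countable_finite)
  then have "(\<integral>\<^sup>+t. ennreal (sqrt_kernel \<beta> (norm (c - of_real r * cis t))) * indicator {0..2*pi} t \<partial>lborel)
     \<le> (\<integral>\<^sup>+t. (\<Sum>m\<in>{-1..3}. ennreal (k m t)) \<partial>lborel)"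
    by (intro nn_integral_mono_AE) (auto elim!: eventually_mono intro: pw)
  also have "\<dots> = (\<Sum>m\<in>{-1..3}. \<integral>\<^sup>+t. ennreal (k m t) \<partial>lborel)"
    unfolding k_def by (rule nn_integral_sum) measurable
  also have "\<dots> \<le> (\<Sum>m\<in>{-1..3::int}. ennreal (3 / r * (4 * sqrt \<beta>)))"
  proof (rule sum_mono)
    fix m :: int
    have "(\<integral>\<^sup>+t. ennreal (k m t) \<partial>lborel)
       = ennreal \<bar>3 / r\<bar> * (\<integral>\<^sup>+x. ennreal (k m (\<tau> + of_int m * pi + 3 / r * x)) \<partial>lborel)"
      unfolding k_def using r by (intro nn_integral_real_affine) auto
    also have "(\<lambda>x. k m (\<tau> + of_int m * pi + 3 / r * x)) = (\<lambda>x. sqrt_kernel \<beta> \<bar>x\<bar>)"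
      using r by (simp add: k_def fun_eq_iff abs_mult)
    also have "ennreal \<bar>3 / r\<bar> * (\<integral>\<^sup>+x. ennreal (sqrt_kernel \<beta> \<bar>x\<bar>) \<partial>lborel) \<le> ennreal \<bar>3 / r\<bar> * ennreal (4 * sqrt \<beta>)"
      by (intro mult_left_mono nn_integral_sqrt_kernel b) auto
    also have "\<dots> = ennreal (3 / r * (4 * sqrt \<beta>))"
      using r b by (subst ennreal_mult) auto
    finally show "(\<integral>\<^sup>+t. ennreal (k m t) \<partial>lborel) \<le> ennreal (3 / r * (4 * sqrt \<beta>))" .
  qed
  also have "\<dots> = ennreal (60 * sqrt \<beta> / r)"
    using r b by (subst sum_ennreal) auto
  finally show ?thesis .
qed

text \<open>
  The square of the norm is a nonconstant affine function of \<open>cos (t + \<phi>)\<close> for some phase \<open>\<phi>\<close>.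
\<close>

lemma countable_circle_level:
  assumes "c \<noteq> 0" "d \<noteq> 0"
  shows "countable {t. norm (c + d * cis t) = k}"
proof -
  define w where "w = cnj c * d"
  have w0: "norm w \<noteq> 0" using assms by (simp add: w_def)
  have w: "w = of_real (norm w) * cis (Arg w)"
    using rcis_cmod_Arg[of w] by (simp add: rcis_def)
  define K where "K = (k\<^sup>2 - (norm c)\<^sup>2 - (norm d)\<^sup>2) / (2 * norm w)"
  have nrm: "(norm (c + d * cis t))\<^sup>2 = (norm c)\<^sup>2 + (norm d)\<^sup>2 + 2 * norm w * cos (Arg w + t)" for t
  proof -
    have "(norm (c + d * cis t))\<^sup>2 = (norm c)\<^sup>2 + (norm (d * cis t))\<^sup>2 + 2 * Re (cnj c * (d * cis t))"
      unfolding cmod_power2 by (simp add: power2_eq_square algebra_simps)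
    also have "cnj c * (d * cis t) = of_real (norm w) * cis (Arg w + t)"
      using w by (simp add: w_def cis_mult[symmetric] mult.assoc)
    finally show ?thesis by (simp add: norm_mult)
  qed
  have sub: "{t. norm (c + d * cis t) = k} \<subseteq> {t. cos (Arg w + t) = K}"
  proof safe
    fix t assume "k = norm (c + d * cis t)"
    then show "cos (Arg w + t) = K" using nrm[of t] w0 by (simp add: K_def)
  qed
  show ?thesis
  proof (cases "\<exists>x. cos x = K")
    case True
    then obtain x where x: "cos x = K" by blast
    have "{t. cos (Arg w + t) = K} \<subseteq> (\<Union>n\<in>\<int>. {x + 2*n*pi - Arg w, - x + 2*n*pi - Arg w})"
    proof
      fix t assume "t \<in> {t. cos (Arg w + t) = K}"
      then have "cos (Arg w + t) = cos x" using x by simp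
      then obtain n where n: "n \<in> \<int>" "Arg w + t = x + 2*n*pi \<or> Arg w + t = - x + 2*n*pi"
        unfolding cos_eq by blast
      then have "t = x + 2*n*pi - Arg w \<or> t = - x + 2*n*pi - Arg w" by linarith
      then show "t \<in> (\<Union>n\<in>\<int>. {x + 2*n*pi - Arg w, - x + 2*n*pi - Arg w})" using n(1) by blast
    qed
    moreover have "countable (\<Union>n\<in>\<int>. {x + 2*n*pi - Arg w, - x + 2*n*pi - Arg w})"
      by (intro countable_UN countable_int) auto
    ultimately show ?thesis by (rule countable_subset[OF order_trans[OF sub]])
  next
    case False
    then have "{t. norm (c + d * cis t) = k} = {}" using sub by blast
    then show ?thesis by simp
  qed
qed

lemma nn_integral_continuous_interval:
  assumes "continuous_on {a..b} f" "\<And>x. x \<in> {a..b} \<Longrightarrow> 0 \<le> f x"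
  shows "(\<integral>\<^sup>+x. ennreal (f x) * indicator {a..b} x \<partial>lborel) = ennreal (integral {a..b::real} f)"
  using assms by (intro nn_integral_has_integral_lebesgue' integrable_integral integrable_continuous_real)

text \<open>
  A rotation shifts the angle, and the integral over a full period is not affected by a shift.
\<close>

lemma integral_circle_rotate:
  fixes f :: "complex \<Rightarrow> real"
  assumes cont: "continuous_on UNIV (\<lambda>t. f (of_real \<rho> * cis t))" and w: "norm w = \<rho>"
  shows "integral {0..2*pi} (\<lambda>t. f (cis t * w)) = integral {0..2*pi} (\<lambda>t. f (of_real \<rho> * cis t))"
proof -
  define F where "F t = f (of_real \<rho> * cis t)" for t
  define \<tau> where "\<tau> = Arg2pi w"
  have \<tau>: "0 \<le> \<tau>" "\<tau> < 2 * pi" unfolding \<tau>_def using Arg2pi[of w] by auto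
  have ww: "w = of_real \<rho> * cis \<tau>"
    using Arg2pi[of w] w by (simp add: \<tau>_def cis_conv_exp is_Arg_def)
  have cF: "continuous_on A F" for A using cont continuous_on_subset unfolding F_def[abs_def] by blast
  then have iF: "F integrable_on {a..b}" for a b by (rule integrable_continuous_real)
  have per: "F (t + 2 * pi) = F t" for t by (simp add: F_def cis_mult[symmetric])
  have shift: "integral {a..b} (\<lambda>t. F (t + c)) = integral {a+c..b+c} F" for a b c
    using integral_shift_Icc_real[of a b F c] by (simp add: o_def add.commute)
  have "integral {0..2*pi} (\<lambda>t. f (cis t * w)) = integral {0..2*pi} (\<lambda>t. F (t + \<tau>))"
    by (simp add: F_def ww cis_mult[symmetric] mult_ac)
  also have "\<dots> = integral {\<tau>..2*pi+\<tau>} F" by (simp add: shift)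
  also have "\<dots> = integral {\<tau>..2*pi} F + integral {2*pi..2*pi+\<tau>} F"
    using \<tau> by (intro Henstock_Kurzweil_Integration.integral_combine[symmetric] iF) auto
  also have "integral {2*pi..2*pi+\<tau>} F = integral {0..\<tau>} (\<lambda>t. F (t + 2 * pi))"
    by (simp add: shift add.commute)
  also have "\<dots> = integral {0..\<tau>} F" by (simp add: per)
  also have "integral {\<tau>..2*pi} F + integral {0..\<tau>} F = integral {0..2*pi} F"
    using \<tau> Henstock_Kurzweil_Integration.integral_combine[of 0 \<tau> "2*pi" F] iF by simp
  finally show ?thesis by (simp add: F_def[abs_def])
qed

section \<open>The logarithmic difference\<close>

lemma ln_one_plus_square_le: "0 \<le> s \<Longrightarrow> ln (1 + s\<^sup>2) \<le> 2 * (s::real)"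
proof -
  assume s: "0 \<le> s"
  have "ln (1 + s\<^sup>2) \<le> ln ((1 + s)\<^sup>2)"
    using s by (subst ln_le_cancel_iff) (auto simp: power2_eq_square algebra_simps add_pos_nonneg)
  also have "\<dots> = 2 * ln (1 + s)" using s by (simp add: ln_realpow)
  also have "ln (1 + s) \<le> s" using s by (rule ln_add_one_self_le_self)
  finally show ?thesis by simp
qed

text \<open>
  The inequality \<open>ln (1 + 1/|b|) \<le> 2 / \<surd>|b|\<close> trades the logarithmic singularity for a square root, whose
  mean over a circle is easy to bound; for large \<open>|b|\<close> it still provides decay.
\<close>

lemma ln_norm_diff_le:
  assumes "a \<noteq> 0" "b \<noteq> 0" "norm a \<le> norm b + 1"
  shows "ln (norm a) - ln (norm b) \<le> 2 / sqrt (norm b)"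
proof -
  have "ln (norm a) - ln (norm b) = ln (norm a / norm b)" using assms by (simp add: ln_div)
  also have "\<dots> \<le> ln (1 + (1 / sqrt (norm b))\<^sup>2)"
  proof (subst ln_le_cancel_iff)
    have "norm a / norm b \<le> (norm b + 1) / norm b" using assms by (intro divide_right_mono) auto
    also have "\<dots> = 1 + (1 / sqrt (norm b))\<^sup>2" using assms by (simp add: field_simps)
    finally show "norm a / norm b \<le> 1 + (1 / sqrt (norm b))\<^sup>2" .
  qed (use assms in \<open>auto intro!: add_pos_nonneg\<close>)
  also have "\<dots> \<le> 2 * (1 / sqrt (norm b))" by (rule ln_one_plus_square_le) simp
  finally show ?thesis by simp
qed

lemma abs_ln_norm_one_minus:
  assumes "norm (x::complex) \<le> 1 / 2"
  shows "\<bar>ln (norm (1 - x))\<bar> \<le> 2 * norm x"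
proof -
  define u where "u = norm (1 - x)"
  have u: "1 - norm x \<le> u" "u \<le> 1 + norm x"
    unfolding u_def using norm_triangle_ineq2[of 1 x] norm_triangle_ineq4[of 1 x] by auto
  have u2: "1/2 \<le> u" using u(1) assms by linarith
  have "ln u \<le> u - 1" using u2 by (intro ln_le_minus_one) auto
  moreover have "- ln u \<le> 2 * norm x"
  proof -
    have "- ln u = ln (1 / u)" using u2 by (simp add: ln_div)
    also have "\<dots> \<le> 1 / u - 1" using u2 by (intro ln_le_minus_one) auto
    also have "\<dots> = (1 - u) / u" using u2 by (simp add: diff_divide_distrib)
    also have "\<dots> \<le> norm x / (1/2)"
      using u u2 assms by (intro frac_le) auto
    finally show ?thesis by simp
  qed
  ultimately show ?thesis using u(2) norm_ge_zero[of x] unfolding u_def by linarith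
qed

lemma poisson_kernel_minus_one_le:
  assumes "norm w = \<alpha>" "norm \<xi> = 1" "1 < \<alpha>"
  shows "\<bar>poisson_kernel \<xi> w - 1\<bar> \<le> 2 / (\<alpha> - 1)"
proof -
  have ne: "w \<noteq> \<xi>" using assms by auto
  have "poisson_kernel \<xi> w - 1 = Re ((w + \<xi>) / (w - \<xi>) - 1)"
    using poisson_kernel_Re[OF ne] by simp
  also have "(w + \<xi>) / (w - \<xi>) - 1 = 2 * \<xi> / (w - \<xi>)"
    using ne by (simp add: field_simps)
  finally have "\<bar>poisson_kernel \<xi> w - 1\<bar> \<le> norm (2 * \<xi> / (w - \<xi>))"
    by (simp only: abs_Re_le_cmod)
  also have "\<dots> = 2 / norm (w - \<xi>)" using assms by (simp add: norm_divide norm_mult)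
  also have "\<dots> \<le> 2 / (\<alpha> - 1)"
    using assms norm_triangle_ineq2[of w \<xi>] by (intro divide_left_mono) (auto intro!: mult_pos_pos)
  finally show ?thesis .
qed

text \<open>
  The Poisson-Jensen formula in the disc of radius \<open>\<alpha>\<close> around \<open>z\<close>, evaluated at \<open>z + 1\<close> and at \<open>z\<close> and
  subtracted. The integrals differ by \<open>O(1/\<alpha>)\<close> in their kernels. A point \<open>b\<close> outside the disc drops
  out, and a point inside leaves \<open>ln |1 - 1/(b - z)|\<close> up to an error of \<open>2/\<alpha>\<close>.
\<close>

lemma log_difference_pointwise:
  assumes g: "nonzero_meromorphic g" and \<alpha>: "2 \<le> \<alpha>" and l: "norm l = 1"
    and z: "z \<notin> singular_set g" "z + 1 \<notin> singular_set g"
    and circ: "\<And>b. b \<in> singular_set g \<Longrightarrow> norm (b - z) \<noteq> \<alpha>"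
  shows "\<bar>ln (norm (g (z + 1))) - ln (norm (g z))\<bar> \<le>
     1 / (pi * (\<alpha> - 1)) * integral {0..2*pi} (\<lambda>t. \<bar>ln (norm (g (z + l * (of_real \<alpha> * cis t))))\<bar>)
     + (\<Sum>b | b \<in> singular_set g \<and> norm b \<le> norm z + \<alpha>. \<bar>of_int (zorder g b)\<bar> *
          (4 * sqrt_kernel \<alpha> (norm (b - z)) + 2 * sqrt_kernel (\<alpha> + 1) (norm (b - 1 - z))))"
proof -
  define \<rho> where "\<rho> = norm z + \<alpha> + 1"
  obtain h where h: "h holomorphic_on ball 0 \<rho>"
    "\<And>w. norm w < \<rho> \<Longrightarrow> w \<notin> singular_set g \<Longrightarrow>
       ln (norm (g w)) = Re (h w) + (\<Sum>b | b \<in> singular_set g \<and> norm b \<le> \<rho>. of_int (zorder g b) * ln (norm (w - b)))"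
    by (rule log_norm_factorization[OF g, of \<rho>]) blast
  define B where "B = {b \<in> singular_set g. norm b \<le> \<rho>}"
  define B' where "B' = {b \<in> singular_set g. norm b \<le> norm z + \<alpha>}"
  have fin: "finite B" "finite B'" unfolding B_def B'_def by (rule finite_singular_set[OF g])+
  have BB': "B' \<subseteq> B" by (auto simp: B_def B'_def \<rho>_def)
  define m where "m b = real_of_int (zorder g b)" for b
  define U where "U w = ln (norm (g w))" for w
  define p where "p t = z + l * (of_real \<alpha> * cis t)" for t
  define w where "w t = of_real \<alpha> * cis t" for t
  \<comment> \<open>In the rotated coordinate the point \<open>z + 1\<close> is \<open>\<xi>\<close>.\<close>
  define \<xi> where "\<xi> = 1 / l"
  have l0: "l \<noteq> 0" using l by auto
  have xi: "norm \<xi> = 1" "l * \<xi> = 1" using l l0 by (simp_all add: \<xi>_def norm_divide)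
  have near_z: "norm w < \<rho>" if "norm (w - z) \<le> \<alpha>" for w
    using that norm_triangle_ineq[of z "w - z"] by (simp add: \<rho>_def)
  have hU: "U w = Re (h w) + (\<Sum>b\<in>B. m b * ln (norm (w - b)))" if "norm (w - z) \<le> \<alpha>" "w \<notin> singular_set g" for w
    using h(2)[OF near_z[OF that(1)] that(2)] by (simp add: U_def m_def B_def)
  have pz: "norm (p t - z) = \<alpha>" for t using l \<alpha> by (simp add: p_def norm_mult)
  have pS: "p t \<notin> singular_set g" for t using circ[of "p t"] pz[of t] by auto
  have PJ: "((\<lambda>t. U (p t) * poisson_kernel x (w t)) has_integral 2 * pi * (Re (h (z + l * x)) +
        (\<Sum>b\<in>B. m b * (if norm (b - z) < \<alpha> then ln (norm (of_real \<alpha> - cnj ((b - z) / l) * x / of_real \<alpha>))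
                       else ln (norm (z + l * x - b)))))) {0..2*pi}" if "norm x < \<alpha>" for x
  proof -
    have "((\<lambda>t. (Re (h (z + l * (of_real \<alpha> * cis t))) +
                (\<Sum>b\<in>B. m b * ln (norm (z + l * (of_real \<alpha> * cis t) - b)))) * poisson_kernel x (of_real \<alpha> * cis t))
      has_integral 2 * pi * (Re (h (z + l * x)) +
        (\<Sum>b\<in>B. m b * (if norm (b - z) < \<alpha> then ln (norm (of_real \<alpha> - cnj ((b - z) / l) * x / of_real \<alpha>))
                       else ln (norm (z + l * x - b)))))) {0..2*pi}"
      by (rule poisson_jensen[OF h(1) fin(1) l _ _ that]) (use \<alpha> circ in \<open>auto simp: \<rho>_def B_def\<close>)
    moreover have "Re (h (z + l * (of_real \<alpha> * cis t))) + (\<Sum>b\<in>B. m b * ln (norm (z + l * (of_real \<alpha> * cis t) - b))) = U (p t)" for t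
      using hU[of "p t"] pz[of t] pS[of t] by (simp add: p_def)
    ultimately show ?thesis by (simp add: w_def)
  qed
  define t1 where "t1 b = (if norm (b - z) < \<alpha> then ln (norm (of_real \<alpha> - cnj ((b - z) / l) * \<xi> / of_real \<alpha>)) else ln (norm (z + 1 - b)))" for b
  define t0 where "t0 b = (if norm (b - z) < \<alpha> then ln \<alpha> else ln (norm (z - b)))" for b
  have v1: "((\<lambda>t. U (p t) * poisson_kernel \<xi> (w t)) has_integral 2 * pi * (Re (h (z + 1)) + (\<Sum>b\<in>B. m b * t1 b))) {0..2*pi}"
    using PJ[of \<xi>] xi \<alpha> by (simp add: t1_def cong: if_cong)
  have w0: "w t \<noteq> 0" for t using \<alpha> by (simp add: w_def)
  have v0: "((\<lambda>t. U (p t)) has_integral 2 * pi * (Re (h z) + (\<Sum>b\<in>B. m b * t0 b))) {0..2*pi}"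
    using PJ[of 0] \<alpha> by (simp add: t0_def poisson_kernel_0[OF w0] cong: if_cong)
  define I where "I = integral {0..2*pi} (\<lambda>t. U (p t) * (poisson_kernel \<xi> (w t) - 1))"
  have vI: "((\<lambda>t. U (p t) * (poisson_kernel \<xi> (w t) - 1)) has_integral
     2 * pi * (Re (h (z + 1)) + (\<Sum>b\<in>B. m b * t1 b)) - 2 * pi * (Re (h z) + (\<Sum>b\<in>B. m b * t0 b))) {0..2*pi}"
    using has_integral_diff[OF v1 v0] by (simp add: algebra_simps)
  have I: "I / (2*pi) = (Re (h (z + 1)) + (\<Sum>b\<in>B. m b * t1 b)) - (Re (h z) + (\<Sum>b\<in>B. m b * t0 b))"
    unfolding I_def integral_unique[OF vI] by (simp add: diff_divide_distrib)
  define e where "e b = (ln (norm (z + 1 - b)) - t1 b) - (ln (norm (z - b)) - t0 b)" for b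
  have "U (z + 1) - U z = I / (2*pi) + (\<Sum>b\<in>B. m b * e b)"
    using hU[of "z + 1"] hU[of z] z \<alpha> unfolding I e_def
    by (simp add: right_diff_distrib sum_subtractf)
  also have "(\<Sum>b\<in>B. m b * e b) = (\<Sum>b\<in>B'. m b * e b)"
  proof (rule sum.mono_neutral_right[OF fin(1) BB'])
    show "\<forall>b\<in>B - B'. m b * e b = 0"
    proof
      fix b assume "b \<in> B - B'"
      then have "norm z + \<alpha> < norm b" by (auto simp: B_def B'_def)
      then have "\<not> norm (b - z) < \<alpha>" using norm_triangle_ineq[of z "b - z"] by auto
      then show "m b * e b = 0" by (simp add: e_def t1_def t0_def)
    qed
  qed
  finally have "\<bar>U (z + 1) - U z\<bar> \<le> \<bar>I / (2*pi)\<bar> + (\<Sum>b\<in>B'. \<bar>m b * e b\<bar>)"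
    using sum_abs[of "\<lambda>b. m b * e b" B'] by linarith
  also have "\<bar>I / (2*pi)\<bar> \<le> 1 / (pi * (\<alpha> - 1)) * integral {0..2*pi} (\<lambda>t. \<bar>U (p t)\<bar>)"
  proof -
    have cU: "continuous_on {0..2*pi} (\<lambda>t. U (p t))"
    proof -
      have "continuous_on (- singular_set g) g" by (rule continuous_on_outside_singular_set) auto
      then have "continuous_on {0..2*pi} (\<lambda>t. g (p t))"
        by (rule continuous_on_compose2) (use pS in \<open>auto simp: p_def intro!: continuous_intros\<close>)
      moreover have "g (p t) \<noteq> 0" for t using pS[of t] by (simp add: singular_set_def)
      ultimately show ?thesis unfolding U_def by (intro continuous_intros) auto
    qed
    have "norm I \<le> integral {0..2*pi} (\<lambda>t. 2 / (\<alpha> - 1) * \<bar>U (p t)\<bar>)"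
      unfolding I_def
    proof (rule integral_norm_bound_integral)
      show "(\<lambda>t. U (p t) * (poisson_kernel \<xi> (w t) - 1)) integrable_on {0..2*pi}" using vI by blast
      show "(\<lambda>t. 2 / (\<alpha> - 1) * \<bar>U (p t)\<bar>) integrable_on {0..2*pi}"
        by (intro integrable_continuous_real continuous_intros cU)
      fix t
      have "\<bar>poisson_kernel \<xi> (w t) - 1\<bar> \<le> 2 / (\<alpha> - 1)"
        by (rule poisson_kernel_minus_one_le) (use xi \<alpha> in \<open>auto simp: w_def\<close>)
      then have "\<bar>U (p t)\<bar> * \<bar>poisson_kernel \<xi> (w t) - 1\<bar> \<le> \<bar>U (p t)\<bar> * (2 / (\<alpha> - 1))"
        by (rule mult_left_mono) simp
      then show "norm (U (p t) * (poisson_kernel \<xi> (w t) - 1)) \<le> 2 / (\<alpha> - 1) * \<bar>U (p t)\<bar>"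
        by (simp add: abs_mult mult.commute)
    qed
    also have "\<dots> = 2 / (\<alpha> - 1) * integral {0..2*pi} (\<lambda>t. \<bar>U (p t)\<bar>)" by simp
    finally have "\<bar>I\<bar> / (2 * pi) \<le> 2 / (\<alpha> - 1) * integral {0..2*pi} (\<lambda>t. \<bar>U (p t)\<bar>) / (2*pi)"
      by (intro divide_right_mono) auto
    then show ?thesis by (simp add: mult.commute)
  qed
  also have "(\<Sum>b\<in>B'. \<bar>m b * e b\<bar>) \<le> (\<Sum>b\<in>B'. \<bar>m b\<bar> * (4 * sqrt_kernel \<alpha> (norm (b - z)) + 2 * sqrt_kernel (\<alpha> + 1) (norm (b - 1 - z))))"
  proof (rule sum_mono)
    fix b assume "b \<in> B'"
    then have bS: "b \<in> singular_set g" by (auto simp: B'_def)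
    have "\<bar>e b\<bar> \<le> 4 * sqrt_kernel \<alpha> (norm (b - z)) + 2 * sqrt_kernel (\<alpha> + 1) (norm (b - 1 - z))"
    proof (cases "norm (b - z) < \<alpha>")
      case False
      then have "e b = 0" by (simp add: e_def t1_def t0_def)
      then show ?thesis by (simp add: sqrt_kernel_nonneg)
    next
      case True
      define y where "y = b - z"
      have ny: "norm y < \<alpha>" "y \<noteq> 0" "1 - y \<noteq> 0"
        using True bS z by (auto simp: y_def algebra_simps)
      have n1: "norm (z + 1 - b) = norm (1 - y)" "norm (z - b) = norm y" "norm (b - 1 - z) = norm (1 - y)"
        by (simp_all add: y_def norm_minus_commute algebra_simps)
      have 1: "\<bar>ln (norm (1 - y)) - ln (norm y)\<bar> \<le> 2 / sqrt (norm y) + 2 / sqrt (norm (1 - y))"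
      proof -
        have "ln (norm (1 - y)) - ln (norm y) \<le> 2 / sqrt (norm y)"
          by (rule ln_norm_diff_le) (use ny norm_triangle_ineq4[of 1 y] in auto)
        moreover have "ln (norm y) - ln (norm (1 - y)) \<le> 2 / sqrt (norm (1 - y))"
          by (rule ln_norm_diff_le) (use ny norm_triangle_ineq4[of 1 "1 - y"] in auto)
        moreover have "0 \<le> 2 / sqrt (norm y)" "0 \<le> 2 / sqrt (norm (1 - y))" by auto
        ultimately show ?thesis by linarith
      qed
      \<comment> \<open>The mirror-image term, which is small because \<open>|y| < \<alpha>\<close>.\<close>
      define x where "x = cnj (y / l) * \<xi> / of_real (\<alpha>\<^sup>2)"
      have nx: "norm x \<le> 1 / \<alpha>"
      proof -
        have "norm x = norm y / \<alpha>\<^sup>2" using l xi by (simp add: x_def norm_mult norm_divide norm_power)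
        also have "\<dots> \<le> \<alpha> / \<alpha>\<^sup>2" using ny \<alpha> by (intro divide_right_mono) auto
        finally show ?thesis using \<alpha> by (simp add: power2_eq_square)
      qed
      have xhalf: "norm x \<le> 1 / 2" using nx \<alpha> order_trans[OF nx, of "1/2"] by (simp add: field_simps)
      have "t1 b - t0 b = ln (norm (1 - x))"
      proof -
        have "of_real \<alpha> - cnj ((b - z) / l) * \<xi> / of_real \<alpha> = of_real \<alpha> * (1 - x)"
          using \<alpha> by (simp add: x_def y_def right_diff_distrib power2_eq_square)
        then have "t1 b = ln (\<alpha> * norm (1 - x))"
          using True \<alpha> by (simp add: t1_def norm_mult)
        moreover have "1 - x \<noteq> 0" using xhalf by auto
        ultimately show ?thesis using True \<alpha> by (simp add: t0_def ln_mult)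
      qed
      then have "\<bar>t1 b - t0 b\<bar> \<le> 2 * norm x" using abs_ln_norm_one_minus[OF xhalf] by simp
      also have "\<dots> \<le> 2 / sqrt (norm y)"
      proof -
        have "sqrt (norm y) \<le> sqrt (\<alpha>\<^sup>2)"
          using ny \<alpha> self_le_power[of \<alpha> 2] by (intro real_sqrt_le_mono) auto
        then have "sqrt (norm y) \<le> \<alpha>" using \<alpha> by simp
        then have "1 / \<alpha> \<le> 1 / sqrt (norm y)" using ny \<alpha> by (intro divide_left_mono) auto
        then show ?thesis using nx by simp
      qed
      finally have 2: "\<bar>t1 b - t0 b\<bar> \<le> 2 / sqrt (norm y)" .
      have "\<bar>e b\<bar> \<le> 4 / sqrt (norm y) + 2 / sqrt (norm (1 - y))"
      proof -
        have "e b = (ln (norm (1 - y)) - ln (norm y)) - (t1 b - t0 b)" unfolding e_def n1 by simp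
        then show ?thesis using 1 2 by (simp add: abs_if split: if_splits)
      qed
      moreover have "norm (1 - y) < \<alpha> + 1" using ny norm_triangle_ineq4[of 1 y] by simp
      ultimately show ?thesis using ny unfolding n1 y_def[symmetric] by (simp add: sqrt_kernel_def)
    qed
    then show "\<bar>m b * e b\<bar> \<le> \<bar>m b\<bar> * (4 * sqrt_kernel \<alpha> (norm (b - z)) + 2 * sqrt_kernel (\<alpha> + 1) (norm (b - 1 - z)))"
      by (simp add: abs_mult mult_left_mono)
  qed
  finally show ?thesis by (simp add: U_def p_def m_def B'_def)
qed

lemma ennreal_plus_le:
  assumes "0 \<le> b" shows "ennreal (a + b) \<le> ennreal a + ennreal b"
proof (cases "0 \<le> a")
  case True
  then show ?thesis using assms by (simp add: ennreal_plus)
next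
  case False
  then have "ennreal (a + b) \<le> ennreal b" by (intro ennreal_leI) auto
  then show ?thesis by (simp add: add_increasing)
qed

lemma borel_measurable_cis [measurable]: "cis \<in> borel_measurable borel"
  by (intro borel_measurable_continuous_onI continuous_intros)

lemma mean_abs_log:
  assumes "generic_radius g \<rho>"
  shows "integral {0..2*pi} (\<lambda>t. \<bar>ln (norm (g (of_real \<rho> * cis t)))\<bar>)
    = 2 * pi * (proximity \<rho> g + proximity \<rho> (\<lambda>z. inverse (g z)))"
proof -
  have "(\<lambda>t. log_plus (norm (g (of_real \<rho> * cis t)))) integrable_on {0..2*pi}"
    "(\<lambda>t. log_plus (norm (inverse (g (of_real \<rho> * cis t))))) integrable_on {0..2*pi}"
    by (intro integrable_on_circle[OF assms] continuous_intros; auto)+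
  then have "integral {0..2*pi} (\<lambda>t. log_plus (norm (g (of_real \<rho> * cis t))))
     + integral {0..2*pi} (\<lambda>t. log_plus (norm (inverse (g (of_real \<rho> * cis t)))))
     = integral {0..2*pi} (\<lambda>t. log_plus (norm (g (of_real \<rho> * cis t))) + log_plus (norm (inverse (g (of_real \<rho> * cis t)))))"
    by (rule integral_add[symmetric])
  also have "\<dots> = integral {0..2*pi} (\<lambda>t. \<bar>ln (norm (g (of_real \<rho> * cis t)))\<bar>)"
    by (intro integral_cong)
       (use continuous_on_circle(2)[OF assms] in \<open>simp add: norm_inverse abs_ln_eq_log_plus\<close>)
  finally show ?thesis by (simp add: proximity_def add_divide_distrib[symmetric])
qed

text \<open>
  The pointwise bound is integrated over the circle \<open>|z| = r\<close>. The order of the two angular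
  integrations is interchanged by Tonelli's theorem; for a fixed position \<open>t\<close> on the small circle, the
  point \<open>cis s \<cdot> (r + \<alpha> \<cdot> cis t)\<close> runs through a circle about the origin, of a radius between \<open>r - \<alpha>\<close> and
  \<open>r + \<alpha>\<close>.
\<close>

lemma mean_log_difference:
  assumes g: "nonzero_meromorphic g" and \<alpha>: "2 \<le> \<alpha>" "\<alpha> < r" and r: "generic_radius g r"
    and r1: "\<And>b. b \<in> singular_set g \<Longrightarrow> norm (b - 1) \<noteq> r"
    and K: "\<And>\<rho>. generic_radius g \<rho> \<Longrightarrow> r - \<alpha> \<le> \<rho> \<Longrightarrow> \<rho> \<le> r + \<alpha> \<Longrightarrow>
              proximity \<rho> g + proximity \<rho> (\<lambda>z. inverse (g z)) \<le> K" and K0: "0 \<le> K"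
  shows "circle_mean (\<lambda>z. \<bar>ln (norm (g (z + 1))) - ln (norm (g z))\<bar>) r
     \<le> 2 * K / (\<alpha> - 1) + 90 * sqrt (\<alpha> + 1) / r * (\<Sum>b | b \<in> singular_set g \<and> norm b \<le> r + \<alpha>. \<bar>of_int (zorder g b)\<bar>)"
proof -
  have r0: "0 < r" "0 < \<alpha>" using \<alpha> by auto
  define S where "S = singular_set g"
  define B where "B = {b \<in> S. norm b \<le> r + \<alpha>}"
  have fin: "finite B" unfolding B_def S_def by (rule finite_singular_set[OF g])
  have cS: "countable S" unfolding S_def by (rule countable_singular_set[OF g])
  define m where "m b = \<bar>real_of_int (zorder g b)\<bar>" for b
  define u where "u s = \<bar>ln (norm (g (of_real r * cis s + 1))) - ln (norm (g (of_real r * cis s)))\<bar>" for s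
  define Q where "Q s t = \<bar>ln (norm (g (cis s * (of_real r + of_real \<alpha> * cis t))))\<bar>" for s t
  define k where "k b s = 4 * sqrt_kernel \<alpha> (norm (b - of_real r * cis s)) + 2 * sqrt_kernel (\<alpha> + 1) (norm (b - 1 - of_real r * cis s))" for b s
  define c1 where "c1 = 1 / (pi * (\<alpha> - 1))"
  have c1: "0 \<le> c1" using \<alpha> by (simp add: c1_def)
  have [measurable]: "g \<in> borel_measurable borel" by (rule borel_measurable_nonzero_meromorphic[OF g])
  have nsing: "of_real r * cis s \<notin> S" "of_real r * cis s + 1 \<notin> S" for s
    using r r0 norm_circle[of r s] r1[of "of_real r * cis s + 1"] by (auto simp: generic_radius_def S_def)
  have gnz: "g w \<noteq> 0" if "w \<notin> S" for w using that by (simp add: S_def singular_set_def)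
  have contg: "continuous_on (- S) g" unfolding S_def by (rule continuous_on_outside_singular_set) auto
  have cu: "continuous_on {0..2*pi} u"
  proof -
    have "continuous_on {0..2*pi} (\<lambda>s. g (of_real r * cis s + 1))" "continuous_on {0..2*pi} (\<lambda>s. g (of_real r * cis s))"
      by (rule continuous_on_compose2[OF contg]; use nsing in \<open>auto intro!: continuous_intros\<close>)+
    then show ?thesis unfolding u_def
      by (intro continuous_intros) (use gnz nsing in auto)
  qed
  \<comment> \<open>Angles \<open>s\<close> for which the small circle about \<open>r \<cdot> cis s\<close> hits a zero or a pole.\<close>
  define bad where "bad = (\<Union>b\<in>S. {s. norm (b + (- of_real r) * cis s) = \<alpha>})"
  have "countable {s. norm (b + (- of_real r) * cis s) = \<alpha>}" for b
  proof (cases "b = 0")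
    case True
    then have "{s. norm (b + (- of_real r) * cis s) = \<alpha>} = {}" using \<alpha> by (auto simp: norm_mult)
    then show ?thesis by simp
  next
    case False
    then show ?thesis using r0 by (intro countable_circle_level) auto
  qed
  then have "countable bad" unfolding bad_def using cS by (intro countable_UN) auto
  then have AE1: "AE s in lborel. s \<notin> bad"
    by (intro AE_not_in countable_imp_null_set_lborel)
  have QM: "(\<lambda>(s,t). ennreal (Q s t) * indicator {0..2*pi} t * indicator {0..2*pi} s) \<in> borel_measurable (lborel \<Otimes>\<^sub>M lborel)"
    unfolding Q_def by measurable
  have QM1: "(\<lambda>s. \<integral>\<^sup>+t. ennreal (Q s t) * indicator {0..2*pi} t \<partial>lborel) \<in> borel_measurable lborel"
    unfolding Q_def by measurable
  have kM: "(\<lambda>s. ennreal (k b s)) \<in> borel_measurable lborel" for b unfolding k_def by measurable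
  have pw: "ennreal (u s) * indicator {0..2*pi} s \<le>
     ennreal c1 * (\<integral>\<^sup>+t. ennreal (Q s t) * indicator {0..2*pi} t * indicator {0..2*pi} s \<partial>lborel)
      + (\<Sum>b\<in>B. ennreal (m b) * (ennreal (k b s) * indicator {0..2*pi} s))" if s: "s \<notin> bad" for s
  proof (cases "s \<in> {0..2*pi}")
    case True
    have circ: "norm (b - of_real r * cis s) \<noteq> \<alpha>" if "b \<in> S" for b
      using s that by (auto simp: bad_def)
    have Qeq: "\<bar>ln (norm (g (of_real r * cis s + cis s * (of_real \<alpha> * cis t))))\<bar> = Q s t" for t
      by (simp add: Q_def distrib_left mult.commute mult.left_commute)
    have "u s \<le> c1 * integral {0..2*pi} (Q s) + (\<Sum>b\<in>B. m b * k b s)"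
      using log_difference_pointwise[OF g \<alpha>(1), of "cis s" "of_real r * cis s"] nsing[of s] circ r0
      by (simp add: u_def c1_def B_def m_def k_def S_def Qeq)
    then have "ennreal (u s) \<le> ennreal (c1 * integral {0..2*pi} (Q s) + (\<Sum>b\<in>B. m b * k b s))"
      by (rule ennreal_leI)
    also have "\<dots> \<le> ennreal (c1 * integral {0..2*pi} (Q s)) + ennreal (\<Sum>b\<in>B. m b * k b s)"
      by (intro ennreal_plus_le sum_nonneg) (auto simp: m_def k_def sqrt_kernel_nonneg)
    also have "ennreal (\<Sum>b\<in>B. m b * k b s) = (\<Sum>b\<in>B. ennreal (m b) * ennreal (k b s))"
      by (subst sum_ennreal[symmetric]) (auto simp: m_def k_def sqrt_kernel_nonneg ennreal_mult)
    also have "ennreal (c1 * integral {0..2*pi} (Q s)) = ennreal c1 * ennreal (integral {0..2*pi} (Q s))"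
      by (rule ennreal_mult') (rule c1)
    also have "ennreal (integral {0..2*pi} (Q s)) = (\<integral>\<^sup>+t. ennreal (Q s t) * indicator {0..2*pi} t \<partial>lborel)"
    proof (rule nn_integral_continuous_interval[symmetric])
      have ns: "cis s * (of_real r + of_real \<alpha> * cis t) \<notin> S" for t
      proof
        assume a: "cis s * (of_real r + of_real \<alpha> * cis t) \<in> S"
        have "cis s * (of_real r + of_real \<alpha> * cis t) - of_real r * cis s = cis s * (of_real \<alpha> * cis t)"
          by (simp add: algebra_simps)
        then show False using circ[OF a] r0 by (simp add: norm_mult)
      qed
      have "continuous_on {0..2*pi} (\<lambda>t. g (cis s * (of_real r + of_real \<alpha> * cis t)))"
        by (rule continuous_on_compose2[OF contg]) (use ns in \<open>auto intro!: continuous_intros\<close>)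
      then show "continuous_on {0..2*pi} (Q s)"
        unfolding Q_def by (intro continuous_intros) (use gnz ns in auto)
    qed (simp add: Q_def)
    finally show ?thesis using True by simp
  qed simp
  have inner: "(\<integral>\<^sup>+s. ennreal (Q s t) * indicator {0..2*pi} s \<partial>lborel) \<le> ennreal (2 * pi * K)"
    if t: "\<And>b. b \<in> S \<Longrightarrow> norm (of_real r + of_real \<alpha> * cis t) \<noteq> norm b" for t
  proof -
    define w where "w = of_real r + of_real \<alpha> * cis t"
    define \<rho> where "\<rho> = norm w"
    have \<rho>: "r - \<alpha> \<le> \<rho>" "\<rho> \<le> r + \<alpha>"
      using norm_triangle_ineq[of "of_real r" "of_real \<alpha> * cis t"] norm_triangle_ineq2[of "of_real r" "- (of_real \<alpha> * cis t)"] r0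
      by (auto simp: \<rho>_def w_def norm_mult)
    then have gen: "generic_radius g \<rho>"
      using t \<alpha> unfolding generic_radius_def S_def \<rho>_def w_def by force
    have c: "continuous_on A (\<lambda>s. \<bar>ln (norm (g (of_real \<rho> * cis s)))\<bar>)" for A
      by (intro continuous_intros continuous_on_circle[OF gen]) (use continuous_on_circle(2)[OF gen] in auto)
    have cw: "continuous_on {0..2*pi} (\<lambda>s. Q s t)"
    proof -
      have "continuous_on {0..2*pi} (\<lambda>s. g (cis s * w))"
        by (rule continuous_on_compose2[OF contg])
           (use t in \<open>auto intro!: continuous_intros simp: w_def[symmetric] norm_mult dest!: t\<close>)
      moreover have "g (cis s * w) \<noteq> 0" for s
        using t[of "cis s * w"] by (intro gnz) (auto simp: w_def norm_mult)
      ultimately show ?thesis unfolding Q_def w_def[symmetric] by (intro continuous_intros) auto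
    qed
    have "(\<integral>\<^sup>+s. ennreal (Q s t) * indicator {0..2*pi} s \<partial>lborel) = ennreal (integral {0..2*pi} (\<lambda>s. Q s t))"
      by (rule nn_integral_continuous_interval[OF cw]) (simp add: Q_def)
    also have "integral {0..2*pi} (\<lambda>s. Q s t) = integral {0..2*pi} (\<lambda>s. \<bar>ln (norm (g (of_real \<rho> * cis s)))\<bar>)"
      using integral_circle_rotate[OF c, of w] by (simp add: Q_def w_def[symmetric] \<rho>_def)
    also have "\<dots> = 2 * pi * (proximity \<rho> g + proximity \<rho> (\<lambda>z. inverse (g z)))" by (rule mean_abs_log[OF gen])
    also have "\<dots> \<le> 2 * pi * K" by (intro mult_left_mono K gen \<rho>) auto
    finally show ?thesis by (simp add: ennreal_leI)
  qed
  have AE2: "AE t in lborel. \<forall>b\<in>S. norm (of_real r + of_real \<alpha> * cis t) \<noteq> norm b"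
  proof -
    have "countable (\<Union>b\<in>S. {t. norm (of_real r + of_real \<alpha> * cis t) = norm b})"
      using cS r0 by (intro countable_UN countable_circle_level) auto
    then have "AE t in lborel. t \<notin> (\<Union>b\<in>S. {t. norm (of_real r + of_real \<alpha> * cis t) = norm b})"
      by (intro AE_not_in countable_imp_null_set_lborel)
    then show ?thesis by (rule eventually_mono) auto
  qed
  have kint: "(\<integral>\<^sup>+s. ennreal (k b s) * indicator {0..2*pi} s \<partial>lborel) \<le> ennreal (360 * sqrt (\<alpha> + 1) / r)" for b
  proof -
    have [measurable]: "(\<lambda>s. ennreal (sqrt_kernel \<beta> (norm (b' - of_real r * cis s))) * indicator {0..2*pi} s) \<in> borel_measurable lborel" for \<beta> b'
      by measurable
    have "(\<integral>\<^sup>+s. ennreal (k b s) * indicator {0..2*pi} s \<partial>lborel)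
      = (\<integral>\<^sup>+s. 4 * (ennreal (sqrt_kernel \<alpha> (norm (b - of_real r * cis s))) * indicator {0..2*pi} s)
            + 2 * (ennreal (sqrt_kernel (\<alpha> + 1) (norm (b - 1 - of_real r * cis s))) * indicator {0..2*pi} s) \<partial>lborel)"
      by (intro nn_integral_cong)
         (auto simp: k_def indicator_def ennreal_plus ennreal_mult' sqrt_kernel_nonneg)
    also have "\<dots> = 4 * (\<integral>\<^sup>+s. ennreal (sqrt_kernel \<alpha> (norm (b - of_real r * cis s))) * indicator {0..2*pi} s \<partial>lborel)
      + 2 * (\<integral>\<^sup>+s. ennreal (sqrt_kernel (\<alpha> + 1) (norm (b - 1 - of_real r * cis s))) * indicator {0..2*pi} s \<partial>lborel)"
      by (subst nn_integral_add) (auto simp: nn_integral_cmult)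
    also have "\<dots> \<le> 4 * ennreal (60 * sqrt \<alpha> / r) + 2 * ennreal (60 * sqrt (\<alpha> + 1) / r)"
      by (intro add_mono mult_left_mono mean_sqrt_kernel_circle) (use r0 in auto)
    also have "\<dots> = ennreal (4 * (60 * sqrt \<alpha> / r) + 2 * (60 * sqrt (\<alpha> + 1) / r))"
    proof -
      have e: "ennreal (4 * x) = 4 * ennreal x" "ennreal (2 * x) = 2 * ennreal x" for x
        by (simp_all add: ennreal_mult')
      have "0 \<le> 4 * (60 * sqrt \<alpha> / r)" "0 \<le> 2 * (60 * sqrt (\<alpha> + 1) / r)" using r0 by auto
      then show ?thesis by (simp only: ennreal_plus e)
    qed
    also have "\<dots> \<le> ennreal (360 * sqrt (\<alpha> + 1) / r)"
    proof (rule ennreal_leI)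
      have "sqrt \<alpha> / r \<le> sqrt (\<alpha> + 1) / r" using r0 by (intro divide_right_mono) auto
      then show "4 * (60 * sqrt \<alpha> / r) + 2 * (60 * sqrt (\<alpha> + 1) / r) \<le> 360 * sqrt (\<alpha> + 1) / r" by simp
    qed
    finally show ?thesis .
  qed
  define n where "n = (\<Sum>b\<in>B. m b)"
  have n0: "0 \<le> n" by (auto simp: n_def m_def intro!: sum_nonneg)
  have "ennreal (integral {0..2*pi} u) = (\<integral>\<^sup>+s. ennreal (u s) * indicator {0..2*pi} s \<partial>lborel)"
    by (rule nn_integral_continuous_interval[symmetric, OF cu]) (simp add: u_def)
  also have "\<dots> \<le> (\<integral>\<^sup>+s. ennreal c1 * (\<integral>\<^sup>+t. ennreal (Q s t) * indicator {0..2*pi} t * indicator {0..2*pi} s \<partial>lborel)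
      + (\<Sum>b\<in>B. ennreal (m b) * (ennreal (k b s) * indicator {0..2*pi} s)) \<partial>lborel)"
    using AE1 by (intro nn_integral_mono_AE) (auto elim!: eventually_mono intro: pw)
  also have "\<dots> = ennreal c1 * (\<integral>\<^sup>+s. (\<integral>\<^sup>+t. ennreal (Q s t) * indicator {0..2*pi} t * indicator {0..2*pi} s \<partial>lborel) \<partial>lborel)
      + (\<Sum>b\<in>B. ennreal (m b) * (\<integral>\<^sup>+s. ennreal (k b s) * indicator {0..2*pi} s \<partial>lborel))"
    using QM kM lborel.borel_measurable_nn_integral[OF QM]
    by (subst nn_integral_add) (auto simp: nn_integral_cmult nn_integral_sum intro!: borel_measurable_sum)
  also have "\<dots> \<le> ennreal c1 * ennreal (2 * pi * (2 * pi * K)) + (\<Sum>b\<in>B. ennreal (m b) * ennreal (360 * sqrt (\<alpha> + 1) / r))"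
  proof (intro add_mono mult_left_mono sum_mono kint)
    have "(\<integral>\<^sup>+s. (\<integral>\<^sup>+t. ennreal (Q s t) * indicator {0..2*pi} t * indicator {0..2*pi} s \<partial>lborel) \<partial>lborel)
      = (\<integral>\<^sup>+t. (\<integral>\<^sup>+s. ennreal (Q s t) * indicator {0..2*pi} t * indicator {0..2*pi} s \<partial>lborel) \<partial>lborel)"
      by (rule lborel_pair.Fubini'[symmetric]) (rule QM)
    also have "\<dots> \<le> (\<integral>\<^sup>+t. ennreal (2 * pi * K) * indicator {0..2*pi} t \<partial>lborel)"
    proof (intro nn_integral_mono_AE)
      show "AE t in lborel. (\<integral>\<^sup>+s. ennreal (Q s t) * indicator {0..2*pi} t * indicator {0..2*pi} s \<partial>lborel) \<le> ennreal (2 * pi * K) * indicator {0..2*pi} t"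
        using AE2
      proof eventually_elim
        case (elim t)
        then show ?case using inner[of t] by (cases "t \<in> {0..2*pi}") auto
      qed
    qed
    also have "\<dots> = ennreal (2 * pi * (2 * pi * K))"
      using K0 by (simp add: nn_integral_cmult_indicator ennreal_mult'[symmetric] mult.commute)
    finally show "(\<integral>\<^sup>+s. (\<integral>\<^sup>+t. ennreal (Q s t) * indicator {0..2*pi} t * indicator {0..2*pi} s \<partial>lborel) \<partial>lborel) \<le> ennreal (2 * pi * (2 * pi * K))" .
  qed auto
  also have "\<dots> = ennreal (c1 * (2 * pi * (2 * pi * K)) + n * (360 * sqrt (\<alpha> + 1) / r))"
  proof -
    have "(\<Sum>b\<in>B. ennreal (m b) * ennreal (360 * sqrt (\<alpha> + 1) / r)) = (\<Sum>b\<in>B. ennreal (m b * (360 * sqrt (\<alpha> + 1) / r)))"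
      using r0 by (intro sum.cong refl ennreal_mult[symmetric]) (auto simp: m_def)
    also have "\<dots> = ennreal (n * (360 * sqrt (\<alpha> + 1) / r))"
      using r0 by (subst sum_ennreal) (auto simp: m_def n_def sum_distrib_right sum_divide_distrib)
    finally show ?thesis
      using c1 K0 n0 r0 by (simp add: ennreal_mult[symmetric] ennreal_plus[symmetric] del: ennreal_plus)
  qed
  finally have "integral {0..2*pi} u \<le> c1 * (2 * pi * (2 * pi * K)) + n * (360 * sqrt (\<alpha> + 1) / r)"
    using c1 K0 n0 r0 by (subst (asm) ennreal_le_iff) (auto intro!: add_nonneg_nonneg mult_nonneg_nonneg)
  then have "integral {0..2*pi} u / (2*pi) \<le> (c1 * (2 * pi * (2 * pi * K)) + n * (360 * sqrt (\<alpha> + 1) / r)) / (2*pi)"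
    by (intro divide_right_mono) auto
  also have "\<dots> = 2 * K / (\<alpha> - 1) + 180 / pi * (sqrt (\<alpha> + 1) / r * n)"
    using \<alpha> r0 by (simp add: c1_def add_divide_distrib) (simp add: field_simps)
  \<comment> \<open>The rough bound \<open>\<pi> \<ge> 2\<close> suffices.\<close>
  also have "180 / pi * (sqrt (\<alpha> + 1) / r * n) \<le> 90 * (sqrt (\<alpha> + 1) / r * n)"
    using pi_ge_two r0 n0 by (intro mult_right_mono) (auto simp: pos_divide_le_eq)
  finally show ?thesis
    by (simp add: circle_mean_def u_def[abs_def] n_def m_def B_def S_def)
qed

text \<open>
  The factor in front of the characteristic in the estimate below. It tends to \<open>0\<close> like \<open>1 / \<surd>\<alpha>\<close>; the
  first summand comes from the Poisson kernels, the second one from the zeros and poles.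
\<close>

definition difference_factor :: "real \<Rightarrow> real" where
  "difference_factor \<alpha> = 4 / (\<alpha> - 1) + 450 * sqrt (\<alpha> + 1) / \<alpha>"

text \<open>
  This plays the role of the lemma on the logarithmic derivative. Since \<open>R - (r + \<alpha>) \<ge> \<alpha>\<close>, the disc of
  radius \<open>r + \<alpha>\<close> contains at most \<open>R/\<alpha>\<close> times the integrated count at \<open>R\<close> many zeros and poles, and
  each of them contributes \<open>O(\<surd>\<alpha> / r)\<close> to the mean.
\<close>

lemma difference_estimate:
  assumes g: "nonzero_meromorphic g" and \<alpha>: "2 \<le> \<alpha>"
  obtains C where "\<And>r R. generic_radius g r \<Longrightarrow> (\<And>b. b \<in> singular_set g \<Longrightarrow> norm (b - 1) \<noteq> r) \<Longrightarrow>
      generic_radius g R \<Longrightarrow> 2 * \<alpha> \<le> r \<Longrightarrow> r + 2 * \<alpha> \<le> R \<Longrightarrow> R \<le> r + 3 * \<alpha> \<Longrightarrow>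
      circle_mean (\<lambda>z. \<bar>ln (norm (g (z + 1))) - ln (norm (g z))\<bar>) r \<le> difference_factor \<alpha> * characteristic R g + C"
proof -
  obtain C where C: "\<And>r. generic_radius g r \<Longrightarrow>
    proximity r (\<lambda>z. inverse (g z)) = characteristic r g - integrated_count (zero_count g) r + C"
    by (rule proximity_inverse[OF g]) blast
  show ?thesis
  proof (rule that[of "difference_factor \<alpha> / 2 * \<bar>C\<bar>"])
    fix r R assume r: "generic_radius g r" and r1: "\<And>b. b \<in> singular_set g \<Longrightarrow> norm (b - 1) \<noteq> r"
      and R: "generic_radius g R" and ineq: "2 * \<alpha> \<le> r" "r + 2 * \<alpha> \<le> R" "R \<le> r + 3 * \<alpha>"
    define T where "T = characteristic R g"
    \<comment> \<open>By the first main theorem, \<open>K\<close> bounds the sum of the two proximities on the circles of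
      radius between \<open>r - \<alpha>\<close> and \<open>r + \<alpha>\<close>.\<close>
    define K where "K = 2 * T + \<bar>C\<bar>"
    have T0: "0 \<le> T" unfolding T_def by (rule characteristic_nonneg[OF g R]) (use ineq \<alpha> in auto)
    then have K0: "0 \<le> K" by (simp add: K_def)
    have K: "proximity \<rho> g + proximity \<rho> (\<lambda>z. inverse (g z)) \<le> K"
      if \<rho>: "generic_radius g \<rho>" "r - \<alpha> \<le> \<rho>" "\<rho> \<le> r + \<alpha>" for \<rho>
    proof -
      have "1 \<le> \<rho>" using \<rho> ineq \<alpha> by auto
      then have "0 \<le> integrated_count (pole_count g) \<rho>" "0 \<le> integrated_count (zero_count g) \<rho>"
        using integrated_counts_nonneg[OF g] by auto
      moreover have "characteristic \<rho> g \<le> T"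
        unfolding T_def using \<rho> ineq \<alpha> by (intro characteristic_almost_mono g R) auto
      ultimately show ?thesis using C[OF \<rho>(1)] by (simp add: K_def characteristic_def)
    qed
    define n where "n = (\<Sum>b | b \<in> singular_set g \<and> norm b \<le> r + \<alpha>. \<bar>real_of_int (zorder g b)\<bar>)"
    have "n \<le> R / (R - (r + \<alpha>)) * (integrated_count (zero_count g) R + integrated_count (pole_count g) R)"
    proof -
      have "\<bar>real_of_int (zorder g b)\<bar> = real (zero_order g b) + real (pole_order g b)" for b
        using zorder_eq_zero_order_minus_pole_order[OF g, of b] zero_order_or_pole_order_zero[of g b] by auto
      then have "n = zero_count g (r + \<alpha>) + pole_count g (r + \<alpha>)"
        by (simp add: n_def zero_count_def pole_count_step_count[OF g] step_count_def sum.distrib)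
      also have "zero_count g (r + \<alpha>) \<le> R / (R - (r + \<alpha>)) * integrated_count (zero_count g) R"
        unfolding zero_count_def
        by (rule step_count_le_integrated_count[OF finite_singular_set[OF g]]) (use ineq \<alpha> in auto)
      also have "pole_count g (r + \<alpha>) \<le> R / (R - (r + \<alpha>)) * integrated_count (pole_count g) R"
        unfolding pole_count_step_count[OF g]
        by (rule step_count_le_integrated_count[OF finite_singular_set[OF g]]) (use ineq \<alpha> in auto)
      finally show ?thesis by (simp add: distrib_left)
    qed
    also have "\<dots> \<le> (5 / 2 * r / \<alpha>) * K"
    proof (rule mult_mono)
      have "R / (R - (r + \<alpha>)) \<le> R / \<alpha>" using ineq \<alpha> by (intro divide_left_mono) auto
      also have "\<dots> \<le> (5 / 2 * r) / \<alpha>" using ineq \<alpha> by (intro divide_right_mono) auto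
      finally show "R / (R - (r + \<alpha>)) \<le> 5 / 2 * r / \<alpha>" by simp
      have "0 \<le> proximity R (\<lambda>z. inverse (g z))"
        by (rule proximity_inverse_nonneg[OF R])
      then show "integrated_count (zero_count g) R + integrated_count (pole_count g) R \<le> K"
        using C[OF R] proximity_nonneg[OF R] by (simp add: K_def T_def characteristic_def)
    qed (use ineq \<alpha> integrated_counts_nonneg[OF g, of R] in auto)
    finally have n: "n \<le> (5 / 2 * r / \<alpha>) * K" .
    have "circle_mean (\<lambda>z. \<bar>ln (norm (g (z + 1))) - ln (norm (g z))\<bar>) r
      \<le> 2 * K / (\<alpha> - 1) + 90 * sqrt (\<alpha> + 1) / r * n"
      unfolding n_def by (rule mean_log_difference[OF g \<alpha> _ r r1 K K0]) (use ineq \<alpha> in auto)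
    also have "90 * sqrt (\<alpha> + 1) / r * n \<le> 90 * sqrt (\<alpha> + 1) / r * ((5 / 2 * r / \<alpha>) * K)"
      by (rule mult_left_mono[OF n]) (use ineq \<alpha> in auto)
    also have "\<dots> = 225 * sqrt (\<alpha> + 1) / \<alpha> * K" using ineq \<alpha> by (simp add: field_simps)
    finally have "circle_mean (\<lambda>z. \<bar>ln (norm (g (z + 1))) - ln (norm (g z))\<bar>) r \<le> (2 / (\<alpha> - 1) + 225 * sqrt (\<alpha> + 1) / \<alpha>) * K"
      by (simp add: distrib_right)
    also have "2 / (\<alpha> - 1) + 225 * sqrt (\<alpha> + 1) / \<alpha> = difference_factor \<alpha> / 2"
      by (simp add: difference_factor_def)
    also have "difference_factor \<alpha> / 2 * K = difference_factor \<alpha> * T + difference_factor \<alpha> / 2 * \<bar>C\<bar>"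
      by (simp add: K_def distrib_left)
    finally show "circle_mean (\<lambda>z. \<bar>ln (norm (g (z + 1))) - ln (norm (g z))\<bar>) r \<le> difference_factor \<alpha> * characteristic R g + difference_factor \<alpha> / 2 * \<bar>C\<bar>"
      by (simp add: T_def)
  qed
qed

section \<open>The divisor of the difference\<close>

text \<open>
  If \<open>f\<close> took the value \<open>a\<close> on a set that is not sparse, it would equal \<open>a\<close> off a sparse set, and so would its
  translate; their difference would then vanish off a sparse set.
\<close>

lemma nonconstant_if_fwd_diff_nonzero:
  assumes f: "f meromorphic_on UNIV" and nz: "\<not> eventually (\<lambda>z. fwd_diff f z = 0) (cosparse UNIV)"
  shows "nonzero_meromorphic (\<lambda>z. f z - a)" "nonzero_meromorphic (fwd_diff f)"
proof -
  have mshift: "(\<lambda>z. f (z + 1)) meromorphic_on UNIV"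
    by (rule meromorphic_on_compose[OF f]) (auto intro!: analytic_intros)
  have md: "fwd_diff f meromorphic_on UNIV"
    unfolding fwd_diff_def[abs_def] by (intro meromorphic_intros mshift f)
  then have "eventually (\<lambda>z. fwd_diff f z = 0) (cosparse UNIV) \<or> eventually (\<lambda>z. fwd_diff f z \<noteq> 0) (cosparse UNIV)"
    by (intro meromorphic_imp_constant_or_avoid) auto
  then show "nonzero_meromorphic (fwd_diff f)" using nz md by (simp add: nonzero_meromorphic_def)
  have ma: "(\<lambda>z. f z - a) meromorphic_on UNIV" by (intro meromorphic_intros f)
  have "\<not> eventually (\<lambda>z. f z - a = 0) (cosparse UNIV)"
  proof
    assume "eventually (\<lambda>z. f z - a = 0) (cosparse UNIV)"
    then have sp: "{z. f z \<noteq> a} sparse_in UNIV" by (simp add: eventually_cosparse)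
    have "{z. fwd_diff f z \<noteq> 0} \<subseteq> {z. f z \<noteq> a} \<union> (+) (-1) ` {z. f z \<noteq> a}"
    proof (rule subsetI, rule ccontr)
      fix z assume z: "z \<in> {z. fwd_diff f z \<noteq> 0}" "z \<notin> {z. f z \<noteq> a} \<union> (+) (-1) ` {z. f z \<noteq> a}"
      have "z = (+) (-1) (z + 1)" by simp
      then have "f (z + 1) = a" using z(2) by blast
      then show False using z by (simp add: fwd_diff_def)
    qed
    moreover have "{z. f z \<noteq> a} \<union> (+) (-1) ` {z. f z \<noteq> a} sparse_in UNIV"
      by (intro sparse_in_union' sp sparse_in_translate_UNIV)
    ultimately have "{z. fwd_diff f z \<noteq> 0} sparse_in UNIV" using sparse_in_subset2 by blast
    then show False using nz by (simp add: eventually_cosparse)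
  qed
  moreover have "eventually (\<lambda>z. f z - a = 0) (cosparse UNIV) \<or> eventually (\<lambda>z. f z - a \<noteq> 0) (cosparse UNIV)"
    by (intro meromorphic_imp_constant_or_avoid ma) auto
  ultimately show "nonzero_meromorphic (\<lambda>z. f z - a)" using ma by (simp add: nonzero_meromorphic_def)
qed

lemma pole_order_minus_const:
  assumes f: "nonzero_meromorphic f"
  shows "pole_order (\<lambda>z. f z - a) = pole_order f"
proof
  fix w
  show "pole_order (\<lambda>z. f z - a) w = pole_order f w"
  proof (cases "is_pole f w \<and> a \<noteq> 0")
    case True
    then have "zorder f w < 0"
      using isolated_pole_imp_neg_zorder nonzero_meromorphicD(4)[OF f] by blast
    then have "zorder (\<lambda>z. f z - a) w = zorder f w"
      using True by (intro zorder_diff1 nonzero_meromorphicD[OF f]) auto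
    then show ?thesis by (simp add: pole_order_def is_pole_minus_const_iff)
  next
    case False
    then show ?thesis by (cases "a = 0") (auto simp: pole_order_def is_pole_minus_const_iff)
  qed
qed

lemma pole_count_minus_const:
  assumes f: "nonzero_meromorphic f"
  shows "pole_count (\<lambda>z. f z - a) = pole_count f"
  by (simp add: pole_count_def fun_eq_iff pole_order_minus_const[OF f] is_pole_minus_const_iff)

lemma zorder_shift_one: "zorder (\<lambda>z. F (z + 1)) w = zorder F (w + 1)"
  by (subst (1 2) zorder_shift) (simp add: add_ac)

lemma nonzero_meromorphic_shift:
  assumes "nonzero_meromorphic g"
  shows "nonzero_meromorphic (\<lambda>z. g (z + 1))"
proof -
  have "{z. g z = 0} sparse_in UNIV" using assms by (simp add: nonzero_meromorphic_def eventually_cosparse)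
  then have "(+) (-1) ` {z. g z = 0} sparse_in UNIV" by (rule sparse_in_translate_UNIV)
  moreover have "(+) (-1) ` {z. g z = 0} = {z. g (z + 1) = 0}"
  proof safe
    fix w assume "g (w + 1) = 0"
    then show "w \<in> (+) (-1) ` {z. g z = 0}" by (intro image_eqI[of _ _ "w + 1"]) auto
  qed auto
  moreover have "(\<lambda>z. g (z + 1)) meromorphic_on UNIV"
    by (rule meromorphic_on_compose[of g UNIV])
       (use assms in \<open>auto simp: nonzero_meromorphic_def intro!: analytic_intros\<close>)
  ultimately show ?thesis by (simp add: nonzero_meromorphic_def eventually_cosparse)
qed

lemma zorder_fwd_diff_ge:
  assumes ga: "nonzero_meromorphic (\<lambda>z. f z - a)" and D: "nonzero_meromorphic (fwd_diff f)"
    and c: "c \<le> zorder (\<lambda>z. f z - a) w" "c \<le> zorder (\<lambda>z. f z - a) (w + 1)"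
  shows "c \<le> zorder (fwd_diff f) w"
proof -
  have gs: "nonzero_meromorphic (\<lambda>z. f (z + 1) - a)" using nonzero_meromorphic_shift[OF ga] by simp
  have e: "fwd_diff f = (\<lambda>z. (f (z + 1) - a) - (f z - a))" by (simp add: fwd_diff_def fun_eq_iff)
  have "zorder (\<lambda>z. (f (z + 1) - a) - (f z - a)) w \<ge> c"
  proof (rule zorder_diff_ge)
    show "\<exists>\<^sub>F z in at w. f (z + 1) - a \<noteq> f z - a"
      using nonzero_meromorphicD(3)[OF D, of w] by (simp add: fwd_diff_def)
    show "c \<le> zorder (\<lambda>z. f (z + 1) - a) w"
      using c(2) zorder_shift_one[of "\<lambda>z. f z - a" w] by simp
  qed (use c nonzero_meromorphicD[OF ga] nonzero_meromorphicD[OF gs] in auto)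
  then show ?thesis by (simp add: e)
qed

text \<open>
  The difference is \<open>(f(z + 1) - a) - (f(z) - a)\<close> for any \<open>a\<close>, and the order of a difference is at least
  the smaller of the two orders. At most one of the minima is positive, since the targets are
  distinct, and none is if one of the two points is a pole.
\<close>

lemma zorder_fwd_diff_lower:
  fixes a :: "'k \<Rightarrow> complex"
  assumes g: "\<And>a. nonzero_meromorphic (\<lambda>z. f z - a)" and D: "nonzero_meromorphic (fwd_diff f)"
    and inj: "inj_on a K" and fin: "finite K"
  shows "(\<Sum>k\<in>K. int (min (zero_order (\<lambda>z. f z - a k) w) (zero_order (\<lambda>z. f z - a k) (w + 1))))
     - int (max (pole_order f w) (pole_order f (w + 1))) \<le> zorder (fwd_diff f) w"
proof -
  have f: "nonzero_meromorphic f" using g[of 0] by simp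
  define m where "m k = min (zero_order (\<lambda>z. f z - a k) w) (zero_order (\<lambda>z. f z - a k) (w + 1))" for k
  have zo: "zorder (\<lambda>z. f z - c) v = int (zero_order (\<lambda>z. f z - c) v) - int (pole_order f v)" for c v
    using zorder_eq_zero_order_minus_pole_order[OF g[of c], of v] by (simp add: pole_order_minus_const[OF f])
  show ?thesis
  proof (cases "\<exists>k\<in>K. m k > 0")
    case True
    then obtain k where k: "k \<in> K" "m k > 0" by blast
    have p0: "pole_order f w = 0" "pole_order f (w + 1) = 0"
      using k(2) zero_order_or_pole_order_zero[of "\<lambda>z. f z - a k" w] zero_order_or_pole_order_zero[of "\<lambda>z. f z - a k" "w + 1"]
      by (auto simp: m_def pole_order_minus_const[OF f])
    have "m j = 0" if "j \<in> K" "j \<noteq> k" for j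
    proof (rule ccontr)
      assume "m j \<noteq> 0"
      then have "isolated_zero (\<lambda>z. f z - a j) w" "isolated_zero (\<lambda>z. f z - a k) w"
        using k(2) by (auto simp: m_def zero_order_def split: if_splits)
      then have "((\<lambda>z. f z - a j) \<longlongrightarrow> 0) (at w)" "((\<lambda>z. f z - a k) \<longlongrightarrow> 0) (at w)"
        by (auto simp: isolated_zero_def)
      from tendsto_diff[OF this] have "((\<lambda>z. a k - a j) \<longlongrightarrow> 0) (at w)" by simp
      then have "a k = a j" by (simp add: tendsto_const_iff)
      then show False using inj that k(1) by (auto dest: inj_onD)
    qed
    then have "(\<Sum>k\<in>K. int (m k)) = (\<Sum>j\<in>K. if j = k then int (m k) else 0)"
      by (intro sum.cong) auto
    also have "\<dots> = int (m k)" using k fin by simp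
    finally have s: "(\<Sum>k\<in>K. int (m k)) = int (m k)" .
    have "int (m k) \<le> zorder (fwd_diff f) w"
      by (rule zorder_fwd_diff_ge[OF g[of "a k"] D]) (simp_all add: zo p0 m_def)
    then show ?thesis using s p0 by (simp add: m_def)
  next
    case False
    then have "(\<Sum>k\<in>K. int (m k)) = 0" by auto
    moreover have "- int (max (pole_order f w) (pole_order f (w + 1))) \<le> zorder (fwd_diff f) w"
    proof (rule zorder_fwd_diff_ge[OF g[of 0] D])
      show "- int (max (pole_order f w) (pole_order f (w + 1))) \<le> zorder (\<lambda>z. f z - 0) w"
        unfolding zo[of 0 w] by linarith
      show "- int (max (pole_order f w) (pole_order f (w + 1))) \<le> zorder (\<lambda>z. f z - 0) (w + 1)"
        unfolding zo[of 0 "w + 1"] by linarith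
    qed
    ultimately show ?thesis by (simp add: m_def)
  qed
qed

text \<open>
  This is the part of the zero count that is removed in the difference counting function: zeros common
  to \<open>w\<close> and \<open>w - 1\<close>, from the radius on from which both points lie in the disc.
\<close>

definition paired_zero_count :: "(complex \<Rightarrow> complex) \<Rightarrow> real \<Rightarrow> real" where
  "paired_zero_count g = step_count (\<lambda>w. max (norm w) (norm (w - 1)))
     (\<lambda>w. real (min (zero_order g w) (zero_order g (w - 1)))) (singular_set g)"

definition paired_pole_count :: "(complex \<Rightarrow> complex) \<Rightarrow> real \<Rightarrow> real" where
  "paired_pole_count g = step_count (\<lambda>w. max (norm w) (norm (w + 1)))
     (\<lambda>w. real (min (pole_order g w) (pole_order g (w + 1)))) (singular_set g)"

definition shifted_pole_count :: "(complex \<Rightarrow> complex) \<Rightarrow> real \<Rightarrow> real" where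
  "shifted_pole_count g = step_count (\<lambda>w. norm (w - 1)) (\<lambda>w. real (pole_order g w)) (singular_set g)"

lemma finite_singular_set_max:
  assumes "nonzero_meromorphic g"
  shows "finite {b \<in> singular_set g. max (norm b) (F b) \<le> R}"
  by (rule finite_subset[OF _ finite_singular_set[OF assms, of R]]) auto

lemma finite_singular_set_shift:
  assumes "nonzero_meromorphic g"
  shows "finite {b \<in> singular_set g. norm (b - 1) \<le> R}"
proof (rule finite_subset[OF _ finite_singular_set[OF assms, of "R + 1"]], safe)
  fix b :: complex assume "norm (b - 1) \<le> R"
  then show "norm b \<le> R + 1" using norm_triangle_ineq[of "b - 1" 1] by simp
qed

lemma n_Delta_zero_eq:
  assumes g: "nonzero_meromorphic (\<lambda>z. f z - a)"
  shows "n_Delta_zero f a t = zero_count (\<lambda>z. f z - a) t - paired_zero_count (\<lambda>z. f z - a) t"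
proof -
  define h where "h = (\<lambda>z. f z - a)"
  define W where "W = {w \<in> singular_set h. norm w \<le> t}"
  have fin: "finite W" unfolding W_def h_def by (rule finite_singular_set[OF g])
  have "n_Delta_zero f a t = (\<Sum>w | norm w \<le> t \<and> isolated_zero h w.
           real (zero_order h w) - real (min (zero_order h w) (if norm (w - 1) \<le> t then zero_order h (w - 1) else 0)))"
    unfolding n_Delta_zero_def h_def Let_def ..
  also have "\<dots> = (\<Sum>w\<in>W. real (zero_order h w) - real (min (zero_order h w) (if norm (w - 1) \<le> t then zero_order h (w - 1) else 0)))"
  proof (rule sum.mono_neutral_left[OF fin])
    show "{w. norm w \<le> t \<and> isolated_zero h w} \<subseteq> W"
      using zero_pole_in_singular_set(1)[OF g] by (auto simp: W_def h_def)
  qed (auto simp: W_def zero_order_def)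
  also have "\<dots> = (\<Sum>w\<in>W. real (zero_order h w)) - (\<Sum>w\<in>W. if norm (w - 1) \<le> t then real (min (zero_order h w) (zero_order h (w - 1))) else 0)"
    unfolding sum_subtractf[symmetric] by (intro sum.cong) auto
  also have "(\<Sum>w\<in>W. if norm (w - 1) \<le> t then real (min (zero_order h w) (zero_order h (w - 1))) else 0) = paired_zero_count h t"
    unfolding paired_zero_count_def step_count_def using fin
    by (subst sum.inter_filter[symmetric]) (auto simp: W_def intro!: sum.cong)
  finally show ?thesis by (simp add: zero_count_def step_count_def W_def h_def)
qed

lemma n_Delta_pole_eq:
  assumes g: "nonzero_meromorphic f"
  shows "n_Delta_pole f t = pole_count f t - paired_pole_count f t"
proof -
  define W where "W = {w \<in> singular_set f. norm w \<le> t}"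
  have fin: "finite W" unfolding W_def by (rule finite_singular_set[OF g])
  have "n_Delta_pole f t = (\<Sum>w | norm w \<le> t \<and> is_pole f w.
           real (pole_order f w) - real (min (pole_order f w) (if norm (w + 1) \<le> t then pole_order f (w + 1) else 0)))"
    by (simp add: n_Delta_pole_def Let_def)
  also have "\<dots> = (\<Sum>w\<in>W. real (pole_order f w) - real (min (pole_order f w) (if norm (w + 1) \<le> t then pole_order f (w + 1) else 0)))"
  proof (rule sum.mono_neutral_left[OF fin])
    show "{w. norm w \<le> t \<and> is_pole f w} \<subseteq> W"
      using zero_pole_in_singular_set(2)[OF g] by (auto simp: W_def)
  qed (auto simp: W_def pole_order_def)
  also have "\<dots> = (\<Sum>w\<in>W. real (pole_order f w)) - (\<Sum>w\<in>W. if norm (w + 1) \<le> t then real (min (pole_order f w) (pole_order f (w + 1))) else 0)"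
    unfolding sum_subtractf[symmetric] by (intro sum.cong) auto
  also have "(\<Sum>w\<in>W. if norm (w + 1) \<le> t then real (min (pole_order f w) (pole_order f (w + 1))) else 0) = paired_pole_count f t"
    unfolding paired_pole_count_def step_count_def using fin
    by (subst sum.inter_filter[symmetric]) (auto simp: W_def intro!: sum.cong)
  finally show ?thesis by (simp add: pole_count_step_count[OF g] step_count_def W_def)
qed

text \<open>
  The local inequality is summed over a disc. The pairing of \<open>w\<close> with \<open>w - 1\<close> in the count of zeros
  becomes a pairing of \<open>w\<close> with \<open>w + 1\<close> by translation; pairs that leave the disc only help. For
  poles, \<open>max x y = x + y - min x y\<close> produces the shifted pole count.
\<close>

lemma divisor_count_fwd_diff:
  fixes a :: "'k \<Rightarrow> complex"
  assumes g: "\<And>a. nonzero_meromorphic (\<lambda>z. f z - a)" and D: "nonzero_meromorphic (fwd_diff f)"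
    and inj: "inj_on a K" and fin: "finite K"
  shows "(\<Sum>k\<in>K. paired_zero_count (\<lambda>z. f z - a k) t) + paired_pole_count f t
     - pole_count f t - shifted_pole_count f t
     \<le> step_count norm (\<lambda>b. of_int (zorder (fwd_diff f) b)) (singular_set (fwd_diff f)) t"
proof -
  have f: "nonzero_meromorphic f" using g[of 0] by simp
  define S where "S = singular_set"
  \<comment> \<open>All points of the disc at which one of the orders involved can be nonzero.\<close>
  define W where "W = {w \<in> S (fwd_diff f). norm w \<le> t} \<union> {w \<in> S f. norm w \<le> t}
     \<union> (\<lambda>w. w - 1) ` {w \<in> S f. norm (w - 1) \<le> t}
     \<union> (\<Union>k\<in>K. (\<lambda>w. w - 1) ` {w \<in> S (\<lambda>z. f z - a k). norm (w - 1) \<le> t})"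
  have finW: "finite W"
    unfolding W_def S_def
    by (intro finite_UnI finite_UN_I finite_imageI fin finite_singular_set finite_singular_set_shift D f g)
  have Wt: "norm w \<le> t" if "w \<in> W" for w using that by (auto simp: W_def)
  have "step_count norm (\<lambda>b. of_int (zorder (fwd_diff f) b)) (singular_set (fwd_diff f)) t
     = (\<Sum>w\<in>W. of_int (zorder (fwd_diff f) w) :: real)"
    unfolding step_count_def
    by (rule sum.mono_neutral_left[OF finW])
       (auto simp: W_def S_def intro: zorder_outside_singular_set)
  also have "\<dots> \<ge> (\<Sum>w\<in>W. (\<Sum>k\<in>K. real (min (zero_order (\<lambda>z. f z - a k) w) (zero_order (\<lambda>z. f z - a k) (w + 1))))
      - real (max (pole_order f w) (pole_order f (w + 1))))"
  proof (rule sum_mono)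
    fix w
    have "real_of_int ((\<Sum>k\<in>K. int (min (zero_order (\<lambda>z. f z - a k) w) (zero_order (\<lambda>z. f z - a k) (w + 1))))
       - int (max (pole_order f w) (pole_order f (w + 1)))) \<le> real_of_int (zorder (fwd_diff f) w)"
      using zorder_fwd_diff_lower[OF g D inj fin, of w] by (simp only: of_int_le_iff)
    then show "(\<Sum>k\<in>K. real (min (zero_order (\<lambda>z. f z - a k) w) (zero_order (\<lambda>z. f z - a k) (w + 1))))
      - real (max (pole_order f w) (pole_order f (w + 1))) \<le> real_of_int (zorder (fwd_diff f) w)"
      by simp
  qed
  moreover have "(\<Sum>w\<in>W. (\<Sum>k\<in>K. real (min (zero_order (\<lambda>z. f z - a k) w) (zero_order (\<lambda>z. f z - a k) (w + 1))))
      - real (max (pole_order f w) (pole_order f (w + 1))))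
     = (\<Sum>k\<in>K. \<Sum>w\<in>W. real (min (zero_order (\<lambda>z. f z - a k) w) (zero_order (\<lambda>z. f z - a k) (w + 1))))
       + (\<Sum>w\<in>W. real (min (pole_order f w) (pole_order f (w + 1))))
       - (\<Sum>w\<in>W. real (pole_order f w)) - (\<Sum>w\<in>W. real (pole_order f (w + 1)))"
  proof -
    have "real (max x y) = real x + real y - real (min x y)" for x y :: nat by auto
    then have "(\<Sum>w\<in>W. (\<Sum>k\<in>K. real (min (zero_order (\<lambda>z. f z - a k) w) (zero_order (\<lambda>z. f z - a k) (w + 1))))
      - real (max (pole_order f w) (pole_order f (w + 1))))
     = (\<Sum>w\<in>W. (\<Sum>k\<in>K. real (min (zero_order (\<lambda>z. f z - a k) w) (zero_order (\<lambda>z. f z - a k) (w + 1))))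
       + real (min (pole_order f w) (pole_order f (w + 1))) - real (pole_order f w) - real (pole_order f (w + 1)))"
      by (intro sum.cong refl) (simp only: algebra_simps)
    also have "\<dots> = (\<Sum>w\<in>W. \<Sum>k\<in>K. real (min (zero_order (\<lambda>z. f z - a k) w) (zero_order (\<lambda>z. f z - a k) (w + 1))))
       + (\<Sum>w\<in>W. real (min (pole_order f w) (pole_order f (w + 1))))
       - (\<Sum>w\<in>W. real (pole_order f w)) - (\<Sum>w\<in>W. real (pole_order f (w + 1)))"
      by (simp only: sum.distrib sum_subtractf)
    also have "(\<Sum>w\<in>W. \<Sum>k\<in>K. real (min (zero_order (\<lambda>z. f z - a k) w) (zero_order (\<lambda>z. f z - a k) (w + 1))))
      = (\<Sum>k\<in>K. \<Sum>w\<in>W. real (min (zero_order (\<lambda>z. f z - a k) w) (zero_order (\<lambda>z. f z - a k) (w + 1))))"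
      by (rule sum.swap)
    finally show ?thesis .
  qed
  moreover have "paired_zero_count (\<lambda>z. f z - a k) t
      \<le> (\<Sum>w\<in>W. real (min (zero_order (\<lambda>z. f z - a k) w) (zero_order (\<lambda>z. f z - a k) (w + 1))))" if k: "k \<in> K" for k
  proof -
    define o' where "o' = zero_order (\<lambda>z. f z - a k)"
    define V where "V = {b \<in> S (\<lambda>z. f z - a k). max (norm b) (norm (b - 1)) \<le> t}"
    have "paired_zero_count (\<lambda>z. f z - a k) t = (\<Sum>b\<in>V. real (min (o' b) (o' (b - 1))))"
      by (simp add: paired_zero_count_def step_count_def V_def S_def o'_def)
    also have "\<dots> = (\<Sum>w\<in>(\<lambda>b. b - 1) ` V. real (min (o' w) (o' (w + 1))))"
      by (subst sum.reindex) (auto simp: inj_on_def min.commute)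
    also have "\<dots> \<le> (\<Sum>w\<in>W. real (min (o' w) (o' (w + 1))))"
    proof (rule sum_mono2[OF finW])
      show "(\<lambda>b. b - 1) ` V \<subseteq> W" using k by (auto simp: W_def V_def)
    qed auto
    finally show ?thesis by (simp add: o'_def)
  qed
  then have "(\<Sum>k\<in>K. paired_zero_count (\<lambda>z. f z - a k) t)
     \<le> (\<Sum>k\<in>K. \<Sum>w\<in>W. real (min (zero_order (\<lambda>z. f z - a k) w) (zero_order (\<lambda>z. f z - a k) (w + 1))))"
    by (rule sum_mono)
  moreover have "paired_pole_count f t \<le> (\<Sum>w\<in>W. real (min (pole_order f w) (pole_order f (w + 1))))"
    unfolding paired_pole_count_def step_count_def
    by (rule sum_mono2[OF finW]) (auto simp: W_def S_def)
  moreover have "(\<Sum>w\<in>W. real (pole_order f w)) = pole_count f t"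
    unfolding pole_count_step_count[OF f] step_count_def
  proof (rule sum.mono_neutral_right[OF finW])
    show "{b \<in> singular_set f. norm b \<le> t} \<subseteq> W" by (auto simp: W_def S_def)
    show "\<forall>w\<in>W - {b \<in> singular_set f. norm b \<le> t}. real (pole_order f w) = 0"
    proof
      fix w assume "w \<in> W - {b \<in> singular_set f. norm b \<le> t}"
      then have "w \<notin> singular_set f" using Wt by auto
      then show "real (pole_order f w) = 0" using orders_outside_singular_set(2)[OF f] by simp
    qed
  qed
  moreover have "(\<Sum>w\<in>W. real (pole_order f (w + 1))) = shifted_pole_count f t"
  proof -
    define V where "V = {b \<in> S f. norm (b - 1) \<le> t}"
    have "shifted_pole_count f t = (\<Sum>b\<in>V. real (pole_order f b))"
      by (simp add: shifted_pole_count_def step_count_def V_def S_def)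
    also have "\<dots> = (\<Sum>w\<in>(\<lambda>b. b - 1) ` V. real (pole_order f (w + 1)))"
      by (subst sum.reindex) (auto simp: inj_on_def)
    also have "\<dots> = (\<Sum>w\<in>W. real (pole_order f (w + 1)))"
    proof (rule sum.mono_neutral_left[OF finW])
      show "(\<lambda>b. b - 1) ` V \<subseteq> W" by (auto simp: W_def V_def)
      show "\<forall>w\<in>W - (\<lambda>b. b - 1) ` V. real (pole_order f (w + 1)) = 0"
      proof
        fix w assume w: "w \<in> W - (\<lambda>b. b - 1) ` V"
        have "w + 1 \<notin> S f"
        proof
          assume "w + 1 \<in> S f"
          then have "w + 1 \<in> V" using Wt w by (auto simp: V_def)
          then have "w \<in> (\<lambda>b. b - 1) ` V" by (intro image_eqI[of _ _ "w + 1"]) auto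
          then show False using w by blast
        qed
        then show "real (pole_order f (w + 1)) = 0"
          using orders_outside_singular_set[OF f] by (simp add: S_def)
      qed
    qed
    finally show ?thesis by simp
  qed
  ultimately show ?thesis by linarith
qed

lemma integrated_divisor_count_fwd_diff:
  fixes a :: "'k \<Rightarrow> complex"
  assumes g: "\<And>a. nonzero_meromorphic (\<lambda>z. f z - a)" and D: "nonzero_meromorphic (fwd_diff f)"
    and inj: "inj_on a K" and fin: "finite K"
  obtains C where "\<And>r. 1 \<le> r \<Longrightarrow> (\<Sum>k\<in>K. integrated_count (paired_zero_count (\<lambda>z. f z - a k)) r)
     + integrated_count (paired_pole_count f) r - integrated_count (pole_count f) r - integrated_count (shifted_pole_count f) r
     \<le> integrated_count (step_count norm (\<lambda>b. of_int (zorder (fwd_diff f) b)) (singular_set (fwd_diff f))) r + C"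
proof -
  have f: "nonzero_meromorphic f" using g[of 0] by simp
  define J where "J n r = integrated_count n r - integrated_count n 1" for n r
  define d where "d = step_count norm (\<lambda>b. real_of_int (zorder (fwd_diff f) b)) (singular_set (fwd_diff f))"
  have hd: "((\<lambda>t. d t / t) has_integral J d r) {1..r}" if "1 \<le> r" for r
    unfolding d_def J_def by (rule integrated_count_diff) (use that finite_singular_set[OF D] in auto)
  have hp: "((\<lambda>t. pole_count f t / t) has_integral J (pole_count f) r) {1..r}" if "1 \<le> r" for r
    unfolding pole_count_step_count[OF f] J_def by (rule integrated_count_diff) (use that finite_singular_set[OF f] in auto)
  have hs: "((\<lambda>t. shifted_pole_count f t / t) has_integral J (shifted_pole_count f) r) {1..r}" if "1 \<le> r" for r
    unfolding shifted_pole_count_def J_def by (rule integrated_count_diff) (use that finite_singular_set_shift[OF f] in auto)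
  have hq: "((\<lambda>t. paired_pole_count f t / t) has_integral J (paired_pole_count f) r) {1..r}" if "1 \<le> r" for r
    unfolding paired_pole_count_def J_def
    by (rule integrated_count_diff[OF finite_singular_set_max[OF f]]) (use that in \<open>auto simp: le_max_iff_disj\<close>)
  have hz: "((\<lambda>t. paired_zero_count (\<lambda>z. f z - a k) t / t) has_integral J (paired_zero_count (\<lambda>z. f z - a k)) r) {1..r}" if "1 \<le> r" for r k
    unfolding paired_zero_count_def J_def
    by (rule integrated_count_diff[OF finite_singular_set_max[OF g]]) (use that in \<open>auto simp: le_max_iff_disj\<close>)
  have J: "(\<Sum>k\<in>K. J (paired_zero_count (\<lambda>z. f z - a k)) r) + J (paired_pole_count f) r - J (pole_count f) r - J (shifted_pole_count f) r \<le> J d r"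
    if r: "1 \<le> r" for r
  proof (rule has_integral_le)
    show "((\<lambda>t. (\<Sum>k\<in>K. paired_zero_count (\<lambda>z. f z - a k) t / t) + paired_pole_count f t / t - pole_count f t / t - shifted_pole_count f t / t)
      has_integral (\<Sum>k\<in>K. J (paired_zero_count (\<lambda>z. f z - a k)) r) + J (paired_pole_count f) r - J (pole_count f) r - J (shifted_pole_count f) r) {1..r}"
      by (intro has_integral_diff has_integral_add has_integral_sum fin hz hq hp hs r)
    show "((\<lambda>t. d t / t) has_integral J d r) {1..r}" by (rule hd[OF r])
    fix t assume "t \<in> {1..r}"
    then show "(\<Sum>k\<in>K. paired_zero_count (\<lambda>z. f z - a k) t / t) + paired_pole_count f t / t - pole_count f t / t - shifted_pole_count f t / t \<le> d t / t"
      using divide_right_mono[OF divisor_count_fwd_diff[OF g D inj fin, of t], of t]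
      by (simp add: d_def add_divide_distrib diff_divide_distrib sum_divide_distrib)
  qed
  show ?thesis
  proof (rule that)
    fix r :: real assume r: "1 \<le> r"
    show "(\<Sum>k\<in>K. integrated_count (paired_zero_count (\<lambda>z. f z - a k)) r)
       + integrated_count (paired_pole_count f) r - integrated_count (pole_count f) r - integrated_count (shifted_pole_count f) r
     \<le> integrated_count (step_count norm (\<lambda>b. of_int (zorder (fwd_diff f) b)) (singular_set (fwd_diff f))) r
      + ((\<Sum>k\<in>K. integrated_count (paired_zero_count (\<lambda>z. f z - a k)) 1)
        + integrated_count (paired_pole_count f) 1 - integrated_count (pole_count f) 1 - integrated_count (shifted_pole_count f) 1 - integrated_count d 1)"
      using J[OF r] unfolding J_def sum_subtractf d_def by linarith
  qed
qed

text \<open>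
  A pole at \<open>b\<close> with \<open>|b - 1| \<le> t\<close> satisfies \<open>|b| \<le> t + 1\<close>. The change from \<open>dt / t\<close> to \<open>dt / (t + 1)\<close> costs
  the factor \<open>1 + 1/s\<close>, which is close to \<open>1\<close> when the integration starts at a large \<open>s\<close>.
\<close>

lemma integrated_shifted_pole_count_le:
  assumes f: "nonzero_meromorphic f" and s: "1 \<le> s" "s \<le> r"
  shows "integrated_count (shifted_pole_count f) r - integrated_count (shifted_pole_count f) s
     \<le> (1 + 1 / s) * integrated_count (pole_count f) (r + 1)"
proof -
  define p where "p = pole_count f"
  have p_eq: "p = step_count norm (\<lambda>w. real (pole_order f w)) (singular_set f)"
    by (simp add: p_def pole_count_step_count[OF f])
  have p0: "0 \<le> p t" for t by (simp add: p_eq step_count_def sum_nonneg)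
  have "((\<lambda>t. p t / t) has_integral (integrated_count p (r + 1) - integrated_count p (s + 1))) {s + 1..r + 1}"
    unfolding p_eq by (rule integrated_count_diff) (use s finite_singular_set[OF f] in auto)
  then have "(((\<lambda>t. p t / t) \<circ> (+) 1) has_integral (integrated_count p (r + 1) - integrated_count p (s + 1))) {s..r}"
    by (subst has_integral_shift_Icc_real) simp
  then have 1: "((\<lambda>t. (1 + 1 / s) * (p (1 + t) / (1 + t))) has_integral (1 + 1 / s) * (integrated_count p (r + 1) - integrated_count p (s + 1))) {s..r}"
    by (intro has_integral_mult_right) (simp add: o_def)
  have 2: "((\<lambda>t. shifted_pole_count f t / t) has_integral
      (integrated_count (shifted_pole_count f) r - integrated_count (shifted_pole_count f) s)) {s..r}"
    unfolding shifted_pole_count_def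
    by (rule integrated_count_diff) (use s finite_singular_set_shift[OF f] in auto)
  have "integrated_count (shifted_pole_count f) r - integrated_count (shifted_pole_count f) s
     \<le> (1 + 1 / s) * (integrated_count p (r + 1) - integrated_count p (s + 1))"
  proof (rule has_integral_le[OF 2 1])
    fix t assume t: "t \<in> {s..r}"
    have "shifted_pole_count f t \<le> p (1 + t)"
      unfolding shifted_pole_count_def p_eq step_count_def
    proof (rule sum_mono2[OF finite_singular_set[OF f]], safe)
      fix b :: complex assume "norm (b - 1) \<le> t"
      then show "norm b \<le> 1 + t" using norm_triangle_ineq[of "b - 1" 1] by simp
    qed simp
    then have "shifted_pole_count f t / t \<le> p (1 + t) / t" using t s by (intro divide_right_mono) auto
    also have "\<dots> = p (1 + t) * (1 / t)" by simp
    also have "1 / t \<le> (1 + 1 / s) / (1 + t)"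
    proof -
      have "0 < t" using t s by auto
      moreover from this have "0 < t + t * t" by (intro add_pos_pos) auto
      ultimately have "1 / t = (1 + 1 / t) / (1 + t)" by (simp add: field_simps)
      also have "\<dots> \<le> (1 + 1 / s) / (1 + t)"
        using t s by (intro divide_right_mono add_left_mono frac_le) auto
      finally show ?thesis .
    qed
    then have "p (1 + t) * (1 / t) \<le> p (1 + t) * ((1 + 1 / s) / (1 + t))" by (rule mult_left_mono) (rule p0)
    finally show "shifted_pole_count f t / t \<le> (1 + 1 / s) * (p (1 + t) / (1 + t))" by (simp add: mult.commute)
  qed
  also have "\<dots> \<le> (1 + 1 / s) * integrated_count p (r + 1)"
    using s integrated_counts_nonneg(2)[OF f, of "s + 1"] by (intro mult_left_mono) (auto simp: p_def)
  finally show ?thesis by (simp add: p_def)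
qed

lemma integrated_pole_count_increment:
  assumes f: "nonzero_meromorphic f" and r: "1 \<le> r" "r + 1 < R"
  shows "integrated_count (pole_count f) (r + 1) - integrated_count (pole_count f) r
     \<le> R / ((R - (r + 1)) * r) * integrated_count (pole_count f) R"
proof -
  define p where "p = pole_count f"
  have p_eq: "p = step_count norm (\<lambda>w. real (pole_order f w)) (singular_set f)"
    by (simp add: p_def pole_count_step_count[OF f])
  have p0: "0 \<le> p t" for t by (simp add: p_eq step_count_def sum_nonneg)
  have pm: "p t \<le> p u" if "t \<le> u" for t u
    unfolding p_eq step_count_def by (rule sum_mono2[OF finite_singular_set[OF f]]) (use that in auto)
  have 1: "((\<lambda>t. p t / t) has_integral (integrated_count p (r + 1) - integrated_count p r)) {r..r + 1}"
    unfolding p_eq by (rule integrated_count_diff) (use r finite_singular_set[OF f] in auto)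
  have 2: "((\<lambda>t. p (r + 1) / r) has_integral p (r + 1) / r) {r..r + 1}"
    using has_integral_const_real[of "p (r + 1) / r" r "r + 1"] by simp
  have "integrated_count p (r + 1) - integrated_count p r \<le> p (r + 1) / r"
    by (rule has_integral_le[OF 1 2]) (use r p0 pm in \<open>auto intro!: frac_le\<close>)
  also have "p (r + 1) \<le> R / (R - (r + 1)) * integrated_count p R"
    unfolding p_eq by (rule step_count_le_integrated_count[OF finite_singular_set[OF f]]) (use r in auto)
  then have "p (r + 1) / r \<le> R / (R - (r + 1)) * integrated_count p R / r"
    using r by (intro divide_right_mono) auto
  finally show ?thesis by (simp add: p_def)
qed

section \<open>The inequality at comparable radii\<close>

text \<open>
  A point is close to at most one of finitely many distinct targets, so up to a constant the sum of
  the proximities to all of them is the proximity to the nearest one.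
\<close>

lemma sum_log_plus_targets:
  fixes a :: "'k \<Rightarrow> complex"
  assumes fin: "finite K" and inj: "inj_on a K" and k0: "k0 \<in> K"
  obtains C where "\<And>x y. (\<And>k. k \<in> K \<Longrightarrow> x \<noteq> a k \<and> y \<noteq> a k) \<Longrightarrow> x \<noteq> y \<Longrightarrow>
     (\<Sum>k\<in>K. log_plus (inverse (norm (x - a k)))) \<le> - ln (norm (y - x)) + log_plus (norm x)
       + 2 * (\<Sum>k\<in>K. \<bar>ln (norm (y - a k)) - ln (norm (x - a k))\<bar>) + C"
proof -
  \<comment> \<open>Half the minimal distance of two targets; the \<open>1\<close> covers the case of a single target.\<close>
  obtain d where d: "0 < d" "\<And>j k. j \<in> K \<Longrightarrow> k \<in> K \<Longrightarrow> j \<noteq> k \<Longrightarrow> 2 * d \<le> norm (a j - a k)"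
  proof -
    define P where "P = (\<lambda>(j,k). norm (a j - a k)) ` {(j,k). j \<in> K \<and> k \<in> K \<and> j \<noteq> k}"
    have "finite {(j,k). j \<in> K \<and> k \<in> K \<and> j \<noteq> k}"
      by (rule finite_subset[of _ "K \<times> K"]) (use fin in auto)
    then have fP: "finite (insert 1 P)" by (simp add: P_def)
    have "0 < Min (insert 1 P)"
      using fP inj by (subst Min_gr_iff) (auto simp: P_def inj_on_def)
    moreover have "Min (insert 1 P) \<le> norm (a j - a k)" if "j \<in> K" "k \<in> K" "j \<noteq> k" for j k
      using fP that by (intro Min_le) (auto simp: P_def)
    ultimately show ?thesis by (intro that[of "Min (insert 1 P) / 2"]) auto
  qed
  define C0 where "C0 = log_plus (norm (a k0)) + ln 2"
  define C where "C = real (card K) * log_plus (inverse d) + C0 + 2 * ln 2"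
  show ?thesis
  proof (rule that[of C])
    fix x y assume xy: "\<And>k. k \<in> K \<Longrightarrow> x \<noteq> a k \<and> y \<noteq> a k" "x \<noteq> y"
    define L where "L k = \<bar>ln (norm (y - a k)) - ln (norm (x - a k))\<bar>" for k
    have L0: "0 \<le> L k" for k by (simp add: L_def)
    have Lsum: "L k \<le> (\<Sum>k\<in>K. L k)" if "k \<in> K" for k
      using that L0 fin by (intro member_le_sum) auto
    obtain k where k: "k \<in> K" "\<And>j. j \<in> K \<Longrightarrow> j \<noteq> k \<Longrightarrow> d \<le> norm (x - a j)"
    proof (cases "\<exists>k\<in>K. norm (x - a k) < d")
      case True
      then obtain k where k: "k \<in> K" "norm (x - a k) < d" by blast
      have "d \<le> norm (x - a j)" if "j \<in> K" "j \<noteq> k" for j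
        using d(2)[OF that(1) k(1) that(2)] k(2) norm_triangle_ineq4[of "x - a k" "x - a j"] by simp
      then show ?thesis using that k by blast
    next
      case False
      then show ?thesis using that[of k0] k0 by force
    qed
    have D: "0 < norm (y - x)" "0 < norm (x - a k)" "0 < norm (x - a k0)" using xy k k0 by auto
    have "(\<Sum>j\<in>K. log_plus (inverse (norm (x - a j)))) \<le> (\<Sum>j\<in>K. log_plus (inverse d) + (if j = k then log_plus (inverse (norm (x - a k))) else 0))"
    proof (rule sum_mono)
      fix j assume "j \<in> K"
      then show "log_plus (inverse (norm (x - a j))) \<le> log_plus (inverse d) + (if j = k then log_plus (inverse (norm (x - a k))) else 0)"
        using k(2)[of j] d(1) log_plus_nonneg[of "inverse d"] by (auto intro!: log_plus_mono le_imp_inverse_le)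
    qed
    also have "\<dots> = real (card K) * log_plus (inverse d) + log_plus (inverse (norm (x - a k)))"
      using k(1) fin by (simp add: sum.distrib)
    also have "log_plus (inverse (norm (x - a k))) \<le> log_plus (norm (y - x) / norm (x - a k)) + log_plus (inverse (norm (y - x)))"
      using log_plus_mult[of "norm (y - x) / norm (x - a k)" "inverse (norm (y - x))"] D by (simp add: field_simps)
    also have "log_plus (norm (y - x) / norm (x - a k)) \<le> L k + ln 2"
      using log_plus_ratio[of x "a k" y] xy k(1) by (simp add: L_def)
    also have "log_plus (inverse (norm (y - x))) = log_plus (norm (y - x)) - ln (norm (y - x))"
      using log_plus_diff_inverse[OF D(1)] by simp
    also have "log_plus (norm (y - x)) \<le> log_plus (norm (x - a k0)) + log_plus (norm (y - x) / norm (x - a k0))"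
      using log_plus_mult[of "norm (x - a k0)" "norm (y - x) / norm (x - a k0)"] D by simp
    also have "log_plus (norm (y - x) / norm (x - a k0)) \<le> L k0 + ln 2"
      using log_plus_ratio[of x "a k0" y] xy k0 by (simp add: L_def)
    also have "log_plus (norm (x - a k0)) \<le> log_plus (norm x) + C0"
      unfolding C0_def by (rule log_plus_norm_minus)
    finally show "(\<Sum>k\<in>K. log_plus (inverse (norm (x - a k)))) \<le> - ln (norm (y - x)) + log_plus (norm x)
       + 2 * (\<Sum>k\<in>K. \<bar>ln (norm (y - a k)) - ln (norm (x - a k))\<bar>) + C"
      using Lsum[OF k(1)] Lsum[OF k0] unfolding L_def[symmetric] C_def by linarith
  qed
qed

text \<open>
  Translation of the values by a constant changes \<open>log\<^sup>+\<close> by a bounded amount and does not change the poles.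
\<close>

lemma characteristic_minus_const:
  assumes f: "nonzero_meromorphic f"
  obtains C where "\<And>r. generic_radius f r \<Longrightarrow> generic_radius (\<lambda>z. f z - a) r \<Longrightarrow>
    \<bar>characteristic r (\<lambda>z. f z - a) - characteristic r f\<bar> \<le> C"
proof (rule that[of "log_plus (norm a) + ln 2"])
  fix r assume r: "generic_radius f r" "generic_radius (\<lambda>z. f z - a) r"
  define C where "C = log_plus (norm a) + ln 2"
  have i: "(\<lambda>t. log_plus (norm (f (of_real r * cis t)))) integrable_on {0..2*pi}"
    "(\<lambda>t. log_plus (norm (f (of_real r * cis t) - a))) integrable_on {0..2*pi}"
    using integrable_on_circle[OF r(1), of "\<lambda>w. log_plus (norm w)"] integrable_on_circle[OF r(2), of "\<lambda>w. log_plus (norm w)"]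
    by (auto intro!: continuous_intros)
  have "circle_mean (\<lambda>z. log_plus (norm (f z - a))) r \<le> circle_mean (\<lambda>z. log_plus (norm (f z)) + C) r"
    by (rule circle_mean_mono) (use i log_plus_norm_minus in \<open>auto intro: integrable_add simp: C_def\<close>)
  moreover have "circle_mean (\<lambda>z. log_plus (norm (f z))) r \<le> circle_mean (\<lambda>z. log_plus (norm (f z - a)) + C) r"
  proof (rule circle_mean_mono)
    fix t
    show "log_plus (norm (f (of_real r * cis t))) \<le> log_plus (norm (f (of_real r * cis t) - a)) + C"
      using log_plus_norm_minus[of "f (of_real r * cis t) - a" "- a"] by (simp add: C_def)
  qed (use i in \<open>auto intro: integrable_add\<close>)
  moreover have "(\<lambda>t. C) integrable_on {0..2*pi}" by (rule integrable_const_ivl)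
  ultimately have "\<bar>proximity r (\<lambda>z. f z - a) - proximity r f\<bar> \<le> C"
    using circle_mean_add[of "\<lambda>z. log_plus (norm (f z))" r "\<lambda>_. C"] circle_mean_add[of "\<lambda>z. log_plus (norm (f z - a))" r "\<lambda>_. C"] i
    by (simp add: proximity_circle_mean circle_mean_const)
  then show "\<bar>characteristic r (\<lambda>z. f z - a) - characteristic r f\<bar> \<le> log_plus (norm a) + ln 2"
    by (simp add: characteristic_def pole_count_minus_const[OF f] C_def)
qed

text \<open>
  At such radii all the estimates apply to \<open>f\<close>, \<open>\<Delta>f\<close>, and to \<open>f - a\<close> on the circle itself and on its
  translate by \<open>1\<close>.
\<close>

definition good_radius :: "(complex \<Rightarrow> complex) \<Rightarrow> complex set \<Rightarrow> real \<Rightarrow> bool" where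
  "good_radius f A r \<longleftrightarrow> 1 \<le> r \<and> generic_radius f r \<and> generic_radius (fwd_diff f) r \<and>
     (\<forall>a\<in>A. generic_radius (\<lambda>z. f z - a) r \<and> (\<forall>b\<in>singular_set (\<lambda>z. f z - a). norm (b - 1) \<noteq> r))"

lemma countable_bad_radii:
  assumes g: "\<And>a. nonzero_meromorphic (\<lambda>z. f z - a)" and D: "nonzero_meromorphic (fwd_diff f)" and fin: "finite A"
  shows "countable {r. 1 \<le> r \<and> \<not> good_radius f A r}"
proof (rule countable_subset)
  have f: "nonzero_meromorphic f" using g[of 0] by simp
  let ?B = "norm ` singular_set f \<union> norm ` singular_set (fwd_diff f) \<union>
    (\<Union>a\<in>A. norm ` singular_set (\<lambda>z. f z - a) \<union> (\<lambda>b. norm (b - 1)) ` singular_set (\<lambda>z. f z - a))"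
  show "{r. 1 \<le> r \<and> \<not> good_radius f A r} \<subseteq> ?B"
    by (force simp: good_radius_def generic_radius_def)
  show "countable ?B"
    using fin by (intro countable_Un countable_image countable_UN countable_singular_set f D g) (auto intro: countable_finite)
qed

lemma integrable_abs_log_difference:
  assumes "generic_radius g r" "\<And>b. b \<in> singular_set g \<Longrightarrow> norm (b - 1) \<noteq> r"
  shows "(\<lambda>t. \<bar>ln (norm (g (of_real r * cis t + 1))) - ln (norm (g (of_real r * cis t)))\<bar>) integrable_on {0..2*pi}"
proof -
  have r: "0 \<le> r" using assms(1) by (simp add: generic_radius_def)
  have ns: "of_real r * cis t \<notin> singular_set g" "of_real r * cis t + 1 \<notin> singular_set g" for t
    using assms r norm_circle[of r t] assms(2)[of "of_real r * cis t + 1"] by (auto simp: generic_radius_def)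
  then have nz: "g (of_real r * cis t) \<noteq> 0" "g (of_real r * cis t + 1) \<noteq> 0" for t
    by (auto simp: singular_set_def)
  have c: "continuous_on (- singular_set g) g" by (rule continuous_on_outside_singular_set) auto
  have "continuous_on {0..2*pi} (\<lambda>t. g (of_real r * cis t + 1))" "continuous_on {0..2*pi} (\<lambda>t. g (of_real r * cis t))"
    by (rule continuous_on_compose2[OF c]; use ns in \<open>auto intro!: continuous_intros\<close>)+
  then show ?thesis
    by (intro integrable_continuous_real continuous_intros) (use nz in auto)
qed

text \<open>
  The bound of \<open>sum_log_plus_targets\<close> is averaged over the circle. On the left, the first main theorem turns each
  proximity into the characteristic minus a zero count; on the right, Jensen's formula turns the mean
  of \<open>ln |\<Delta>f|\<close> into the divisor count of \<open>\<Delta>f\<close>, which is bounded below by the paired counts. What remains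
  of the poles is one pole count, which completes the proximity of \<open>f\<close> to a characteristic.
\<close>

lemma second_main_inequality:
  assumes g: "\<And>a. nonzero_meromorphic (\<lambda>z. f z - a)" and D: "nonzero_meromorphic (fwd_diff f)"
    and fin: "finite A" and ne: "A \<noteq> {}" and \<alpha>: "2 \<le> \<alpha>"
  obtains C where "\<And>r R. good_radius f A r \<Longrightarrow> good_radius f A R \<Longrightarrow> 2 * \<alpha> \<le> r \<Longrightarrow>
      r + 2 * \<alpha> \<le> R \<Longrightarrow> R \<le> r + 3 * \<alpha> \<Longrightarrow>
      (real (card A) - 1) * characteristic r f \<le> N_Delta_pole r f + (\<Sum>a\<in>A. N_Delta_zero r f a)
        + (2 * real (card A) * difference_factor \<alpha> + 4 / \<alpha>) * characteristic R f + C"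
proof -
  have f: "nonzero_meromorphic f" using g[of 0] by simp
  define h where "h a = (\<lambda>z. f z - a)" for a
  note gh = g[folded h_def]
  have df0: "0 \<le> difference_factor \<alpha>" using \<alpha> by (simp add: difference_factor_def)
  obtain a0 where a0: "a0 \<in> A" using ne by blast
  obtain C1 where C1: "\<And>x y. (\<And>a. a \<in> A \<Longrightarrow> x \<noteq> a \<and> y \<noteq> a) \<Longrightarrow> x \<noteq> y \<Longrightarrow>
     (\<Sum>a\<in>A. log_plus (inverse (norm (x - a)))) \<le> - ln (norm (y - x)) + log_plus (norm x)
       + 2 * (\<Sum>a\<in>A. \<bar>ln (norm (y - a)) - ln (norm (x - a))\<bar>) + C1"
    by (rule sum_log_plus_targets[OF fin inj_on_id2 a0]) blast
  have "\<forall>a. \<exists>C. \<forall>r. generic_radius (h a) r \<longrightarrow>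
    proximity r (\<lambda>z. inverse (h a z)) = characteristic r (h a) - integrated_count (zero_count (h a)) r + C"
    using proximity_inverse[OF gh] by metis
  then obtain C2 where C2: "\<And>a r. generic_radius (h a) r \<Longrightarrow>
    proximity r (\<lambda>z. inverse (h a z)) = characteristic r (h a) - integrated_count (zero_count (h a)) r + C2 a" by metis
  have "\<forall>a. \<exists>C. \<forall>r. generic_radius f r \<longrightarrow> generic_radius (h a) r \<longrightarrow> \<bar>characteristic r (h a) - characteristic r f\<bar> \<le> C"
    using characteristic_minus_const[OF f] unfolding h_def by metis
  then obtain C3 where C3: "\<And>a r. generic_radius f r \<Longrightarrow> generic_radius (h a) r \<Longrightarrow> \<bar>characteristic r (h a) - characteristic r f\<bar> \<le> C3 a" by metis
  define P where "P a C \<longleftrightarrow> (\<forall>r R. generic_radius (h a) r \<longrightarrow> (\<forall>b\<in>singular_set (h a). norm (b - 1) \<noteq> r) \<longrightarrow>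
      generic_radius (h a) R \<longrightarrow> 2 * \<alpha> \<le> r \<longrightarrow> r + 2 * \<alpha> \<le> R \<longrightarrow> R \<le> r + 3 * \<alpha> \<longrightarrow>
      circle_mean (\<lambda>z. \<bar>ln (norm (h a (z + 1))) - ln (norm (h a z))\<bar>) r \<le> difference_factor \<alpha> * characteristic R (h a) + C)" for a C
  have "\<forall>a. \<exists>C. P a C"
  proof
    fix a
    obtain C where "\<And>r R. generic_radius (h a) r \<Longrightarrow> (\<And>b. b \<in> singular_set (h a) \<Longrightarrow> norm (b - 1) \<noteq> r) \<Longrightarrow>
      generic_radius (h a) R \<Longrightarrow> 2 * \<alpha> \<le> r \<Longrightarrow> r + 2 * \<alpha> \<le> R \<Longrightarrow> R \<le> r + 3 * \<alpha> \<Longrightarrow>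
      circle_mean (\<lambda>z. \<bar>ln (norm (h a (z + 1))) - ln (norm (h a z))\<bar>) r \<le> difference_factor \<alpha> * characteristic R (h a) + C"
      by (rule difference_estimate[OF gh[of a] \<alpha>]) blast
    then have "P a C" unfolding P_def by blast
    then show "\<exists>C. P a C" ..
  qed
  then have "\<exists>C. \<forall>a. P a (C a)" by (rule choice)
  then obtain C4 where "\<forall>a. P a (C4 a)" ..
  then have C4: "\<And>a r R. generic_radius (h a) r \<Longrightarrow> (\<forall>b\<in>singular_set (h a). norm (b - 1) \<noteq> r) \<Longrightarrow>
      generic_radius (h a) R \<Longrightarrow> 2 * \<alpha> \<le> r \<Longrightarrow> r + 2 * \<alpha> \<le> R \<Longrightarrow> R \<le> r + 3 * \<alpha> \<Longrightarrow>
      circle_mean (\<lambda>z. \<bar>ln (norm (h a (z + 1))) - ln (norm (h a z))\<bar>) r \<le> difference_factor \<alpha> * characteristic R (h a) + C4 a"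
    unfolding P_def by blast
  define ND where "ND = integrated_count (step_count norm (\<lambda>b. real_of_int (zorder (fwd_diff f) b)) (singular_set (fwd_diff f)))"
  obtain C5 where C5: "\<And>r. generic_radius (fwd_diff f) r \<Longrightarrow> circle_mean (\<lambda>z. ln (norm (fwd_diff f z))) r = ND r + C5"
    unfolding ND_def by (rule jensen_divisor[OF D]) blast
  obtain C6 where C6: "\<And>r. 1 \<le> r \<Longrightarrow> (\<Sum>a\<in>A. integrated_count (paired_zero_count (h a)) r)
     + integrated_count (paired_pole_count f) r - integrated_count (pole_count f) r - integrated_count (shifted_pole_count f) r
     \<le> ND r + C6"
    unfolding ND_def h_def by (rule integrated_divisor_count_fwd_diff[OF g D inj_on_id2 fin]) blast
  \<comment> \<open>The starting radius \<open>\<alpha>\<close> of the shifted pole count makes its relative error \<open>1/\<alpha>\<close>.\<close>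
  define C7 where "C7 = integrated_count (shifted_pole_count f) \<alpha>"
  define C where "C = C1 - C5 + C6 + C7 - (\<Sum>a\<in>A. C2 a) + (\<Sum>a\<in>A. C3 a) + 2 * (\<Sum>a\<in>A. difference_factor \<alpha> * C3 a + C4 a)"
  show ?thesis
  proof (rule that[of C])
    fix r R assume r: "good_radius f A r" and R: "good_radius f A R" and ineq: "2 * \<alpha> \<le> r" "r + 2 * \<alpha> \<le> R" "R \<le> r + 3 * \<alpha>"
    have r1: "1 \<le> r" "1 \<le> R" and rf: "generic_radius f r" "generic_radius f R" "generic_radius (fwd_diff f) r"
      using r R by (auto simp: good_radius_def)
    have rh: "generic_radius (h a) r" "generic_radius (h a) R" "\<forall>b\<in>singular_set (h a). norm (b - 1) \<noteq> r" if "a \<in> A" for a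
      using r R that by (auto simp: good_radius_def h_def)
    define L where "L a z = \<bar>ln (norm (h a (z + 1))) - ln (norm (h a z))\<bar>" for a z
    define N where "N = integrated_count (pole_count f)"
    define T where "T s = characteristic s f" for s
    have NT: "0 \<le> N s" "generic_radius f s \<Longrightarrow> N s \<le> T s" if "1 \<le> s" for s
      using integrated_counts_nonneg(2)[OF f that] proximity_nonneg[of f s] by (auto simp: N_def T_def characteristic_def)
    have iL: "(\<lambda>t. L a (of_real r * cis t)) integrable_on {0..2*pi}" if "a \<in> A" for a
      unfolding L_def using integrable_abs_log_difference[of "h a" r] rh[OF that] by simp
    have iP: "(\<lambda>t. log_plus (norm (inverse (h a (of_real r * cis t))))) integrable_on {0..2*pi}" if "a \<in> A" for a
      by (intro integrable_on_circle[OF rh(1)[OF that], of "\<lambda>w. log_plus (norm (inverse w))"] continuous_intros) auto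
    have iD: "(\<lambda>t. ln (norm (fwd_diff f (of_real r * cis t)))) integrable_on {0..2*pi}"
      by (intro integrable_on_circle[OF rf(3), of "\<lambda>w. ln (norm w)"] continuous_intros) auto
    have iF: "(\<lambda>t. log_plus (norm (f (of_real r * cis t)))) integrable_on {0..2*pi}"
      by (intro integrable_on_circle[OF rf(1), of "\<lambda>w. log_plus (norm w)"] continuous_intros)
    have "(\<Sum>a\<in>A. proximity r (\<lambda>z. inverse (h a z))) = circle_mean (\<lambda>z. \<Sum>a\<in>A. log_plus (norm (inverse (h a z)))) r"
      unfolding proximity_circle_mean by (rule circle_mean_sum[symmetric, OF fin iP])
    also have "\<dots> \<le> circle_mean (\<lambda>z. (-1) * ln (norm (fwd_diff f z)) + (log_plus (norm (f z)) + (2 * (\<Sum>a\<in>A. L a z) + C1))) r"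
    proof (rule circle_mean_mono)
      show "(\<lambda>t. \<Sum>a\<in>A. log_plus (norm (inverse (h a (of_real r * cis t))))) integrable_on {0..2*pi}"
        by (intro integrable_sum fin iP)
      show "(\<lambda>t. (-1) * ln (norm (fwd_diff f (of_real r * cis t))) + (log_plus (norm (f (of_real r * cis t))) + (2 * (\<Sum>a\<in>A. L a (of_real r * cis t)) + C1))) integrable_on {0..2*pi}"
        by (intro integrable_add integrable_on_mult_right integrable_sum fin iL iD iF integrable_const_ivl)
      fix t
      define z where "z = of_real r * cis t"
      have nz: "norm z = r" using r1 by (simp add: z_def)
      have "f z \<noteq> a \<and> f (z + 1) \<noteq> a" if "a \<in> A" for a
      proof -
        have "z \<notin> singular_set (h a)" "z + 1 \<notin> singular_set (h a)"
          using rh(1,3)[OF that] nz bspec[OF rh(3)[OF that], of "z + 1"] by (auto simp: generic_radius_def)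
        then show ?thesis by (auto simp: singular_set_def h_def)
      qed
      moreover have "fwd_diff f z \<noteq> 0" using circle_generic(1)[of "fwd_diff f" z] rf(3) nz by simp
      ultimately have "(\<Sum>a\<in>A. log_plus (inverse (norm (f z - a)))) \<le> - ln (norm (f (z + 1) - f z)) + log_plus (norm (f z))
       + 2 * (\<Sum>a\<in>A. \<bar>ln (norm (f (z + 1) - a)) - ln (norm (f z - a))\<bar>) + C1"
        by (intro C1) (auto simp: fwd_diff_def)
      then show "(\<Sum>a\<in>A. log_plus (norm (inverse (h a (of_real r * cis t)))))
        \<le> (-1) * ln (norm (fwd_diff f (of_real r * cis t))) + (log_plus (norm (f (of_real r * cis t))) + (2 * (\<Sum>a\<in>A. L a (of_real r * cis t)) + C1))"
        unfolding z_def[symmetric] by (simp add: h_def L_def fwd_diff_def norm_inverse)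
    qed
    also have "\<dots> = - circle_mean (\<lambda>z. ln (norm (fwd_diff f z))) r + (proximity r f + (2 * (\<Sum>a\<in>A. circle_mean (L a) r) + C1))"
    proof -
      have i1: "(\<lambda>t. 2 * (\<Sum>a\<in>A. L a (of_real r * cis t))) integrable_on {0..2*pi}"
        by (intro integrable_on_mult_right integrable_sum fin iL)
      have i2: "(\<lambda>t. 2 * (\<Sum>a\<in>A. L a (of_real r * cis t)) + C1) integrable_on {0..2*pi}"
        by (intro integrable_add i1 integrable_const_ivl)
      have i3: "(\<lambda>t. log_plus (norm (f (of_real r * cis t))) + (2 * (\<Sum>a\<in>A. L a (of_real r * cis t)) + C1)) integrable_on {0..2*pi}"
        by (intro integrable_add i2 iF)
      have i4: "(\<lambda>t. (-1) * ln (norm (fwd_diff f (of_real r * cis t)))) integrable_on {0..2*pi}"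
        by (intro integrable_on_mult_right iD)
      have "circle_mean (\<lambda>z. (-1) * ln (norm (fwd_diff f z)) + (log_plus (norm (f z)) + (2 * (\<Sum>a\<in>A. L a z) + C1))) r
         = circle_mean (\<lambda>z. (-1) * ln (norm (fwd_diff f z))) r + circle_mean (\<lambda>z. log_plus (norm (f z)) + (2 * (\<Sum>a\<in>A. L a z) + C1)) r"
        by (rule circle_mean_add[OF i4 i3])
      also have "circle_mean (\<lambda>z. log_plus (norm (f z)) + (2 * (\<Sum>a\<in>A. L a z) + C1)) r
        = circle_mean (\<lambda>z. log_plus (norm (f z))) r + circle_mean (\<lambda>z. 2 * (\<Sum>a\<in>A. L a z) + C1) r"
        by (rule circle_mean_add[OF iF i2])
      also have "circle_mean (\<lambda>z. 2 * (\<Sum>a\<in>A. L a z) + C1) r = circle_mean (\<lambda>z. 2 * (\<Sum>a\<in>A. L a z)) r + circle_mean (\<lambda>z. C1) r"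
        by (rule circle_mean_add[OF i1 integrable_const_ivl])
      also have "circle_mean (\<lambda>z. 2 * (\<Sum>a\<in>A. L a z)) r = 2 * (\<Sum>a\<in>A. circle_mean (L a) r)"
        using circle_mean_sum[OF fin iL] by (simp add: circle_mean_cmult)
      also have "circle_mean (\<lambda>z. (-1) * ln (norm (fwd_diff f z))) r = - circle_mean (\<lambda>z. ln (norm (fwd_diff f z))) r"
        by (subst circle_mean_cmult) simp
      finally show ?thesis by (simp only: circle_mean_const proximity_circle_mean)
    qed
    also have "(\<Sum>a\<in>A. circle_mean (L a) r) \<le> (\<Sum>a\<in>A. difference_factor \<alpha> * T R + (difference_factor \<alpha> * C3 a + C4 a))"
    proof (rule sum_mono)
      fix a assume a: "a \<in> A"
      have "circle_mean (L a) r \<le> difference_factor \<alpha> * characteristic R (h a) + C4 a"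
        unfolding L_def by (rule C4[OF rh(1)[OF a] rh(3)[OF a] rh(2)[OF a] ineq])
      also have "characteristic R (h a) \<le> T R + C3 a" using C3[OF rf(2) rh(2)[OF a]] by (simp add: T_def)
      then have "difference_factor \<alpha> * characteristic R (h a) \<le> difference_factor \<alpha> * (T R + C3 a)"
        by (rule mult_left_mono) (rule df0)
      finally show "circle_mean (L a) r \<le> difference_factor \<alpha> * T R + (difference_factor \<alpha> * C3 a + C4 a)"
        by (simp add: distrib_left)
    qed
    also have "(\<Sum>a\<in>A. difference_factor \<alpha> * T R + (difference_factor \<alpha> * C3 a + C4 a))
      = real (card A) * difference_factor \<alpha> * T R + (\<Sum>a\<in>A. difference_factor \<alpha> * C3 a + C4 a)"
      by (simp add: sum.distrib)
    finally have up: "(\<Sum>a\<in>A. proximity r (\<lambda>z. inverse (h a z))) \<le> - (ND r + C5) + (proximity r f +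
        (2 * (real (card A) * difference_factor \<alpha> * T R + (\<Sum>a\<in>A. difference_factor \<alpha> * C3 a + C4 a)) + C1))"
      unfolding C5[OF rf(3)] by simp
    have "(\<Sum>a\<in>A. T r - C3 a - integrated_count (zero_count (h a)) r + C2 a) \<le> (\<Sum>a\<in>A. proximity r (\<lambda>z. inverse (h a z)))"
    proof (rule sum_mono)
      fix a assume a: "a \<in> A"
      show "T r - C3 a - integrated_count (zero_count (h a)) r + C2 a \<le> proximity r (\<lambda>z. inverse (h a z))"
        using C2[OF rh(1)[OF a]] C3[OF rf(1) rh(1)[OF a]] by (simp add: T_def)
    qed
    then have lo: "real (card A) * T r - (\<Sum>a\<in>A. C3 a) - (\<Sum>a\<in>A. integrated_count (zero_count (h a)) r) + (\<Sum>a\<in>A. C2 a)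
       \<le> (\<Sum>a\<in>A. proximity r (\<lambda>z. inverse (h a z)))"
      by (simp add: sum.distrib sum_subtractf)
    have shifted: "integrated_count (shifted_pole_count f) r \<le> N r + 4 / \<alpha> * T R + C7"
    proof -
      have e1: "integrated_count (shifted_pole_count f) r - C7 \<le> (1 + 1 / \<alpha>) * N (r + 1)"
        unfolding C7_def N_def by (rule integrated_shifted_pole_count_le[OF f]) (use \<alpha> ineq in auto)
      have e2: "(1 + 1 / \<alpha>) * N (r + 1) = N (r + 1) + 1 / \<alpha> * N (r + 1)" by (simp add: distrib_right)
      have inc: "N (r + 1) \<le> N r + 3 / \<alpha> * T R"
      proof -
        have "N (r + 1) - N r \<le> R / ((R - (r + 1)) * r) * N R"
          unfolding N_def by (rule integrated_pole_count_increment[OF f]) (use \<alpha> ineq in auto)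
        also have "\<dots> \<le> 3 / \<alpha> * T R"
        proof (rule mult_mono)
          have "R / ((R - (r + 1)) * r) \<le> (3 * r) / (\<alpha> * r)"
            using \<alpha> ineq by (intro frac_le mult_right_mono) auto
          also have "\<dots> = 3 / \<alpha>" using \<alpha> ineq by simp
          finally show "R / ((R - (r + 1)) * r) \<le> 3 / \<alpha>" .
        qed (use NT[OF r1(2)] rf \<alpha> in auto)
        finally show ?thesis by simp
      qed
      have e3: "1 / \<alpha> * N (r + 1) \<le> 1 / \<alpha> * T R"
      proof (rule mult_left_mono)
        have "N (r + 1) \<le> N R"
        proof -
          have "((\<lambda>t. pole_count f t / t) has_integral N R - N (r + 1)) {r + 1..R}"
            unfolding N_def pole_count_step_count[OF f]
            by (rule integrated_count_diff[OF finite_singular_set[OF f]]) (use r1 \<alpha> ineq in auto)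
          then have "0 \<le> N R - N (r + 1)"
            by (rule has_integral_nonneg)
               (use r1 in \<open>auto simp: pole_count_step_count[OF f] step_count_def intro!: divide_nonneg_nonneg sum_nonneg\<close>)
          then show ?thesis by simp
        qed
        then show "N (r + 1) \<le> T R" using NT(2)[OF r1(2) rf(2)] by linarith
      qed (use \<alpha> in auto)
      have "3 / \<alpha> * T R + 1 / \<alpha> * T R = 4 / \<alpha> * T R" by (simp flip: distrib_right add_divide_distrib)
      then show ?thesis using e1 e2 e3 inc by linarith
    qed
    have NZ: "N_Delta_zero r f a = integrated_count (zero_count (h a)) r - integrated_count (paired_zero_count (h a)) r" for a
    proof -
      have "n_Delta_zero f a = (\<lambda>t. zero_count (h a) t - paired_zero_count (h a) t)"
        using n_Delta_zero_eq[OF g[of a]] by (simp add: h_def fun_eq_iff)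
      then show ?thesis
        unfolding N_Delta_zero_def zero_count_def paired_zero_count_def
        using r1 finite_singular_set[OF gh[of a]] finite_singular_set_max[OF gh[of a], of "\<lambda>w. norm (w - 1)"]
        by (simp add: integrated_count_minus le_max_iff_disj del: max.bounded_iff)
    qed
    have NP: "N_Delta_pole r f = N r - integrated_count (paired_pole_count f) r"
    proof -
      have "n_Delta_pole f = (\<lambda>t. pole_count f t - paired_pole_count f t)"
        using n_Delta_pole_eq[OF f] by (simp add: fun_eq_iff)
      then show ?thesis
        unfolding N_Delta_pole_def N_def pole_count_step_count[OF f] paired_pole_count_def
        using r1 finite_singular_set[OF f] finite_singular_set_max[OF f, of "\<lambda>w. norm (w + 1)"]
        by (simp add: integrated_count_minus le_max_iff_disj del: max.bounded_iff)
    qed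
    have NZ_sum: "(\<Sum>a\<in>A. N_Delta_zero r f a) = (\<Sum>a\<in>A. integrated_count (zero_count (h a)) r) - (\<Sum>a\<in>A. integrated_count (paired_zero_count (h a)) r)"
      by (simp add: NZ sum_subtractf)
    have T_split: "T r = proximity r f + N r" by (simp add: T_def N_def characteristic_def)
    define P1 P2 P3 P4 where "P1 = real (card A) * difference_factor \<alpha> * T R" and "P2 = 4 / \<alpha> * T R"
      and "P3 = (\<Sum>a\<in>A. difference_factor \<alpha> * C3 a + C4 a)" and "P4 = real (card A) * T r"
    note fold = N_def[symmetric] P1_def[symmetric] P2_def[symmetric] P3_def[symmetric] P4_def[symmetric]
    have "P4 \<le> (\<Sum>a\<in>A. integrated_count (zero_count (h a)) r) - ND r + proximity r f + 2 * P1
        + (C1 - C5 - (\<Sum>a\<in>A. C2 a) + (\<Sum>a\<in>A. C3 a) + 2 * P3)"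
      using up lo unfolding fold unfolding distrib_left by linarith
    moreover have "- ND r \<le> 2 * N r + P2 + C7 + C6 - (\<Sum>a\<in>A. integrated_count (paired_zero_count (h a)) r)
        - integrated_count (paired_pole_count f) r"
      using shifted C6[OF r1(1)] unfolding fold by linarith
    ultimately have "P4 - T r \<le> N_Delta_pole r f + (\<Sum>a\<in>A. N_Delta_zero r f a) + (2 * P1 + P2) + C"
      using NZ_sum T_split NP unfolding C_def fold by linarith
    then show "(real (card A) - 1) * characteristic r f \<le> N_Delta_pole r f + (\<Sum>a\<in>A. N_Delta_zero r f a)
        + (2 * real (card A) * difference_factor \<alpha> + 4 / \<alpha>) * characteristic R f + C"
      by (simp add: T_def P1_def P2_def P4_def left_diff_distrib distrib_right mult.assoc)
  qed
qed

section \<open>Exceptional sets of zero upper density\<close>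

text \<open>
  A variant of zero upper density in terms of real numbers that includes measurability.
\<close>

definition zero_density :: "real set \<Rightarrow> bool" where
  "zero_density E \<longleftrightarrow> E \<in> sets lebesgue \<and>
     (\<forall>\<epsilon>>0. eventually (\<lambda>r. measure lebesgue (E \<inter> {1..r}) \<le> \<epsilon> * r) at_top)"

lemma lmeasurable_Int_interval: "E \<in> sets lebesgue \<Longrightarrow> E \<inter> {a..b::real} \<in> lmeasurable"
  by (metis Int_commute fmeasurable_Int_fmeasurable lmeasurable_interval(1) cbox_interval)

lemma upper_density_zero:
  assumes "zero_density E"
  shows "upper_density E = 0"
proof (rule antisym)
  show "upper_density E \<le> 0"
  proof (rule ccontr)
    assume "\<not> upper_density E \<le> 0"
    then obtain e where "0 < ereal e" and less: "ereal e < upper_density E"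
      using ereal_dense2[of 0 "upper_density E"] by (auto simp: not_le)
    then have e: "0 < e" by simp
    have "eventually (\<lambda>r. measure lebesgue (E \<inter> {1..r}) \<le> e * r \<and> r > 0) at_top"
      using assms e eventually_gt_at_top by (auto simp: zero_density_def intro: eventually_conj)
    then have "eventually (\<lambda>r. ereal (measure lebesgue (E \<inter> {1..r}) / r) \<le> ereal e) at_top"
      by eventually_elim (simp add: pos_divide_le_eq)
    then have "upper_density E \<le> ereal e"
      unfolding upper_density_def by (rule Limsup_bounded)
    then show False using less by simp
  qed
  have "0 \<le> Liminf at_top (\<lambda>r. ereal (measure lebesgue (E \<inter> {1..r}) / r))"
    by (rule Liminf_bounded, rule eventually_mono[OF eventually_gt_at_top[of "0::real"]]) auto
  also have "\<dots> \<le> upper_density E"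
    unfolding upper_density_def by (rule Liminf_le_Limsup) simp
  finally show "0 \<le> upper_density E" .
qed

lemma zero_density_subset:
  assumes "zero_density E" "E' \<subseteq> E" "E' \<in> sets lebesgue"
  shows "zero_density E'"
  unfolding zero_density_def
proof (intro conjI allI impI)
  fix \<epsilon> :: real assume "0 < \<epsilon>"
  then have "eventually (\<lambda>r. measure lebesgue (E \<inter> {1..r}) \<le> \<epsilon> * r) at_top"
    using assms(1) by (simp add: zero_density_def)
  then show "eventually (\<lambda>r. measure lebesgue (E' \<inter> {1..r}) \<le> \<epsilon> * r) at_top"
  proof eventually_elim
    case (elim r)
    have "measure lebesgue (E' \<inter> {1..r}) \<le> measure lebesgue (E \<inter> {1..r})"
      using assms
      by (intro measure_mono_fmeasurable[OF _ fmeasurableD[OF lmeasurable_Int_interval] lmeasurable_Int_interval])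
         (auto simp: zero_density_def)
    then show ?case using elim by simp
  qed
qed fact

lemma zero_density_Un:
  assumes "zero_density A" "zero_density B"
  shows "zero_density (A \<union> B)"
  unfolding zero_density_def
proof (intro conjI allI impI)
  show "A \<union> B \<in> sets lebesgue" using assms by (auto simp: zero_density_def)
  fix \<epsilon> :: real assume "0 < \<epsilon>"
  then have "0 < \<epsilon> / 2" by simp
  then have "eventually (\<lambda>r. measure lebesgue (A \<inter> {1..r}) \<le> \<epsilon> / 2 * r) at_top"
    "eventually (\<lambda>r. measure lebesgue (B \<inter> {1..r}) \<le> \<epsilon> / 2 * r) at_top"
    using assms unfolding zero_density_def by blast+
  then show "eventually (\<lambda>r. measure lebesgue ((A \<union> B) \<inter> {1..r}) \<le> \<epsilon> * r) at_top"
  proof eventually_elim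
    case (elim r)
    have "measure lebesgue ((A \<union> B) \<inter> {1..r}) \<le> measure lebesgue (A \<inter> {1..r}) + measure lebesgue (B \<inter> {1..r})"
      unfolding Int_Un_distrib2 using assms
      by (intro measure_Un_le fmeasurableD[OF lmeasurable_Int_interval]) (auto simp: zero_density_def)
    then show ?case using elim by simp
  qed
qed

lemma zero_density_countable:
  assumes "countable A" shows "zero_density A"
proof -
  have n: "A \<in> null_sets lebesgue"
    using countable_imp_null_set_lborel[OF assms] null_sets_completionI by blast
  have "measure lebesgue (A \<inter> {1..r}) = 0" for r
  proof -
    have "A \<inter> {1..r} \<in> null_sets lebesgue"
      using countable_imp_null_set_lborel[of "A \<inter> {1..r}"] assms null_sets_completionI by blast
    then show ?thesis by (simp add: measure_eq_0_null_sets)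
  qed
  moreover have "eventually (\<lambda>r. 0 \<le> \<epsilon> * r) at_top" if "0 < \<epsilon>" for \<epsilon> :: real
    using eventually_ge_at_top[of 0] by eventually_elim (use that in auto)
  ultimately show ?thesis using n by (auto simp: zero_density_def)
qed

text \<open>
  Cut the half-line into blocks of length \<open>h\<close>. Every block on which \<open>T\<close> doubles contributes \<open>ln 2\<close> to the
  growth of \<open>ln T\<close>, and \<open>ln T(r) = o(r)\<close> leaves room for \<open>o(r)\<close> such blocks.
\<close>

lemma slow_growth_outside_zero_density:
  fixes T :: "real \<Rightarrow> real"
  assumes mono: "\<And>x y. 1 \<le> x \<Longrightarrow> x \<le> y \<Longrightarrow> T x \<le> T y" and T1: "\<And>x. 1 \<le> x \<Longrightarrow> 1 \<le> T x"
    and slow: "\<And>\<epsilon>. 0 < \<epsilon> \<Longrightarrow> eventually (\<lambda>x. ln (T x) \<le> \<epsilon> * x) at_top" and h: "0 < h"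
  obtains E where "zero_density E" "\<And>r. 1 \<le> r \<Longrightarrow> r \<notin> E \<Longrightarrow> T (r + h) \<le> 2 * T r"
proof -
  \<comment> \<open>The endpoints of the blocks. If \<open>T\<close> doubles between \<open>r\<close> and \<open>r + h\<close>, it doubles over the two blocks
    that contain these points, which is recorded in \<open>K\<close>.\<close>
  define p where "p k = 1 + real k * h" for k
  have p1: "1 \<le> p k" for k using h by (simp add: p_def)
  have pm: "p i \<le> p j" if "i \<le> j" for i j using that h by (simp add: p_def mult_right_mono)
  define l where "l k = ln (T (p k))" for k
  have lm: "l i \<le> l j" if "i \<le> j" for i j
    unfolding l_def using mono[OF p1 pm[OF that]] T1[OF p1[of i]] T1[OF p1[of j]] by simp
  have l0: "0 \<le> l k" for k unfolding l_def using T1[OF p1[of k]] by simp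
  define K where "K = {k. 2 * T (p k) < T (p (k + 2))}"
  define E where "E = (\<Union>k\<in>K. {p k..p (Suc k)})"
  have cnt: "real (card (K \<inter> {..<n})) * ln 2 \<le> 2 * l (n + 1)" for n
  proof -
    have "real (card (K \<inter> {..<n})) * ln 2 = (\<Sum>k\<in>K \<inter> {..<n}. ln 2)" by simp
    also have "\<dots> \<le> (\<Sum>k\<in>K \<inter> {..<n}. l (k + 2) - l k)"
    proof (rule sum_mono)
      fix k assume "k \<in> K \<inter> {..<n}"
      then have k: "2 * T (p k) < T (p (k + 2))" by (simp add: K_def)
      have pos: "0 < T (p k)" using T1[OF p1[of k]] by simp
      have "ln 2 + l k = ln (2 * T (p k))" unfolding l_def using pos by (simp add: ln_mult)
      also have "\<dots> \<le> l (k + 2)" unfolding l_def using k pos by simp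
      finally show "ln 2 \<le> l (k + 2) - l k" by simp
    qed
    also have "\<dots> \<le> (\<Sum>k<n. l (k + 2) - l k)"
      by (rule sum_mono2) (auto simp: lm)
    also have "\<dots> = l (n + 1) + l n - l 1 - l 0"
      by (induction n) auto
    also have "\<dots> \<le> 2 * l (n + 1)" using lm[of n "n + 1"] l0[of 1] l0[of 0] by simp
    finally show ?thesis .
  qed
  have Em: "E \<in> sets lebesgue" unfolding E_def by (intro sets.countable_UN') auto
  have meas: "measure lebesgue (E \<inter> {1..r}) \<le> 2 * h / ln 2 * ln (T (r + 2 * h))" if r: "1 \<le> r" for r
  proof -
    define n where "n = nat \<lfloor>(r - 1) / h\<rfloor> + 1"
    have fl: "real (nat \<lfloor>(r - 1) / h\<rfloor>) \<le> (r - 1) / h" using r h by simp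
    have kn: "k < n" if "p k \<le> r" for k
    proof -
      have "real k \<le> (r - 1) / h" using that h by (simp add: p_def pos_le_divide_eq)
      then have "int k \<le> \<lfloor>(r - 1) / h\<rfloor>" by (simp add: le_floor_iff)
      then show ?thesis by (simp add: n_def)
    qed
    have "E \<inter> {1..r} \<subseteq> (\<Union>k\<in>K \<inter> {..<n}. {p k..p (Suc k)})"
    proof
      fix x assume "x \<in> E \<inter> {1..r}"
      then obtain k where "k \<in> K" "p k \<le> x" "x \<le> p (Suc k)" "x \<le> r" by (auto simp: E_def)
      then show "x \<in> (\<Union>k\<in>K \<inter> {..<n}. {p k..p (Suc k)})" using kn[of k] by auto
    qed
    then have "measure lebesgue (E \<inter> {1..r}) \<le> measure lebesgue (\<Union>k\<in>K \<inter> {..<n}. {p k..p (Suc k)})"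
      by (rule measure_mono_fmeasurable[OF _ fmeasurableD[OF lmeasurable_Int_interval[OF Em]]])
         (auto intro!: fmeasurable.finite_UN)
    also have "\<dots> \<le> (\<Sum>k\<in>K \<inter> {..<n}. measure lebesgue {p k..p (Suc k)})"
      by (rule measure_UNION_le) auto
    also have "\<dots> = real (card (K \<inter> {..<n})) * h"
      using h pm by (simp add: p_def distrib_right)
    also have "\<dots> = real (card (K \<inter> {..<n})) * ln 2 * (h / ln 2)" by simp
    also have "\<dots> \<le> 2 * l (n + 1) * (h / ln 2)"
      using cnt[of n] h by (intro mult_right_mono) auto
    also have "\<dots> \<le> 2 * ln (T (r + 2 * h)) * (h / ln 2)"
    proof -
      have "real n * h \<le> r - 1 + h" using fl h by (simp add: n_def distrib_right pos_le_divide_eq)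
      then have "p (n + 1) \<le> r + 2 * h" using h by (simp add: p_def distrib_right)
      then have "l (n + 1) \<le> ln (T (r + 2 * h))"
        unfolding l_def using mono[OF p1] T1[OF p1[of "n + 1"]] T1[of "r + 2 * h"] r h by auto
      then show ?thesis using h by (intro mult_right_mono) auto
    qed
    finally show ?thesis by (simp add: mult.commute mult.left_commute)
  qed
  have "zero_density E"
    unfolding zero_density_def
  proof (intro conjI Em allI impI)
    fix \<epsilon> :: real assume e: "0 < \<epsilon>"
    define \<eta> where "\<eta> = \<epsilon> * ln 2 / (4 * h)"
    have eta: "0 < \<eta>" using e h by (simp add: \<eta>_def)
    have "eventually (\<lambda>r. ln (T (r + 2 * h)) \<le> \<eta> * (r + 2 * h)) at_top"
      using slow[OF eta] filterlim_tendsto_add_at_top[OF tendsto_const[of "2*h"] filterlim_ident]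
      by (auto simp: filterlim_iff add.commute)
    then show "eventually (\<lambda>r. measure lebesgue (E \<inter> {1..r}) \<le> \<epsilon> * r) at_top"
      using eventually_ge_at_top[of "max 1 (2*h)"]
    proof eventually_elim
      case (elim r)
      have "measure lebesgue (E \<inter> {1..r}) \<le> 2 * h / ln 2 * ln (T (r + 2 * h))"
        by (rule meas) (use elim in auto)
      also have "\<dots> \<le> 2 * h / ln 2 * (\<eta> * (2 * r))"
      proof (rule mult_left_mono)
        have "\<eta> * (r + 2 * h) \<le> \<eta> * (2 * r)" using elim eta by (intro mult_left_mono) auto
        then show "ln (T (r + 2 * h)) \<le> \<eta> * (2 * r)" using elim by linarith
      qed (use h in auto)
      also have "\<dots> = \<epsilon> * r" using h by (simp add: \<eta>_def)
      finally show ?case .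
    qed
  qed
  moreover have "T (r + h) \<le> 2 * T r" if r: "1 \<le> r" "r \<notin> E" for r
  proof (rule ccontr)
    assume c: "\<not> T (r + h) \<le> 2 * T r"
    define k where "k = nat \<lfloor>(r - 1) / h\<rfloor>"
    have fl: "real k \<le> (r - 1) / h" "(r - 1) / h < real k + 1"
      unfolding k_def using r h by (auto simp: le_floor_iff)
    have pk: "p k \<le> r" "r \<le> p (Suc k)" "r + h \<le> p (k + 2)"
      using fl h by (auto simp: p_def pos_le_divide_eq pos_divide_less_eq algebra_simps)
    have "T (p k) \<le> T r" "T (r + h) \<le> T (p (k + 2))"
      using pk p1 r h by (auto intro!: mono)
    then have "k \<in> K" using c by (simp add: K_def)
    then show False using pk r by (auto simp: E_def)
  qed
  ultimately show ?thesis by (rule that)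
qed

text \<open>
  For each \<open>\<delta> = 1/(j+1)\<close> there is an exceptional set of its own. Switching from one to the next at a
  sufficiently sparse sequence of radii makes a single one out of them.
\<close>

lemma diagonal_zero_density:
  fixes S T :: "real \<Rightarrow> real"
  assumes ex: "\<And>\<delta>. 0 < \<delta> \<Longrightarrow> \<exists>E. zero_density E \<and> eventually (\<lambda>r. r \<notin> E \<longrightarrow> 0 \<le> T r \<and> S r \<le> \<delta> * T r) at_top"
  obtains E where "zero_density E" "\<And>\<delta>. 0 < \<delta> \<Longrightarrow> eventually (\<lambda>r. r \<notin> E \<longrightarrow> 0 \<le> T r \<and> S r \<le> \<delta> * T r) at_top"
proof -
  have "\<forall>j. \<exists>E. zero_density E \<and> eventually (\<lambda>r. r \<notin> E \<longrightarrow> 0 \<le> T r \<and> S r \<le> 1 / real (Suc j) * T r) at_top"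
    by (intro allI ex) simp
  then obtain A where A: "\<And>j. zero_density (A j)"
    "\<And>j. eventually (\<lambda>r. r \<notin> A j \<longrightarrow> 0 \<le> T r \<and> S r \<le> 1 / real (Suc j) * T r) at_top" by metis
  define F where "F j = (\<Union>i\<le>j. A i)" for j
  have Fd: "zero_density (F j)" for j
  proof (induction j)
    case 0
    then show ?case using A by (simp add: F_def)
  next
    case (Suc j)
    have "F (Suc j) = F j \<union> A (Suc j)" by (auto simp: F_def atMost_Suc)
    then show ?case using zero_density_Un[OF Suc A(1)] by simp
  qed
  have Fm: "F j \<in> sets lebesgue" for j using Fd by (simp add: zero_density_def)
  have Finc: "F i \<subseteq> F j" if "i \<le> j" for i j using that by (force simp: F_def)
  have "\<forall>j. \<exists>\<rho>. \<forall>r\<ge>\<rho>. measure lebesgue (F j \<inter> {1..r}) \<le> 1 / real (Suc j) * r \<and>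
      (r \<notin> A j \<longrightarrow> 0 \<le> T r \<and> S r \<le> 1 / real (Suc j) * T r)"
  proof
    fix j
    have "eventually (\<lambda>r. measure lebesgue (F j \<inter> {1..r}) \<le> 1 / real (Suc j) * r \<and>
      (r \<notin> A j \<longrightarrow> 0 \<le> T r \<and> S r \<le> 1 / real (Suc j) * T r)) at_top"
    proof (rule eventually_conj[OF _ A(2)])
      have "\<forall>\<epsilon>>0. eventually (\<lambda>r. measure lebesgue (F j \<inter> {1..r}) \<le> \<epsilon> * r) at_top"
        using Fd[of j] by (simp add: zero_density_def)
      then show "eventually (\<lambda>r. measure lebesgue (F j \<inter> {1..r}) \<le> 1 / real (Suc j) * r) at_top"
        by (rule allE[of _ "1 / real (Suc j)"]) simp
    qed
    then show "\<exists>\<rho>. \<forall>r\<ge>\<rho>. measure lebesgue (F j \<inter> {1..r}) \<le> 1 / real (Suc j) * r \<and>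
      (r \<notin> A j \<longrightarrow> 0 \<le> T r \<and> S r \<le> 1 / real (Suc j) * T r)"
      by (simp add: eventually_at_top_linorder)
  qed
  then obtain \<rho> where \<rho>: "\<And>j r. \<rho> j \<le> r \<Longrightarrow> measure lebesgue (F j \<inter> {1..r}) \<le> 1 / real (Suc j) * r"
    "\<And>j r. \<rho> j \<le> r \<Longrightarrow> r \<notin> A j \<Longrightarrow> 0 \<le> T r \<and> S r \<le> 1 / real (Suc j) * T r" by metis
  \<comment> \<open>An increasing unbounded sequence above \<open>\<rho>\<close>, at which the sets are switched.\<close>
  define \<sigma> where "\<sigma> j = (\<Sum>i\<le>j. \<bar>\<rho> i\<bar> + 1)" for j
  have \<sigma>S: "\<sigma> (Suc j) = \<sigma> j + (\<bar>\<rho> (Suc j)\<bar> + 1)" for j by (simp add: \<sigma>_def)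
  have \<sigma>: "\<rho> j \<le> \<sigma> j" "real j < \<sigma> j" for j
  proof -
    show "real j < \<sigma> j" by (induction j) (auto simp: \<sigma>S, simp add: \<sigma>_def)
    show "\<rho> j \<le> \<sigma> j"
    proof (cases j)
      case (Suc i)
      have "0 \<le> \<sigma> i" by (auto simp: \<sigma>_def intro!: sum_nonneg)
      then show ?thesis using Suc by (simp add: \<sigma>S)
    qed (simp add: \<sigma>_def)
  qed
  have \<sigma>m: "\<sigma> i \<le> \<sigma> j" if "i \<le> j" for i j
    using that by (rule lift_Suc_mono_le[rotated]) (simp add: \<sigma>S)
  define E where "E = (\<Union>i. F i \<inter> {\<sigma> i..<\<sigma> (Suc i)})"
  have Em: "E \<in> sets lebesgue" unfolding E_def by (intro sets.countable_UN sets.Int) (auto simp: Fm)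
  have block: "\<exists>i\<ge>j. \<sigma> i \<le> r \<and> r < \<sigma> (Suc i)" if r: "\<sigma> j \<le> r" for j r
  proof -
    obtain k where "r < real k" using reals_Archimedean2 by blast
    then have ex: "r < \<sigma> (Suc k)" using \<sigma>(2)[of "Suc k"] by simp
    define i where "i = (LEAST k. r < \<sigma> (Suc k))"
    have i: "r < \<sigma> (Suc i)" unfolding i_def by (rule LeastI) (rule ex)
    have "\<sigma> i \<le> r"
    proof (cases i)
      case 0
      then show ?thesis using r \<sigma>m[of 0 j] by simp
    next
      case (Suc i')
      then have "\<not> r < \<sigma> (Suc i')" using not_less_Least[of i' "\<lambda>k. r < \<sigma> (Suc k)"] by (simp add: i_def)
      then show ?thesis using Suc by simp
    qed
    moreover have "j \<le> i"
      using \<sigma>m[of "Suc i" j] i r by (cases "j \<le> i") auto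
    ultimately show ?thesis using i by blast
  qed
  have inE: "r \<in> E \<longleftrightarrow> r \<in> F i" if "\<sigma> i \<le> r" "r < \<sigma> (Suc i)" for i r
  proof
    assume "r \<in> E"
    then obtain i' where i': "r \<in> F i'" "\<sigma> i' \<le> r" "r < \<sigma> (Suc i')" by (auto simp: E_def)
    have "i' \<le> i" using \<sigma>m[of "Suc i" i'] that i' by (cases "i' \<le> i") auto
    then show "r \<in> F i" using Finc i' by blast
  qed (use that in \<open>auto simp: E_def\<close>)
  have small: "1 / real (Suc j) \<le> \<delta>" if "0 < \<delta>" "j = nat \<lceil>1 / \<delta>\<rceil>" for \<delta> j
  proof -
    have "1 / \<delta> \<le> real (Suc j)" using that by (simp add: of_nat_ceiling) linarith
    then have "1 \<le> \<delta> * real (Suc j)" using that(1) by (simp only: pos_divide_le_eq mult.commute)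
    then show ?thesis by (subst pos_divide_le_eq) auto
  qed
  show ?thesis
  proof (rule that)
    show "zero_density E"
      unfolding zero_density_def
    proof (intro conjI Em allI impI)
      fix \<epsilon> :: real assume e: "0 < \<epsilon>"
      define j where "j = nat \<lceil>1 / \<epsilon>\<rceil>"
      show "eventually (\<lambda>r. measure lebesgue (E \<inter> {1..r}) \<le> \<epsilon> * r) at_top"
        using eventually_ge_at_top[of "\<sigma> j"]
      proof eventually_elim
        case (elim r)
        obtain i where i: "j \<le> i" "\<sigma> i \<le> r" "r < \<sigma> (Suc i)" using block[OF elim] by blast
        have r0: "0 < r" using \<sigma>(2)[of i] i by linarith
        have "E \<inter> {1..r} \<subseteq> F i \<inter> {1..r}"
        proof
          fix x assume x: "x \<in> E \<inter> {1..r}"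
          then obtain i' where i': "x \<in> F i'" "\<sigma> i' \<le> x" by (auto simp: E_def)
          have "i' \<le> i" using \<sigma>m[of "Suc i" i'] x i i' by (cases "i' \<le> i") auto
          then show "x \<in> F i \<inter> {1..r}" using Finc x i' by blast
        qed
        then have "measure lebesgue (E \<inter> {1..r}) \<le> measure lebesgue (F i \<inter> {1..r})"
          by (rule measure_mono_fmeasurable[OF _ fmeasurableD[OF lmeasurable_Int_interval[OF Em]] lmeasurable_Int_interval[OF Fm]])
        also have "\<dots> \<le> 1 / real (Suc i) * r" using \<rho>(1)[of i r] \<sigma>(1)[of i] i by linarith
        also have "\<dots> \<le> 1 / real (Suc j) * r" using i r0 by (intro mult_right_mono divide_left_mono) auto
        also have "\<dots> \<le> \<epsilon> * r" using small[OF e j_def] r0 by (intro mult_right_mono) auto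
        finally show ?case .
      qed
    qed
    fix \<delta> :: real assume d: "0 < \<delta>"
    define j where "j = nat \<lceil>1 / \<delta>\<rceil>"
    show "eventually (\<lambda>r. r \<notin> E \<longrightarrow> 0 \<le> T r \<and> S r \<le> \<delta> * T r) at_top"
      using eventually_ge_at_top[of "\<sigma> j"]
    proof eventually_elim
      case (elim r)
      obtain i where i: "j \<le> i" "\<sigma> i \<le> r" "r < \<sigma> (Suc i)" using block[OF elim] by blast
      show ?case
      proof
        assume "r \<notin> E"
        then have "r \<notin> F i" using inE i by blast
        then have "r \<notin> A i" by (auto simp: F_def)
        then have *: "0 \<le> T r" "S r \<le> 1 / real (Suc i) * T r" using \<rho>(2)[of i r] \<sigma>(1)[of i] i by force+
        have "1 / real (Suc i) \<le> 1 / real (Suc j)" using i by (intro divide_left_mono) auto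
        then have "1 / real (Suc i) \<le> \<delta>" using small[OF d j_def] by linarith
        then have "1 / real (Suc i) * T r \<le> \<delta> * T r" using * by (intro mult_right_mono)
        then show "0 \<le> T r \<and> S r \<le> \<delta> * T r" using * by linarith
      qed
    qed
  qed
qed

section \<open>The second main theorem for the difference operator\<close>

lemma good_radius_between:
  assumes g: "\<And>a. nonzero_meromorphic (\<lambda>z. f z - a)" and D: "nonzero_meromorphic (fwd_diff f)" and fin: "finite A"
    and u: "1 \<le> u" "u < v"
  obtains R where "good_radius f A R" "u < R" "R < v"
proof -
  have "uncountable {u<..<v}" using u by (simp add: uncountable_open_interval)
  moreover have "countable {r. 1 \<le> r \<and> \<not> good_radius f A r}" by (rule countable_bad_radii[OF g D fin])
  ultimately have "\<not> {u<..<v} \<subseteq> {r. 1 \<le> r \<and> \<not> good_radius f A r}" using countable_subset by blast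
  then show ?thesis using that u by auto
qed

text \<open>
  The function attains some value \<open>a\<close>, at \<open>z0\<close> say. This single point contributes \<open>ln r + O(1)\<close> to the
  integrated count of the zeros of \<open>f - a\<close>, which the first main theorem bounds by the characteristic.
\<close>

lemma characteristic_tendsto_infinity:
  assumes g: "\<And>a. nonzero_meromorphic (\<lambda>z. f z - a)"
  obtains a where "\<And>M. eventually (\<lambda>r. generic_radius f r \<longrightarrow> generic_radius (\<lambda>z. f z - a) r \<longrightarrow> M \<le> characteristic r f) at_top"
proof -
  have f: "nonzero_meromorphic f" using g[of 0] by simp
  have "uncountable (UNIV :: complex set)" by (rule uncountable_UNIV_complex)
  then have "singular_set f \<noteq> UNIV" using countable_singular_set[OF f] by auto
  then obtain z0 where z0: "f analytic_on {z0}" by (auto simp: singular_set_def)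
  define h where "h = (\<lambda>z. f z - f z0)"
  have gh: "nonzero_meromorphic h" unfolding h_def by (rule g)
  have ah: "h analytic_on {z0}" unfolding h_def by (intro analytic_intros z0)
  have z0S: "z0 \<in> singular_set h" by (simp add: singular_set_def h_def)
  have iz: "isolated_zero h z0"
    using nonzero_meromorphicD(2)[OF gh, of z0] isContD[OF analytic_at_imp_isCont[OF ah]]
    by (simp add: isolated_zero_def h_def)
  then have zo: "1 \<le> zero_order h z0"
    using zorder_isolated_zero_pos[OF iz ah] by (simp add: zero_order_def)
  obtain C where C: "\<And>r. generic_radius h r \<Longrightarrow>
    proximity r (\<lambda>z. inverse (h z)) = characteristic r h - integrated_count (zero_count h) r + C"
    by (rule proximity_inverse[OF gh]) blast
  obtain C' where C': "\<And>r. generic_radius f r \<Longrightarrow> generic_radius h r \<Longrightarrow> \<bar>characteristic r h - characteristic r f\<bar> \<le> C'"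
    unfolding h_def by (rule characteristic_minus_const[OF f]) blast
  have lower: "ln r - ln (max 1 (norm z0)) - C - C' \<le> characteristic r f"
    if r: "max 1 (norm z0) \<le> r" "generic_radius f r" "generic_radius h r" for r
  proof -
    have fin: "finite {b \<in> singular_set h. norm b \<le> r}" by (rule finite_singular_set[OF gh])
    have "ln r - ln (max 1 (norm z0)) \<le> real (zero_order h z0) * log_excess (norm z0) r"
    proof -
      have "ln (norm z0) \<le> ln (max 1 (norm z0))" if "z0 \<noteq> 0"
        using that by (subst ln_le_cancel_iff) auto
      then have "ln r - ln (max 1 (norm z0)) \<le> log_excess (norm z0) r"
        using r by (auto simp: log_excess_def max_absorb1)
      also have "\<dots> \<le> real (zero_order h z0) * log_excess (norm z0) r"
        using zo log_excess_nonneg[of "norm z0" r] r mult_right_mono[of 1 "real (zero_order h z0)" "log_excess (norm z0) r"] by simp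
      finally show ?thesis .
    qed
    also have "\<dots> \<le> (\<Sum>b | b \<in> singular_set h \<and> norm b \<le> r. real (zero_order h b) * log_excess (norm b) r)"
      by (rule member_le_sum) (use fin z0S r in \<open>auto intro!: mult_nonneg_nonneg log_excess_nonneg\<close>)
    also have "\<dots> = integrated_count (zero_count h) r"
      unfolding zero_count_def using r by (subst integrated_count_step_count(1)[OF fin]) auto
    finally have 1: "ln r - ln (max 1 (norm z0)) \<le> integrated_count (zero_count h) r" .
    have "0 \<le> proximity r (\<lambda>z. inverse (h z))"
      by (rule proximity_inverse_nonneg[OF r(3)])
    then show ?thesis using 1 C[OF r(3)] C'[OF r(2,3)] by linarith
  qed
  show ?thesis
  proof (rule that)
    fix M
    have "eventually (\<lambda>r::real. M + ln (max 1 (norm z0)) + C + C' \<le> ln r) at_top"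
      using ln_at_top by (simp add: filterlim_at_top)
    then show "eventually (\<lambda>r. generic_radius f r \<longrightarrow> generic_radius (\<lambda>z. f z - f z0) r \<longrightarrow> M \<le> characteristic r f) at_top"
      using eventually_ge_at_top[of "max 1 (norm z0)"]
    proof eventually_elim
      case (elim r)
      then show ?case using lower[of r] by (force simp: h_def)
    qed
  qed
qed

lemma difference_factor_small:
  assumes "0 < \<epsilon>"
  obtains \<alpha> where "2 \<le> \<alpha>" "2 * c * difference_factor \<alpha> + 4 / \<alpha> \<le> \<epsilon>"
proof -
  have "((\<lambda>\<alpha>. 2 * c * difference_factor \<alpha> + 4 / \<alpha>) \<longlongrightarrow> 0) at_top"
    unfolding difference_factor_def by real_asymp
  then have "eventually (\<lambda>\<alpha>. 2 * c * difference_factor \<alpha> + 4 / \<alpha> < \<epsilon>) at_top"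
    using assms by (rule order_tendstoD)
  then have "eventually (\<lambda>\<alpha>. 2 * c * difference_factor \<alpha> + 4 / \<alpha> < \<epsilon> \<and> 2 \<le> \<alpha>) at_top"
    by (rule eventually_conj[OF _ eventually_ge_at_top])
  then obtain \<alpha> where "2 * c * difference_factor \<alpha> + 4 / \<alpha> < \<epsilon>" "2 \<le> \<alpha>"
    using eventually_happens trivial_limit_at_top_linorder by blast
  then show ?thesis using that by force
qed

text \<open>
  The exceptional set consists of the radii where the characteristic more than doubles over the length
  \<open>3\<alpha>\<close>, together with the countably many radii that are not good. Additive constants are absorbed
  because the characteristic is unbounded.
\<close>

lemma second_main_theorem_outside_zero_density:
  assumes f: "f meromorphic_on UNIV" and sub: "subnormal f"
    and nc: "\<not> eventually (\<lambda>z. fwd_diff f z = 0) (cosparse UNIV)"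
    and fin: "finite A" and ne: "A \<noteq> {}" and d: "0 < \<delta>"
  shows "\<exists>E. zero_density E \<and> eventually (\<lambda>r. r \<notin> E \<longrightarrow> 0 \<le> characteristic r f \<and>
     (real (card A) - 1) * characteristic r f - (N_Delta_pole r f + (\<Sum>a\<in>A. N_Delta_zero r f a)) \<le> \<delta> * characteristic r f) at_top"
proof -
  note g = nonconstant_if_fwd_diff_nonzero(1)[OF f nc] and D = nonconstant_if_fwd_diff_nonzero(2)[OF f nc]
  have nf: "nonzero_meromorphic f" using g[of 0] by simp
  define T where "T r = characteristic r f" for r
  define G where "G = {r. good_radius f A r}"
  have Tnn: "0 \<le> T r" if "r \<in> G" for r
    using that characteristic_nonneg[OF nf] by (simp add: G_def T_def good_radius_def)
  have Tm: "T r \<le> T R" if "r \<in> G" "R \<in> G" "r \<le> R" for r R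
    unfolding T_def by (rule characteristic_almost_mono[OF nf]) (use that in \<open>auto simp: G_def good_radius_def\<close>)
  have between: "\<exists>R\<in>G. u < R \<and> R < v" if "1 \<le> u" "u < v" for u v
    using good_radius_between[OF g D fin that] by (auto simp: G_def)
  \<comment> \<open>The characteristic is known to be monotone on \<open>G\<close> only; \<open>U\<close> is an increasing function on the whole
    line that differs from it by at most \<open>1\<close> on \<open>G\<close>.\<close>
  define U where "U x = Sup (insert 0 (T ` {s \<in> G. s \<le> x})) + 1" for x
  have Ub: "t \<le> T R" if "R \<in> G" "x \<le> R" "t \<in> insert 0 (T ` {s \<in> G. s \<le> x})" for x R t
    using that Tm Tnn by auto
  have bdd: "bdd_above (insert 0 (T ` {s \<in> G. s \<le> x}))" for x
  proof -
    obtain R where "R \<in> G" "max 1 x < R" using between[of "max 1 x" "max 1 x + 1"] by auto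
    then show ?thesis using Ub[of R x] by (intro bdd_aboveI[of _ "T R"]) auto
  qed
  have Ule: "U x \<le> T R + 1" if "R \<in> G" "x \<le> R" for x R
    unfolding U_def using Ub[OF that] by (intro add_right_mono cSup_least) auto
  have UT: "T s + 1 \<le> U x" if "s \<in> G" "s \<le> x" for s x
    unfolding U_def using that bdd by (intro add_right_mono cSup_upper) auto
  have U1: "1 \<le> U x" for x unfolding U_def using cSup_upper[OF _ bdd, of 0 x] by simp
  have Umono: "U x \<le> U y" if "x \<le> y" for x y
    unfolding U_def using that bdd by (intro add_right_mono cSup_subset_mono) auto
  have slow: "eventually (\<lambda>x. ln (U x) \<le> \<epsilon> * x) at_top" if e: "0 < \<epsilon>" for \<epsilon>
  proof -
    have "Limsup at_top (\<lambda>r. ereal (ln (T r) / r)) < ereal (\<epsilon> / 2)"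
      using sub e by (simp add: subnormal_def T_def)
    then have "eventually (\<lambda>r. ereal (ln (T r) / r) < ereal (\<epsilon> / 2)) at_top"
      by (rule Limsup_lessD)
    then have "eventually (\<lambda>r. ln (T r) / r < \<epsilon> / 2) at_top" by simp
    then obtain x0 where x0: "\<And>r. x0 \<le> r \<Longrightarrow> ln (T r) / r < \<epsilon> / 2"
      by (auto simp: eventually_at_top_linorder)
    have "eventually (\<lambda>x::real. ln 2 + \<epsilon> / 2 * (x + 1) \<le> \<epsilon> * x) at_top"
      using e by real_asymp
    then show ?thesis
      using eventually_ge_at_top[of "max 1 x0"]
    proof eventually_elim
      case (elim x)
      obtain R where R: "R \<in> G" "x < R" "R < x + 1" using between[of x "x + 1"] elim by auto
      have "T R \<le> exp (\<epsilon> / 2 * (x + 1))"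
      proof (cases "0 < T R")
        case True
        have "ln (T R) \<le> \<epsilon> / 2 * R" using x0[of R] R elim by (simp add: field_simps)
        also have "\<dots> \<le> \<epsilon> / 2 * (x + 1)" using R e by (intro mult_left_mono) auto
        finally show ?thesis using True by (metis exp_le_cancel_iff exp_ln)
      next
        case False
        then show ?thesis by (smt (verit) exp_gt_zero)
      qed
      moreover have "1 \<le> exp (\<epsilon> / 2 * (x + 1))" using e elim by simp
      ultimately have "U x \<le> 2 * exp (\<epsilon> / 2 * (x + 1))"
        using Ule[OF R(1) less_imp_le[OF R(2)]] by linarith
      then have "ln (U x) \<le> ln (2 * exp (\<epsilon> / 2 * (x + 1)))"
        using U1[of x] by (subst ln_le_cancel_iff) auto
      also have "\<dots> = ln 2 + \<epsilon> / 2 * (x + 1)" by (simp add: ln_mult)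
      finally show ?case using elim by simp
    qed
  qed
  obtain \<alpha> where \<alpha>: "2 \<le> \<alpha>" "2 * real (card A) * difference_factor \<alpha> + 4 / \<alpha> \<le> \<delta> / 4"
    using difference_factor_small[of "\<delta> / 4" "real (card A)"] d by auto
  define \<epsilon> where "\<epsilon> = 2 * real (card A) * difference_factor \<alpha> + 4 / \<alpha>"
  have eps: "0 \<le> \<epsilon>" "\<epsilon> \<le> \<delta> / 4" using \<alpha> by (auto simp: \<epsilon>_def difference_factor_def)
  obtain C where C: "\<And>r R. good_radius f A r \<Longrightarrow> good_radius f A R \<Longrightarrow> 2 * \<alpha> \<le> r \<Longrightarrow>
      r + 2 * \<alpha> \<le> R \<Longrightarrow> R \<le> r + 3 * \<alpha> \<Longrightarrow>
      (real (card A) - 1) * characteristic r f \<le> N_Delta_pole r f + (\<Sum>a\<in>A. N_Delta_zero r f a)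
        + (2 * real (card A) * difference_factor \<alpha> + 4 / \<alpha>) * characteristic R f + C"
    by (rule second_main_inequality[OF g D fin ne \<alpha>(1)]) blast
  obtain E1 where E1: "zero_density E1" "\<And>r. 1 \<le> r \<Longrightarrow> r \<notin> E1 \<Longrightarrow> U (r + 3 * \<alpha>) \<le> 2 * U r"
    by (rule slow_growth_outside_zero_density[of U "3 * \<alpha>"]) (use Umono U1 slow \<alpha> in auto)
  obtain a where a: "\<And>M. eventually (\<lambda>r. generic_radius f r \<longrightarrow> generic_radius (\<lambda>z. f z - a) r \<longrightarrow> M \<le> characteristic r f) at_top"
    by (rule characteristic_tendsto_infinity[OF g]) blast
  define E where "E = E1 \<union> ({r. 1 \<le> r \<and> \<not> good_radius f A r} \<union> norm ` singular_set (\<lambda>z. f z - a))"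
  have "zero_density E"
    unfolding E_def
    by (intro zero_density_Un E1 zero_density_countable countable_bad_radii[OF g D fin] countable_image countable_singular_set g)
  moreover have "eventually (\<lambda>r. r \<notin> E \<longrightarrow> 0 \<le> T r \<and>
     (real (card A) - 1) * T r - (N_Delta_pole r f + (\<Sum>a\<in>A. N_Delta_zero r f a)) \<le> \<delta> * T r) at_top"
    using a[of "(2 * \<epsilon> + \<bar>C\<bar>) / (\<delta> / 2)"] eventually_ge_at_top[of "2 * \<alpha>"]
  proof eventually_elim
    case (elim r)
    show ?case
    proof
      assume rE: "r \<notin> E"
      have r1: "1 \<le> r" using elim \<alpha> by simp
      then have rG: "r \<in> G" using rE by (auto simp: E_def G_def)
      then have "generic_radius f r" by (simp add: G_def good_radius_def)
      moreover have "generic_radius (\<lambda>z. f z - a) r" using rE r1 by (force simp: E_def generic_radius_def)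
      ultimately have big: "(2 * \<epsilon> + \<bar>C\<bar>) / (\<delta> / 2) \<le> T r" using elim by (simp add: T_def)
      obtain R where R: "R \<in> G" "r + 2 * \<alpha> < R" "R < r + 3 * \<alpha>"
        using between[of "r + 2 * \<alpha>" "r + 3 * \<alpha>"] r1 \<alpha> by auto
      have "T R + 1 \<le> U (r + 3 * \<alpha>)" by (rule UT) (use R in auto)
      also have "\<dots> \<le> 2 * U r" by (rule E1(2)) (use r1 rE in \<open>auto simp: E_def\<close>)
      also have "\<dots> \<le> 2 * (T r + 1)" using Ule[OF rG order_refl] by simp
      finally have TR: "T R \<le> 2 * T r + 2" by simp
      have "(real (card A) - 1) * T r \<le> N_Delta_pole r f + (\<Sum>a\<in>A. N_Delta_zero r f a) + \<epsilon> * T R + C"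
        unfolding T_def \<epsilon>_def by (rule C) (use rG R elim in \<open>auto simp: G_def\<close>)
      also have "\<epsilon> * T R \<le> \<epsilon> * (2 * T r + 2)" by (rule mult_left_mono[OF TR eps(1)])
      also have "\<dots> = \<epsilon> * (2 * T r) + 2 * \<epsilon>" by (simp add: distrib_left)
      also have "\<epsilon> * (2 * T r) \<le> \<delta> / 4 * (2 * T r)" using eps Tnn[OF rG] by (intro mult_right_mono) auto
      also have "C \<le> \<bar>C\<bar>" by simp
      finally have "(real (card A) - 1) * T r - (N_Delta_pole r f + (\<Sum>a\<in>A. N_Delta_zero r f a)) \<le> \<delta> / 2 * T r + (2 * \<epsilon> + \<bar>C\<bar>)"
        by simp
      also have "2 * \<epsilon> + \<bar>C\<bar> \<le> \<delta> / 2 * T r" using big d by (simp add: pos_divide_le_eq mult.commute)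
      finally show "0 \<le> T r \<and> (real (card A) - 1) * T r - (N_Delta_pole r f + (\<Sum>a\<in>A. N_Delta_zero r f a)) \<le> \<delta> * T r"
        using Tnn[OF rG] by simp
    qed
  qed
  ultimately show ?thesis unfolding T_def by blast
qed

theorem theorem4p1:
  fixes f :: "complex \<Rightarrow> complex" and q :: nat and a :: "nat \<Rightarrow> complex"
  assumes "f meromorphic_on UNIV"
    and "subnormal f"
    and "\<not> eventually (\<lambda>z. fwd_diff f z = 0) (cosparse UNIV)"
    and "q \<ge> 2"
    and "inj_on a {1..q}"
  shows "\<exists>E S. small_error f E S \<and> upper_density E = 0 \<and>
           (\<forall>r>0. (real q - 1) * characteristic r f
                    \<le> N_Delta_pole r f + (\<Sum>k=1..q. N_Delta_zero r f (a k)) + S r)"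
proof -
  define A where "A = a ` {1..q}"
  have A: "finite A" "A \<noteq> {}" "card A = q"
    using assms(4) card_image[OF assms(5)] by (auto simp: A_def)
  define X where "X r = (real q - 1) * characteristic r f - (N_Delta_pole r f + (\<Sum>k=1..q. N_Delta_zero r f (a k)))" for r
  \<comment> \<open>Only an upper bound for the excess \<open>X\<close> is available, so its positive part serves as error term.\<close>
  define S where "S r = max 0 (X r)" for r
  have X: "X r = (real (card A) - 1) * characteristic r f - (N_Delta_pole r f + (\<Sum>c\<in>A. N_Delta_zero r f c))" for r
  proof -
    have "(\<Sum>c\<in>A. N_Delta_zero r f c) = (\<Sum>k=1..q. N_Delta_zero r f (a k))"
      unfolding A_def by (subst sum.reindex[OF assms(5)]) simp
    then show ?thesis by (simp add: X_def A(3))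
  qed
  obtain E where E: "zero_density E" "\<And>\<delta>. 0 < \<delta> \<Longrightarrow>
      eventually (\<lambda>r. r \<notin> E \<longrightarrow> 0 \<le> characteristic r f \<and> X r \<le> \<delta> * characteristic r f) at_top"
    by (rule diagonal_zero_density[of "\<lambda>r. characteristic r f" X])
       (use second_main_theorem_outside_zero_density[OF assms(1-3) A(1,2)] in \<open>auto simp: X\<close>)
  define E' where "E' = E \<inter> {1..}"
  have Em: "E' \<in> sets lebesgue" using E(1) by (auto simp: E'_def zero_density_def)
  have "zero_density E'" by (rule zero_density_subset[OF E(1) _ Em]) (auto simp: E'_def)
  then have "upper_density E' = 0" by (rule upper_density_zero)
  moreover have "S \<in> o[inf at_top (principal (- E'))](\<lambda>r. characteristic r f)"
  proof (rule landau_o.smallI)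
    fix c :: real assume c: "0 < c"
    show "eventually (\<lambda>r. norm (S r) \<le> c * norm (characteristic r f)) (inf at_top (principal (- E')))"
      unfolding eventually_inf_principal using E(2)[OF c] eventually_ge_at_top[of 1]
    proof eventually_elim
      case (elim r)
      show ?case
      proof
        assume "r \<in> - E'"
        then have "0 \<le> characteristic r f" "X r \<le> c * characteristic r f" using elim by (auto simp: E'_def)
        then show "norm (S r) \<le> c * norm (characteristic r f)" using c by (simp add: S_def)
      qed
    qed
  qed
  moreover have "(real q - 1) * characteristic r f \<le> N_Delta_pole r f + (\<Sum>k=1..q. N_Delta_zero r f (a k)) + S r" for r
    by (simp add: S_def X_def)
  ultimately show ?thesis
    using Em by (intro exI[of _ E'] exI[of _ S]) (auto simp: small_error_def E'_def)
qed

end
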